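(* Let $\mathbf u_h\in\boldsymbol V_h$ and let $\beta$ be a component in the set of tracked variables $\mathcal J$. Consider the stabilized problem $$\overline{\mathsf M}(\mathbf u_h^{n+1})\,\delta_tU^{n+1}+\overline{\mathsf K}(\mathbf u_h^{n+1})\,U^{n+1}=\mathsf G$$ with $\mathsf G=0$ (all objects as defined in the context). This problem is local bounds preserving at any region where $u_h^\beta$ has extreme values. That is, at every node $i\in\mathcal N_h$ at which $u_h^\beta$ has a local discrete extremum, the $i$-th (block) equation, written in the form $$\sum_j \overline{\mathsf M}_{ij}\,\delta_t\mathbf u_i^{n+1}+\sum_{j\ne i}\mathsf A_{ij}(\mathbf u_j^{n+1}-\mathbf u_i^{n+1})=\mathbf 0,$$ has $\overline{\mathsf M}_{ij}=m_i\delta_{ij}I_{m\times m}$ with $m_i>0$, $\mathsf A_{ij}$ has non-positive eigenvalues for every $j\neq i$, and $\sum_j\mathsf A_{ij}=\mathbf 0$.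
   Context: Continuous problem. $\Omega\subset\mathbb R^d$ is an open bounded connected Lipschitz domain; the problem is the first-order hyperbolic system $\partial_t\mathbf u+\nabla\cdot\boldsymbol f(\mathbf u)=\boldsymbol g$ with $m$ conserved variables. The paper treats either $m=1$ with $f(u)=\mathbf v u$ ($\mathbf v$ divergence-free), or the Euler equations, $m=d+2$, $\mathbf u=(\rho,\boldsymbol m,\rho E)$ with momentum $\boldsymbol m=\rho\mathbf v$, flux $\boldsymbol f=(\boldsymbol m,\ \boldsymbol m\otimes\mathbf v+p\mathbb I,\ \mathbf v(\rho E+p))$, and ideal gas law $p=(\gamma-1)\rho(E-\tfrac12\|\mathbf v\|^2)$. $\boldsymbol f'$ is the flux Jacobian; for $c\in\mathbb R^d$, $\boldsymbol f'(\mathbf u)\cdot c=\sum_k\boldsymbol f_k'(\mathbf u)c_k$. For each component $\beta$, the boundary is split into inflow $\Gamma_{\rm in}^\beta$ (where $u_h^\beta=\bar u_h^\beta$ is imposed strongly) and outflow $\Gamma_{\rm out}^\beta=\partial\Omega\setminus\Gamma_{\rm in}^\beta$; $\mathbf u_h=\mathbf u_{0h}$ at $t=0$. Mesh and space. $\mathcal T_h$ is a hierarchically refined octree-based quadrilateral/hexahedral mesh with cells $K_e$, 2:1 balanced. $\tilde{\mathcal N}_h$ is the set of all nodes; $\mathcal N_h^{hg}$ is the set of hanging nodes (nodes at the interface between cells of different level belonging only to the finer cells); $\mathcal N_h=\tilde{\mathcal N}_h\setminus\mathcal N_h^{hg}$. $\boldsymbol V_h$ consists of continuous $\mathbb R^m$-valued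 functions that are componentwise $Q_1$ on each cell; $\varphi_i$ is the nodal shape function and $\mathbf u_h=\sum_{i\in\tilde{\mathcal N}_h}\varphi_i\mathbf u_i$. Hanging values satisfy $\mathbf u_k=\sum_{j\in\overline{\mathcal M}(k)}C_{kj}\mathbf u_j$, $C_{kj}=\varphi_j(x_k)$ computed in the neighbouring coarse cell, where $\overline{\mathcal M}(k)$ is the set of nodes constraining $k$; $\mathcal M(i)$ is the set of hanging nodes constrained by $i$. Fluxes are discretized in the same space, $\boldsymbol f_h=\sum_i\varphi_i\boldsymbol f(\mathbf u_i)$ (group FEM), and the constraints are applied also to the fluxes: $\boldsymbol f'(\mathbf u_k)=\sum_{i\in\overline{\mathcal M}(k)}C_{ki}\boldsymbol f'(\mathbf u_i)$ for hanging $k$. $\Omega_i$ is the union of cells containing node $i$, $\mathcal N_h(\Omega_i)$ is the set of $j\in\mathcal N_h$ with $x_j\in\Omega_i$, and $\mathcal N_h(K)$ is the set of nodes in $\mathcal N_h$ lying in $K$. Galerkin matrices. $U^{n+1}$ is the vector of nodal values at $t^{n+1}$, $\delta_tU=\Delta t_{n+1}^{-1}(U^{n+1}-U^n)$. The $m\times m$ blocks are $\mathsf M_{ij}=(\varphi_j,\varphi_i)I_{m\times m}+\mathcal M_{ij}$, $\mathsf K_{ij}=-\sum_k\boldsymbol f'_k(\mathbf u_j^{n+1})(\varphi_j,\partial_k\varphi_i)+\sum_k\boldsymbol f_k'(\mathbf u_j^{n+1})(\varphi_j,n_k\varphi_i)_{\Gamma_{\rm out}}+\mathcal K_{ij}$,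 $\mathsf G_i=(\boldsymbol g,\varphi_i)+\mathcal G_i$, where $\mathcal M,\mathcal K,\mathcal G$ are the terms arising from imposing the conformity constraints. With $c_{ij}^e=(\nabla\varphi_j,\varphi_i)_{K_e}$, the paper writes the assembled convection vectors, constraints included, as $c_{ij}=\sum_e\big(c_{ij}^e+\sum_{k\in\mathcal M(j)}C_{kj}c_{ik}^e+\sum_{k\in\mathcal M(i)}C_{ki}c_{kj}^e+\sum_{k\in\mathcal M(i)\cap\mathcal M(j)}C_{ki}C_{kj}c_{kk}^e\big)$. Roe average and form of the scheme (Euler). $\mathbf u_{ij}$ is the Roe average of $\mathbf u_i,\mathbf u_j$: $\rho_{ij}=\sqrt{\rho_i\rho_j}$, $\mathbf v_{ij}=\frac{\mathbf v_i\sqrt{\rho_i}+\mathbf v_j\sqrt{\rho_j}}{\sqrt{\rho_i}+\sqrt{\rho_j}}$, $H_{ij}=\frac{H_i\sqrt{\rho_i}+H_j\sqrt{\rho_j}}{\sqrt{\rho_i}+\sqrt{\rho_j}}$, $H_i=E_i+p_i/\rho_i$, $a_{ij}=\sqrt{(\gamma-1)(H_{ij}-\|\mathbf v_{ij}\|^2/2)}$. The eigenvalues of $\boldsymbol f'(\mathbf u_{ij})\cdot c$ are $\mathbf v_{ij}\cdot c$ ($d$ times) and $\mathbf v_{ij}\cdot c\pm a_{ij}\|c\|$. The scheme is written in terms of differences $\mathbf u_j-\mathbf u_i$ with the flux Jacobians evaluated at the Roe averages, so that for $j\ne i$ the matrix $\mathsf A_{ij}$ is $\overline{\mathsf K}_{ij}(\mathbf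 u_{ij})=\boldsymbol f'(\mathbf u_{ij})\cdot c_{ij}+\mathsf B_{ij}$, and $\mathsf A_{ii}=-\sum_{j\neq i}\mathsf A_{ij}$. For $m=1$, $\mathsf A_{ij}=\overline{\mathsf K}_{ij}$. Local discrete extremum. $u_h^\beta$ has a local discrete minimum (resp. maximum) at $i\in\mathcal N_h$ if $u_i^\beta\le u_j^\beta$ (resp. $\ge$) for all $j\in\mathcal N_h(\Omega_i)$. Shock detector. $\mathcal J$ is the set of components used to detect inadmissible values of $\mathbf u_h$ ($\mathcal J=\{1\}$ if $m=1$). For $i\in\mathcal N_h$, $j\in\mathcal N_h(\Omega_i)\setminus\{i\}$: $r_{ij}=x_j-x_i$, $\hat r_{ij}=r_{ij}/|r_{ij}|$; $x_{ij}^{\rm sym}$ is the intersection point other than $x_j$ of $\partial\Omega_i$ with the line through $x_i,x_j$; $r_{ij}^{\rm sym}=x_{ij}^{\rm sym}-x_i$; $u_{ij}^{{\rm sym},\beta}=u_h^\beta(x_{ij}^{\rm sym})$; $$[\![\nabla u_h^\beta]\!]_{ij}=\frac{u^\beta_j-u^\beta_i}{|r_{ij}|}+\frac{u^{{\rm sym},\beta}_{ij}-u^\beta_i}{|r^{\rm sym}_{ij}|},\quad \{\!\{|\nabla u^\beta_h\cdot\hat r_{ij}|\}\!\}_{ij}=\frac12\Big(\frac{|u^\beta_j-u^\beta_i|}{|r_{ij}|}+\frac{|u^{{\rm sym},\beta}_{ij}-u^\beta_i|}{|r^{\rm sym}_{ij}|}\Big),$$ $$\alpha_i(u_h^\beta)=\left[\frac{|\sum_j[\![\nabla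 u_h^\beta]\!]_{ij}|}{\sum_j2\{\!\{|\nabla u_h^\beta\cdot\hat r_{ij}|\}\!\}_{ij}}\right]^q\text{ if the denominator is nonzero},\qquad \alpha_i(u_h^\beta)=0\text{ otherwise},$$ sums over $j\in\mathcal N_h(\Omega_i)\setminus\{i\}$, $q>1$. At inflow (Dirichlet) nodes the detector is set to $0$; at outflow nodes, whenever $x_{ij}^{\rm sym}=x_i$, the fraction containing $u_{ij}^{{\rm sym},\beta}$ is dropped. Then $\boldsymbol\alpha_i(\mathbf u_h)=\max_{\beta\in\mathcal J}\alpha_i(u_h^\beta)$ for $i\in\mathcal N_h$, and $\boldsymbol\alpha_k(\mathbf u_h)=\max_{j\in\overline{\mathcal M}(k)}\boldsymbol\alpha_j(\mathbf u_h)$ for $k\in\mathcal N_h^{hg}$. Stabilization. $\ell(i,j)=2\delta_{ij}-1$. For $m=1$: $\mathsf B_{ij}=\nu_{ij}\ell(i,j)$ with $\nu_{ij}=\max\{\alpha_i\mathsf K_{ij},0,\alpha_j\mathsf K_{ji}\}$ for $j\in\mathcal N_h(\Omega_i)\setminus\{i\}$ and $\nu_{ii}=\sum_{j\neq i}\nu_{ij}$. For $m>1$ (Euler): $\mathsf B_{ij}=\sum_{K_e\in\mathcal T_h}\nu^e_{ij}\,\ell(i,j)I_{m\times m}$ where, for $j\in\mathcal N_h(\Omega_i)\setminus\{i\}$, $$\begin{aligned}\nu_{ij}^e=&\max(\boldsymbol\alpha_i\lambda_{ij}^{\max},\boldsymbol\alpha_j\lambda^{\max}_{ji})+\sum_{k\in\mathcal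 M(i)}C_{ki}\max(\boldsymbol\alpha_k\lambda^{\max}_{kj},\boldsymbol\alpha_j\lambda^{\max}_{jk})\\&+\sum_{k\in\mathcal M(j)}C_{kj}\max(\boldsymbol\alpha_i\lambda^{\max}_{ik},\boldsymbol\alpha_k\lambda^{\max}_{ki})+\sum_{k\in\mathcal M(i)\cap\mathcal M(j)}C_{ki}C_{kj}\boldsymbol\alpha_k\lambda^{\max}_{kk},\end{aligned}$$ $\nu^e_{ii}=\sum_{j\in\mathcal N_h(\Omega_i)\setminus\{i\}}\nu^e_{ij}$. Here $\lambda_{ab}^{\max}$ in the definition of $\nu_{ij}^e$ is the spectral radius $\rho(\boldsymbol f'(\mathbf u_{ij})\cdot(\nabla\varphi_b,\varphi_a)_{K_e})$ (the Roe average is that of the conforming pair $i,j$, also when $a$ or $b$ is hanging). Finally $\overline{\mathsf K}_{ij}=\mathsf K_{ij}+\mathsf B_{ij}$ and $\overline{\mathsf M}_{ij}=[1-\max(\boldsymbol\alpha_i,\boldsymbol\alpha_j)]\mathsf M_{ij}+\delta_{ij}\sum_{k\in\mathcal N_h}\max(\boldsymbol\alpha_i,\boldsymbol\alpha_k)\mathsf M_{ik}$.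
   Formalization: Added: detector denominator of u_h^β nonzero at i; values at hanging nodes in Ω_i respect the extremum; i is not an inflow node; the mesh resolves the inflow boundary; nodal density and pressure positive (Euler). ν_ij is used for all pairs i≠j, not only x_j in Ω_i. *)

theory Defs
  imports "HOL-Analysis.Analysis"
begin

section \<open>Domain, surface measure and convection field\<close>

definition lipschitz_domain :: "(real^'d) set \<Rightarrow> bool" where
  "lipschitz_domain \<Omega> \<longleftrightarrow>
     open \<Omega> \<and> connected \<Omega> \<and> bounded \<Omega> \<and> \<Omega> \<noteq> {} \<and>
     (\<forall>p \<in> frontier \<Omega>. \<exists>r > 0. \<exists>e g L.
        norm e = 1 \<and> L-lipschitz_on UNIV g \<and> (\<forall>x t. g (x + t *\<^sub>R e) = g x) \<and>
        \<Omega> \<inter> ball p r = {x \<in> ball p r. x \<bullet> e < g x})"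

definition partial :: "'d::finite \<Rightarrow> (real^'d \<Rightarrow> real) \<Rightarrow> real^'d \<Rightarrow> real" where
  "partial k w x = frechet_derivative w (at x) (axis k 1)"

definition gradient :: "(real^'d::finite \<Rightarrow> real) \<Rightarrow> real^'d \<Rightarrow> real^'d" where
  "gradient w x = (\<chi> k. partial k w x)"

text \<open>Functions that are continuous up to the boundary and locally Lipschitz with a uniform
  constant. On a Lipschitz domain these are the continuous representatives of
  \<open>W\<^sup>1\<^sup>,\<^sup>\<infinity>\<close>; by Rademacher's theorem they are differentiable almost everywhere.\<close>

definition W1_infinity :: "(real^'d::finite) set \<Rightarrow> (real^'d \<Rightarrow> real) \<Rightarrow> bool" where
  "W1_infinity \<Omega> w \<longleftrightarrow>
     continuous_on (closure \<Omega>) w \<and>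
     (\<exists>L. \<forall>x \<in> \<Omega>. \<exists>\<epsilon> > 0. L-lipschitz_on (ball x \<epsilon> \<inter> \<Omega>) w)"

text \<open>The surface measure \<open>\<sigma>\<close> of the boundary and the outward unit normal \<open>n\<close>. The library has
  no surface measures; as in the theory of sets of finite perimeter, the pair is determined
  (\<open>n\<close> up to \<open>\<sigma>\<close>-null sets) as the polar decomposition of the vector measure in the
  Gauss-Green formula.\<close>

definition surface_measure_normal ::
    "(real^'d::finite) set \<Rightarrow> (real^'d) measure \<Rightarrow> (real^'d \<Rightarrow> real^'d) \<Rightarrow> bool" where
  "surface_measure_normal \<Omega> \<sigma> n \<longleftrightarrow>
     sets \<sigma> = sets borel \<and> finite_measure \<sigma> \<and> emeasure \<sigma> (- frontier \<Omega>) = 0 \<and>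
     n \<in> borel_measurable borel \<and> (AE x in \<sigma>. norm (n x) = 1) \<and>
     (\<forall>w k. W1_infinity \<Omega> w \<longrightarrow>
        (LINT x:\<Omega>|lebesgue. partial k w x) = (LINT x:frontier \<Omega>|\<sigma>. w x * n x $ k))"

definition divergence_free :: "(real^'d::finite) set \<Rightarrow> (real^'d \<Rightarrow> real^'d) \<Rightarrow> bool" where
  "divergence_free \<Omega> v \<longleftrightarrow>
     (\<forall>k. W1_infinity \<Omega> (\<lambda>x. v x $ k)) \<and>
     (\<forall>x \<in> \<Omega>. v differentiable (at x) \<and> (\<Sum>k\<in>UNIV. partial k (\<lambda>y. v y $ k) x) = 0)"


section \<open>Cells\<close>

text \<open>A quadrilateral/hexahedral cell is given by its vertices. The vertices of the reference
  cube \<open>[0,1]\<^sup>d\<close> are indexed by the set of coordinates that are equal to 1, and the cell is the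
  image of the reference cube under the multilinear map with the given vertex values.\<close>

type_synonym 'd cell = "'d set \<Rightarrow> real^'d"

definition ref_shape :: "'d::finite set \<Rightarrow> real^'d \<Rightarrow> real" where
  "ref_shape s \<xi> = (\<Prod>k\<in>UNIV. if k \<in> s then \<xi> $ k else 1 - \<xi> $ k)"

abbreviation ref_cube :: "(real^'d::finite) set" where
  "ref_cube \<equiv> cbox 0 1"

definition cell_map :: "'d::finite cell \<Rightarrow> real^'d \<Rightarrow> real^'d" where
  "cell_map K \<xi> = (\<Sum>s\<in>UNIV. ref_shape s \<xi> *\<^sub>R K s)"

definition cell_set :: "'d::finite cell \<Rightarrow> (real^'d) set" where
  "cell_set K = cell_map K ` ref_cube"

abbreviation vertices :: "'d::finite cell \<Rightarrow> (real^'d) set" where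
  "vertices K \<equiv> range K"

definition nondegenerate :: "'d::finite cell \<Rightarrow> bool" where
  "nondegenerate K \<longleftrightarrow> inj_on (cell_map K) ref_cube \<and>
     (\<forall>\<xi> \<in> ref_cube. det (matrix (frechet_derivative (cell_map K) (at \<xi>))) \<noteq> 0)"

text \<open>The nodal \<open>Q\<^sub>1\<close> shape function of the point \<open>p\<close> on the cell \<open>K\<close>, extended by zero; it is
  identically zero if \<open>p\<close> is not a vertex of \<open>K\<close>.\<close>

definition shape :: "'d::finite cell \<Rightarrow> real^'d \<Rightarrow> real^'d \<Rightarrow> real" where
  "shape K p x = (if x \<in> cell_set K
     then \<Sum>s | K s = p. ref_shape s (inv_into ref_cube (cell_map K) x) else 0)"


section \<open>Octree meshes\<close>

definition tiling :: "(real^'d::finite) set \<Rightarrow> 'd cell set \<Rightarrow> bool" where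
  "tiling \<Omega> T \<longleftrightarrow> finite T \<and> (\<forall>K \<in> T. nondegenerate K) \<and>
     (\<Union>K\<in>T. cell_set K) = closure \<Omega> \<and>
     (\<forall>K \<in> T. \<forall>K' \<in> T. K \<noteq> K' \<longrightarrow> interior (cell_set K) \<inter> interior (cell_set K') = {})"

text \<open>Two cells of a conforming mesh meet in a common face which both of them parametrise in the
  same way, that is, their nodal shape functions agree on the intersection.\<close>

definition conforming_mesh :: "(real^'d::finite) set \<Rightarrow> 'd cell set \<Rightarrow> bool" where
  "conforming_mesh \<Omega> G \<longleftrightarrow> tiling \<Omega> G \<and>
     (\<forall>K \<in> G. \<forall>K' \<in> G. \<forall>x \<in> cell_set K \<inter> cell_set K'. \<forall>p. shape K p x = shape K' p x)"

definition child :: "'d::finite cell \<Rightarrow> 'd set \<Rightarrow> 'd cell" where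
  "child K t = (\<lambda>s. cell_map K (\<chi> k. (of_bool (k \<in> t) + of_bool (k \<in> s)) / 2))"

definition refine :: "'d::finite cell set \<Rightarrow> 'd cell set" where
  "refine G = {child K t | K t. K \<in> G}"

text \<open>The leaves of a forest of octrees over a conforming mesh \<open>G\<close>, where \<open>level K\<close> is the depth
  of the leaf \<open>K\<close>; cells that touch each other differ by at most one level.\<close>

definition octree_mesh :: "(real^'d::finite) set \<Rightarrow> 'd cell set \<Rightarrow> bool" where
  "octree_mesh \<Omega> T \<longleftrightarrow> tiling \<Omega> T \<and>
     (\<exists>G level. conforming_mesh \<Omega> G \<and>
        (\<forall>K \<in> T. K \<in> (refine ^^ level K) G) \<and>
        (\<forall>K \<in> T. \<forall>K' \<in> T. cell_set K \<inter> cell_set K' \<noteq> {} \<longrightarrow>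
           level K \<le> level K' + (1::nat)))"


section \<open>Nodes, hanging nodes and constraints\<close>

text \<open>A node is identified with its position.\<close>

definition all_nodes :: "'d::finite cell set \<Rightarrow> (real^'d) set" where
  "all_nodes T = (\<Union>K\<in>T. vertices K)"

definition hanging :: "'d::finite cell set \<Rightarrow> (real^'d) set" where
  "hanging T = {p \<in> all_nodes T. \<exists>K \<in> T. p \<in> cell_set K - vertices K}"

definition nodes :: "'d::finite cell set \<Rightarrow> (real^'d) set" where
  "nodes T = all_nodes T - hanging T"

text \<open>A coarse cell containing the hanging node \<open>k\<close>. There can be several; they all yield the
  same constraint.\<close>

definition coarse_cell :: "'d::finite cell set \<Rightarrow> real^'d \<Rightarrow> 'd cell" where
  "coarse_cell T k = (SOME K. K \<in> T \<and> k \<in> cell_set K - vertices K)"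

definition constr :: "'d::finite cell set \<Rightarrow> real^'d \<Rightarrow> real^'d \<Rightarrow> real" where
  "constr T k j = shape (coarse_cell T k) j k"

definition constraining :: "'d::finite cell set \<Rightarrow> real^'d \<Rightarrow> (real^'d) set" where
  "constraining T k = {j \<in> vertices (coarse_cell T k). constr T k j \<noteq> 0}"

definition constrained_by :: "'d::finite cell set \<Rightarrow> real^'d \<Rightarrow> (real^'d) set" where
  "constrained_by T i = {k \<in> hanging T. i \<in> constraining T k}"

definition patch :: "'d::finite cell set \<Rightarrow> real^'d \<Rightarrow> (real^'d) set" where
  "patch T i = (\<Union>K \<in> {K \<in> T. i \<in> cell_set K}. cell_set K)"

definition patch_nodes :: "'d::finite cell set \<Rightarrow> real^'d \<Rightarrow> (real^'d) set" where
  "patch_nodes T i = {j \<in> nodes T. j \<in> patch T i}"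


section \<open>The finite element space\<close>

definition Vh :: "(real^'d::finite) set \<Rightarrow> 'd cell set \<Rightarrow> (real^'d \<Rightarrow> real^'m::finite) set" where
  "Vh \<Omega> T = {u. continuous_on (closure \<Omega>) u \<and>
     (\<forall>K \<in> T. \<exists>a. \<forall>\<xi> \<in> ref_cube. u (cell_map K \<xi>) = (\<Sum>s\<in>UNIV. ref_shape s \<xi> *\<^sub>R a s))}"

text \<open>The shape function of a node of \<open>nodes T\<close> once the hanging values have been eliminated.
  On the interface between cells the cell used for the evaluation does not matter,
  see \<open>conforming_constraints\<close> below.\<close>

definition cell_basis :: "'d::finite cell set \<Rightarrow> 'd cell \<Rightarrow> real^'d \<Rightarrow> real^'d \<Rightarrow> real" where
  "cell_basis T K i x = shape K i x + (\<Sum>k\<in>constrained_by T i. constr T k i * shape K k x)"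

definition basis_fun :: "'d::finite cell set \<Rightarrow> real^'d \<Rightarrow> real^'d \<Rightarrow> real" where
  "basis_fun T i x = cell_basis T (SOME K. K \<in> T \<and> x \<in> cell_set K) i x"

text \<open>Hanging nodes are constrained by nodes that do not hang themselves, and the constraints
  produce continuous functions. Both are standard for octree meshes with 2:1 balance.\<close>

definition conforming_constraints :: "'d::finite cell set \<Rightarrow> bool" where
  "conforming_constraints T \<longleftrightarrow>
     (\<forall>k \<in> hanging T. constraining T k \<subseteq> nodes T) \<and>
     (\<forall>i \<in> nodes T. \<forall>K \<in> T. \<forall>K' \<in> T. \<forall>x \<in> cell_set K \<inter> cell_set K'.
        cell_basis T K i x = cell_basis T K' i x)"

text \<open>The values on the inflow boundary can be imposed strongly at the nodes: the shape functions
  of the remaining nodes vanish there.\<close>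

definition resolves_inflow :: "'d::finite cell set \<Rightarrow> (real^'d) set \<Rightarrow> bool" where
  "resolves_inflow T \<Gamma> \<longleftrightarrow> (\<forall>i \<in> nodes T - \<Gamma>. \<forall>x \<in> \<Gamma>. basis_fun T i x = 0)"


section \<open>Local discrete extrema and the shock detector\<close>

definition local_discrete_min :: "'d::finite cell set \<Rightarrow> (real^'d \<Rightarrow> real) \<Rightarrow> real^'d \<Rightarrow> bool" where
  "local_discrete_min T w i \<longleftrightarrow> (\<forall>j \<in> patch_nodes T i. w i \<le> w j)"

definition local_discrete_max :: "'d::finite cell set \<Rightarrow> (real^'d \<Rightarrow> real) \<Rightarrow> real^'d \<Rightarrow> bool" where
  "local_discrete_max T w i \<longleftrightarrow> (\<forall>j \<in> patch_nodes T i. w i \<ge> w j)"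

text \<open>The point where the ray from \<open>i\<close> in the direction opposite to \<open>j\<close> leaves the patch of \<open>i\<close>.
  It is \<open>i\<close> itself if \<open>i\<close> is on the boundary and the ray leaves the patch immediately.\<close>

definition sym_point :: "'d::finite cell set \<Rightarrow> real^'d \<Rightarrow> real^'d \<Rightarrow> real^'d" where
  "sym_point T i j =
     i - Sup {s. 0 \<le> s \<and> (\<forall>t \<in> {0..s}. i - t *\<^sub>R sgn (j - i) \<in> patch T i)} *\<^sub>R sgn (j - i)"

definition sym_slope :: "'d::finite cell set \<Rightarrow> (real^'d \<Rightarrow> real) \<Rightarrow> real^'d \<Rightarrow> real^'d \<Rightarrow> real" where
  "sym_slope T w i j = (if sym_point T i j = i then 0
     else (w (sym_point T i j) - w i) / norm (sym_point T i j - i))"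

definition grad_jump :: "'d::finite cell set \<Rightarrow> (real^'d \<Rightarrow> real) \<Rightarrow> real^'d \<Rightarrow> real^'d \<Rightarrow> real" where
  "grad_jump T w i j = (w j - w i) / norm (j - i) + sym_slope T w i j"

definition grad_mean :: "'d::finite cell set \<Rightarrow> (real^'d \<Rightarrow> real) \<Rightarrow> real^'d \<Rightarrow> real^'d \<Rightarrow> real" where
  "grad_mean T w i j = 1/2 * (\<bar>w j - w i\<bar> / norm (j - i) + \<bar>sym_slope T w i j\<bar>)"

definition detector_denom :: "'d::finite cell set \<Rightarrow> (real^'d \<Rightarrow> real) \<Rightarrow> real^'d \<Rightarrow> real" where
  "detector_denom T w i = (\<Sum>j\<in>patch_nodes T i - {i}. 2 * grad_mean T w i j)"

definition detector ::
    "'d::finite cell set \<Rightarrow> real \<Rightarrow> (real^'d) set \<Rightarrow> (real^'d \<Rightarrow> real) \<Rightarrow> real^'d \<Rightarrow> real" where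
  "detector T q \<Gamma> w i =
     (if i \<in> \<Gamma> \<or> detector_denom T w i = 0 then 0
      else (\<bar>\<Sum>j\<in>patch_nodes T i - {i}. grad_jump T w i j\<bar> / detector_denom T w i) powr q)"

text \<open>The detector of a vector valued function; \<open>J\<close> is the set of tracked components and
  \<open>\<Gamma> \<beta>\<close> the inflow boundary of the component \<open>\<beta>\<close>.\<close>

definition node_detector ::
    "'d::finite cell set \<Rightarrow> real \<Rightarrow> ('m::finite \<Rightarrow> (real^'d) set) \<Rightarrow> 'm set \<Rightarrow>
     (real^'d \<Rightarrow> real^'m) \<Rightarrow> real^'d \<Rightarrow> real" where
  "node_detector T q \<Gamma> J u i = Max ((\<lambda>\<beta>. detector T q (\<Gamma> \<beta>) (\<lambda>x. u x $ \<beta>) i) ` J)"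

definition sys_detector ::
    "'d::finite cell set \<Rightarrow> real \<Rightarrow> ('m::finite \<Rightarrow> (real^'d) set) \<Rightarrow> 'm set \<Rightarrow>
     (real^'d \<Rightarrow> real^'m) \<Rightarrow> real^'d \<Rightarrow> real" where
  "sys_detector T q \<Gamma> J u i =
     (if i \<in> hanging T then Max (node_detector T q \<Gamma> J u ` constraining T i)
      else node_detector T q \<Gamma> J u i)"


section \<open>Mass matrix\<close>

text \<open>\<open>ell\<close> is the function \<open>2\<delta>\<^sub>i\<^sub>j - 1\<close>. In the matrices below, \<open>\<alpha>\<close> stands for the values of the
  shock detector at all nodes.\<close>

definition ell :: "'a \<Rightarrow> 'a \<Rightarrow> real" where
  "ell i j = 2 * of_bool (i = j) - 1"

text \<open>By bilinearity, using \<open>basis_fun\<close> amounts to adding the terms from the elimination of the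
  hanging nodes to the inner products of the nodal shape functions.\<close>

definition mass :: "(real^'d::finite) set \<Rightarrow> 'd cell set \<Rightarrow> real^'d \<Rightarrow> real^'d \<Rightarrow> real" where
  "mass \<Omega> T i j = (LINT x:\<Omega>|lebesgue. basis_fun T j x * basis_fun T i x)"

definition stab_mass ::
    "(real^'d::finite) set \<Rightarrow> 'd cell set \<Rightarrow> (real^'d \<Rightarrow> real) \<Rightarrow> real^'d \<Rightarrow> real^'d \<Rightarrow> real^'m^'m" where
  "stab_mass \<Omega> T \<alpha> i j =
     ((1 - max (\<alpha> i) (\<alpha> j)) * mass \<Omega> T i j
      + of_bool (i = j) * (\<Sum>k\<in>nodes T. max (\<alpha> i) (\<alpha> k) * mass \<Omega> T i k)) *\<^sub>R mat 1"


section \<open>Linear advection\<close>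

text \<open>For \<open>f(u) = v u\<close> the flux Jacobian is the field \<open>v\<close>, which depends on the position only.\<close>

definition adv_K ::
    "(real^'d::finite) set \<Rightarrow> 'd cell set \<Rightarrow> (real^'d) measure \<Rightarrow> (real^'d \<Rightarrow> real^'d) \<Rightarrow>
     (real^'d \<Rightarrow> real^'d) \<Rightarrow> (real^'d) set \<Rightarrow> real^'d \<Rightarrow> real^'d \<Rightarrow> real" where
  "adv_K \<Omega> T \<sigma> n v \<Gamma> i j =
     - (\<Sum>k\<in>UNIV. LINT x:\<Omega>|lebesgue. v x $ k * basis_fun T j x * partial k (basis_fun T i) x)
     + (\<Sum>k\<in>UNIV. LINT x:frontier \<Omega> - \<Gamma>|\<sigma>. v x $ k * basis_fun T j x * (n x $ k * basis_fun T i x))"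

text \<open>The formula for \<open>\<nu>\<^sub>i\<^sub>j\<close> is used for all pairs of nodes. It gives zero unless the supports of
  the two shape functions overlap; because of the hanging nodes these can also overlap for nodes that
  do not share a cell.\<close>

definition adv_nu ::
    "'d::finite cell set \<Rightarrow> (real^'d \<Rightarrow> real^'d \<Rightarrow> real) \<Rightarrow> (real^'d \<Rightarrow> real) \<Rightarrow>
     real^'d \<Rightarrow> real^'d \<Rightarrow> real" where
  "adv_nu T K \<alpha> i j =
     (let \<nu> = (\<lambda>a b. max (\<alpha> a * K a b) (max 0 (\<alpha> b * K b a)))
      in if i = j then \<Sum>l\<in>nodes T - {i}. \<nu> i l else \<nu> i j)"

definition adv_A ::
    "(real^'d::finite) set \<Rightarrow> 'd cell set \<Rightarrow> (real^'d) measure \<Rightarrow> (real^'d \<Rightarrow> real^'d) \<Rightarrow>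
     (real^'d \<Rightarrow> real^'d) \<Rightarrow> (real^'d) set \<Rightarrow> (real^'d \<Rightarrow> real) \<Rightarrow> real^'d \<Rightarrow> real^'d \<Rightarrow> real^1^1" where
  "adv_A \<Omega> T \<sigma> n v \<Gamma> \<alpha> i j =
     (adv_K \<Omega> T \<sigma> n v \<Gamma> i j + adv_nu T (adv_K \<Omega> T \<sigma> n v \<Gamma>) \<alpha> i j * ell i j) *\<^sub>R mat 1"


section \<open>Eigenvalues of real matrices\<close>

definition complex_eigenvalue :: "real^'m^'m::finite \<Rightarrow> complex \<Rightarrow> bool" where
  "complex_eigenvalue A z \<longleftrightarrow>
     (\<exists>x :: complex^'m. x \<noteq> 0 \<and> (\<chi> a b. complex_of_real (A $ a $ b)) *v x = z *s x)"

definition spectral_radius :: "real^'m^'m::finite \<Rightarrow> real" where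
  "spectral_radius A = Max (cmod ` {z. complex_eigenvalue A z})"


section \<open>Euler equations\<close>

text \<open>The components of the state \<open>(\<rho>, \<rho>v, \<rho>E)\<close> are indexed by \<open>Inl ()\<close>, \<open>Inr (Inl k)\<close> and
  \<open>Inr (Inr ())\<close>; there are \<open>d + 2\<close> of them.\<close>

type_synonym 'd euler_state = "real^(unit + 'd + unit)"

definition euler_vec :: "real \<Rightarrow> real^'d::finite \<Rightarrow> real \<Rightarrow> 'd euler_state" where
  "euler_vec r m e = (\<chi> a. case a of Inl _ \<Rightarrow> r | Inr (Inl k) \<Rightarrow> m $ k | Inr (Inr _) \<Rightarrow> e)"

definition density :: "'d::finite euler_state \<Rightarrow> real" where
  "density u = u $ Inl ()"

definition momentum :: "'d::finite euler_state \<Rightarrow> real^'d" where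
  "momentum u = (\<chi> k. u $ Inr (Inl k))"

definition total_energy :: "'d::finite euler_state \<Rightarrow> real" where
  "total_energy u = u $ Inr (Inr ())"

definition velocity :: "'d::finite euler_state \<Rightarrow> real^'d" where
  "velocity u = (1 / density u) *\<^sub>R momentum u"

definition pressure :: "real \<Rightarrow> 'd::finite euler_state \<Rightarrow> real" where
  "pressure \<gamma> u =
     (\<gamma> - 1) * density u * (total_energy u / density u - 1/2 * (norm (velocity u))\<^sup>2)"

definition enthalpy :: "real \<Rightarrow> 'd::finite euler_state \<Rightarrow> real" where
  "enthalpy \<gamma> u = total_energy u / density u + pressure \<gamma> u / density u"

definition euler_flux :: "real \<Rightarrow> 'd::finite \<Rightarrow> 'd euler_state \<Rightarrow> 'd euler_state" where
  "euler_flux \<gamma> k u =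
     euler_vec (momentum u $ k)
       (velocity u $ k *\<^sub>R momentum u + pressure \<gamma> u *\<^sub>R axis k 1)
       (velocity u $ k * (total_energy u + pressure \<gamma> u))"

definition flux_jacobian ::
    "real \<Rightarrow> 'd::finite euler_state \<Rightarrow> real^'d \<Rightarrow> real^(unit + 'd + unit)^(unit + 'd + unit)" where
  "flux_jacobian \<gamma> u c =
     (\<Sum>k\<in>UNIV. c $ k *\<^sub>R matrix (frechet_derivative (euler_flux \<gamma> k) (at u)))"

definition admissible :: "real \<Rightarrow> 'd::finite euler_state \<Rightarrow> bool" where
  "admissible \<gamma> u \<longleftrightarrow> density u > 0 \<and> pressure \<gamma> u > 0"

text \<open>The state with the averaged density, velocity and enthalpy. Solving
  \<open>H = E + p/\<rho> = \<gamma>E - (\<gamma>-1)|v|\<^sup>2/2\<close> for \<open>E\<close> gives the last component.\<close>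

definition roe :: "real \<Rightarrow> 'd::finite euler_state \<Rightarrow> 'd euler_state \<Rightarrow> 'd euler_state" where
  "roe \<gamma> u u' =
     (let a = sqrt (density u); b = sqrt (density u');
          r = sqrt (density u * density u');
          v = (1 / (a + b)) *\<^sub>R (a *\<^sub>R velocity u + b *\<^sub>R velocity u');
          H = (enthalpy \<gamma> u * a + enthalpy \<gamma> u' * b) / (a + b)
      in euler_vec r (r *\<^sub>R v) (r * ((H + (\<gamma> - 1) * (norm v)\<^sup>2 / 2) / \<gamma>)))"

text \<open>\<open>cell_conv K i j\<close> is \<open>(\<nabla>\<phi>\<^sub>j, \<phi>\<^sub>i)\<close> on the cell \<open>K\<close>, without constraints.\<close>

definition cell_conv :: "'d::finite cell \<Rightarrow> real^'d \<Rightarrow> real^'d \<Rightarrow> real^'d" where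
  "cell_conv K i j = (LINT x:cell_set K|lebesgue. shape K i x *\<^sub>R gradient (shape K j) x)"

definition conv :: "'d::finite cell set \<Rightarrow> real^'d \<Rightarrow> real^'d \<Rightarrow> real^'d" where
  "conv T i j = (\<Sum>K\<in>T. cell_conv K i j
     + (\<Sum>k\<in>constrained_by T j. constr T k j *\<^sub>R cell_conv K i k)
     + (\<Sum>k\<in>constrained_by T i. constr T k i *\<^sub>R cell_conv K k j)
     + (\<Sum>k\<in>constrained_by T i \<inter> constrained_by T j.
          (constr T k i * constr T k j) *\<^sub>R cell_conv K k k))"

text \<open>As for advection, the formula for \<open>\<nu>\<^sub>i\<^sub>j\<close> is used for all pairs of nodes.\<close>

definition euler_nu ::
    "real \<Rightarrow> 'd::finite cell set \<Rightarrow> (real^'d \<Rightarrow> 'd euler_state) \<Rightarrow> (real^'d \<Rightarrow> real) \<Rightarrow>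
     'd cell \<Rightarrow> real^'d \<Rightarrow> real^'d \<Rightarrow> real" where
  "euler_nu \<gamma> T u \<alpha> K i j =
     (let rad = (\<lambda>a b. spectral_radius (flux_jacobian \<gamma> (roe \<gamma> (u i) (u j)) (cell_conv K a b)))
      in max (\<alpha> i * rad i j) (\<alpha> j * rad j i)
         + (\<Sum>k\<in>constrained_by T i. constr T k i * max (\<alpha> k * rad k j) (\<alpha> j * rad j k))
         + (\<Sum>k\<in>constrained_by T j. constr T k j * max (\<alpha> i * rad i k) (\<alpha> k * rad k i))
         + (\<Sum>k\<in>constrained_by T i \<inter> constrained_by T j.
              constr T k i * constr T k j * \<alpha> k * rad k k))"

definition euler_B ::
    "real \<Rightarrow> 'd::finite cell set \<Rightarrow> (real^'d \<Rightarrow> 'd euler_state) \<Rightarrow> (real^'d \<Rightarrow> real) \<Rightarrow>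
     real^'d \<Rightarrow> real^'d \<Rightarrow> real^(unit + 'd + unit)^(unit + 'd + unit)" where
  "euler_B \<gamma> T u \<alpha> i j =
     (\<Sum>K\<in>T. (if i = j then \<Sum>l\<in>nodes T - {i}. euler_nu \<gamma> T u \<alpha> K i l
               else euler_nu \<gamma> T u \<alpha> K i j) * ell i j) *\<^sub>R mat 1"

definition euler_offdiag ::
    "real \<Rightarrow> 'd::finite cell set \<Rightarrow> (real^'d \<Rightarrow> 'd euler_state) \<Rightarrow> (real^'d \<Rightarrow> real) \<Rightarrow>
     real^'d \<Rightarrow> real^'d \<Rightarrow> real^(unit + 'd + unit)^(unit + 'd + unit)" where
  "euler_offdiag \<gamma> T u \<alpha> i j =
     flux_jacobian \<gamma> (roe \<gamma> (u i) (u j)) (conv T i j) + euler_B \<gamma> T u \<alpha> i j"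

text \<open>The scheme is written in terms of the differences \<open>u\<^sub>j - u\<^sub>i\<close>, which fixes the diagonal.\<close>

definition euler_A ::
    "real \<Rightarrow> 'd::finite cell set \<Rightarrow> (real^'d \<Rightarrow> 'd euler_state) \<Rightarrow> (real^'d \<Rightarrow> real) \<Rightarrow>
     real^'d \<Rightarrow> real^'d \<Rightarrow> real^(unit + 'd + unit)^(unit + 'd + unit)" where
  "euler_A \<gamma> T u \<alpha> i j =
     (if i = j then - (\<Sum>l\<in>nodes T - {i}. euler_offdiag \<gamma> T u \<alpha> i l)
      else euler_offdiag \<gamma> T u \<alpha> i j)"


section \<open>Local bounds preservation\<close>

text \<open>The first conjunct says that the \<open>i\<close>-th equation of \<open>M \<delta>\<^sub>tU + A U = 0\<close> can be written in terms
  of differences, where \<open>dtu\<close> is the discrete time derivative of the nodal values \<open>u\<close>.\<close>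

definition bounds_preserving_row ::
    "'a set \<Rightarrow> ('a \<Rightarrow> 'a \<Rightarrow> real^'m^'m::finite) \<Rightarrow> ('a \<Rightarrow> 'a \<Rightarrow> real^'m^'m) \<Rightarrow>
     ('a \<Rightarrow> real^'m) \<Rightarrow> ('a \<Rightarrow> real^'m) \<Rightarrow> 'a \<Rightarrow> bool" where
  "bounds_preserving_row N M A dtu u i \<longleftrightarrow>
     ((\<Sum>j\<in>N. M i j *v dtu j) + (\<Sum>j\<in>N. A i j *v u j) = 0 \<longleftrightarrow>
      (\<Sum>j\<in>N. M i j *v dtu i) + (\<Sum>j\<in>N - {i}. A i j *v (u j - u i)) = 0) \<and>
     (\<exists>m > 0. \<forall>j \<in> N. M i j = (m * of_bool (i = j)) *\<^sub>R mat 1) \<and>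
     (\<forall>j \<in> N - {i}. \<forall>z. complex_eigenvalue (A i j) z \<longrightarrow> z \<in> \<real> \<and> Re z \<le> 0) \<and>
     (\<Sum>j\<in>N. A i j) = 0"

end

theory Submission
  imports Defs
begin

text \<open>
  At a local discrete extremum the shock detector saturates. On the patch of the node \<open>i\<close> the
  function is a convex combination of its values at the vertices of the cells, so it lies on one side
  of its value at \<open>i\<close> everywhere on the patch, in particular at the symmetric points. All the
  one-sided slopes in the detector then have the same sign, and the absolute value of their sum equals
  the sum of their absolute values: \<open>\<alpha>\<^sub>i = 1\<close> (\<open>node_detector_eq_1\<close>). At the
  other nodes the detector is at most 1, and at the hanging nodes constrained by \<open>i\<close> it is at
  least 1, being a maximum over the constraining nodes.
  The four properties of the row follow from this.

  \<^item> Mass. As \<open>max (\<alpha>\<^sub>i, \<alpha>\<^sub>j) = 1\<close>, the consistent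
  mass matrix is replaced by the lumped one in row \<open>i\<close>. The shape functions form a partition of
  unity (\<open>sum_basis_fun\<close>), so the diagonal entry is the integral of the shape function of
  \<open>i\<close>, which is nonnegative, continuous and positive at \<open>i\<close>.

  \<^item> Eigenvalues for advection. For \<open>\<alpha>\<^sub>i = 1\<close> the artificial diffusion
  \<open>\<nu>\<^sub>i\<^sub>j\<close> is at least the Galerkin entry from which it is subtracted.

  \<^item> Eigenvalues for the Euler equations. The eigenvalues of the flux Jacobian in the direction
  \<open>c\<close> are \<open>v \<bullet> c\<close> and \<open>v \<bullet> c \<plusminus> a |c|\<close>, and the two acoustic
  ones do occur, so its spectral radius is at least the wave speed
  \<open>|v \<bullet> c| + a |c|\<close>. This is sublinear in \<open>c\<close>. The vector of the
  assembled entry is a sum, with nonnegative weights, of vectors of single cells, and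
  \<open>\<nu>\<^sub>i\<^sub>j\<close> adds up their spectral radii with at least the same weights; hence
  subtracting it moves all eigenvalues into the left half line (\<open>wave_speed_conv_le\<close>). The Roe
  average of admissible states is admissible because the squared norm is convex, so \<open>a\<close> is a
  positive real number.

  \<^item> Row sums. For the Euler equations the diagonal block is defined by them. For advection the
  artificial diffusion has zero row sums, and by the partition of unity the Galerkin row sums to
  \<open>- \<integral> v \<bullet> \<nabla>\<phi>\<^sub>i + \<integral> (v \<bullet> n) \<phi>\<^sub>i\<close>, where the
  second integral is over the outflow boundary. As \<open>\<phi>\<^sub>i\<close> vanishes on the inflow boundary,
  this is zero by the Gauss-Green formula for \<open>v \<phi>\<^sub>i\<close> and \<open>div v = 0\<close>
  (\<open>adv_K_row_sum\<close>). The Gauss-Green formula holds for functions in \<open>W\<^sup>1\<^sup>,\<^sup>\<infinity>\<close>, so most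
  of the work goes into the regularity of the shape functions on curved cells: they are Lipschitz
  continuous because the inverses of the cell maps are, and they are differentiable off the
  boundaries of the cells, which form a null set.
\<close>

section \<open>Reference shape functions and cells\<close>

lemma ref_shape_nonneg: "0 \<le> ref_shape s \<xi>" if "\<xi> \<in> ref_cube"
  using that by (auto simp: ref_shape_def mem_box_cart intro!: prod_nonneg)

text \<open>Expanding \<open>\<Prod>\<^sub>k (\<xi>\<^sub>k + (1 - \<xi>\<^sub>k)) = 1\<close> gives one summand per vertex.\<close>

lemma sum_ref_shape: "(\<Sum>s\<in>UNIV. ref_shape s \<xi>) = 1"
proof -
  have "1 = (\<Prod>k\<in>UNIV. \<xi> $ k + (1 - \<xi> $ k))"
    by simp
  also have "\<dots> = (\<Sum>s\<in>UNIV. (\<Prod>k\<in>s. \<xi> $ k) * (\<Prod>k\<in>-s. 1 - \<xi> $ k))"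
    by (subst prod_add) (auto simp: Compl_eq_Diff_UNIV)
  also have "\<dots> = (\<Sum>s\<in>UNIV. ref_shape s \<xi>)"
    by (auto simp: ref_shape_def prod.If_cases intro!: sum.cong)
  finally show ?thesis ..
qed

definition ref_vertex :: "'d::finite set \<Rightarrow> real^'d" where
  "ref_vertex s = (\<chi> k. of_bool (k \<in> s))"

lemma ref_vertex_in_ref_cube: "ref_vertex s \<in> ref_cube"
  by (auto simp: ref_vertex_def mem_box_cart)

lemma ref_shape_ref_vertex: "ref_shape t (ref_vertex s) = of_bool (t = s)"
proof (cases "t = s")
  case False
  then obtain k where k: "k \<in> t \<and> k \<notin> s \<or> k \<notin> t \<and> k \<in> s"
    by auto
  then have "(if k \<in> t then ref_vertex s $ k else 1 - ref_vertex s $ k) = 0"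
    by (auto simp: ref_vertex_def)
  then have "ref_shape t (ref_vertex s) = 0"
    unfolding ref_shape_def by (intro prod_zero bexI [of _ k]) auto
  with False show ?thesis
    by simp
qed (auto simp: ref_shape_def ref_vertex_def intro: prod.neutral)

lemma continuous_on_ref_shape: "continuous_on A (ref_shape s)"
proof -
  have "continuous_on A (\<lambda>\<xi>. if k \<in> s then \<xi> $ k else 1 - \<xi> $ k)" for k
    by (cases "k \<in> s") (auto intro!: continuous_intros)
  then show ?thesis
    unfolding ref_shape_def [abs_def] by (intro continuous_intros)
qed

lemma continuous_on_cell_map: "continuous_on A (cell_map K)"
  unfolding cell_map_def [abs_def] by (intro continuous_intros continuous_on_ref_shape)

lemma cell_map_ref_vertex: "cell_map K (ref_vertex s) = K s"
  by (simp add: cell_map_def ref_shape_ref_vertex of_bool_def if_distrib [where f="\<lambda>c. c *\<^sub>R _"] cong: if_cong)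

lemma vertex_in_cell: "K s \<in> cell_set K"
  unfolding cell_set_def
  by (metis cell_map_ref_vertex imageI ref_vertex_in_ref_cube)

lemma compact_cell_set: "compact (cell_set K)"
  unfolding cell_set_def by (intro compact_continuous_image continuous_on_cell_map compact_cbox)

abbreviation cell_inv :: "'d::finite cell \<Rightarrow> real^'d \<Rightarrow> real^'d" where
  "cell_inv K \<equiv> inv_into ref_cube (cell_map K)"

lemma cell_inv_in_ref_cube: "cell_inv K x \<in> ref_cube" if "x \<in> cell_set K"
  using that unfolding cell_set_def by (rule inv_into_into)

lemma cell_map_cell_inv: "cell_map K (cell_inv K x) = x" if "x \<in> cell_set K"
  using that unfolding cell_set_def by (rule f_inv_into_f)

lemma cell_inv_cell_map: "cell_inv K (cell_map K \<xi>) = \<xi>"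
  if "nondegenerate K" "\<xi> \<in> ref_cube"
  using that unfolding nondegenerate_def by (auto intro: inv_into_f_f)

lemma cell_inv_vertex: "cell_inv K (K s) = ref_vertex s" if "nondegenerate K"
  using cell_inv_cell_map [OF that ref_vertex_in_ref_cube, of s] by (simp add: cell_map_ref_vertex)

lemma continuous_on_cell_inv: "continuous_on (cell_set K) (cell_inv K)" if "nondegenerate K"
  unfolding cell_set_def
  using that by (intro continuous_on_inv continuous_on_cell_map compact_cbox ballI cell_inv_cell_map)

lemma shape_nonneg: "0 \<le> shape K p x"
  by (auto simp: shape_def intro!: sum_nonneg ref_shape_nonneg cell_inv_in_ref_cube)

lemma sum_shape:
  assumes "finite P" "vertices K \<subseteq> P" "x \<in> cell_set K"
  shows "(\<Sum>p\<in>P. shape K p x) = 1"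
proof -
  have "(\<Sum>p\<in>P. shape K p x) = (\<Sum>p\<in>P. \<Sum>s | s \<in> UNIV \<and> K s = p. ref_shape s (cell_inv K x))"
    using assms by (simp add: shape_def)
  also have "\<dots> = (\<Sum>s\<in>UNIV. ref_shape s (cell_inv K x))"
    using assms by (intro sum.group) auto
  finally show ?thesis
    by (simp add: sum_ref_shape)
qed

text \<open>A cell that is not degenerate has distinct vertices, since the inverse of the cell map recovers
  the reference vertex. Therefore only one summand of the shape function survives.\<close>

lemma shape_at_vertex:
  fixes K :: "'d::finite cell"
  assumes "nondegenerate K"
  shows "shape K (K s) (K s) = 1"
proof -
  have "t = s" if "K t = K s" for t
  proof -
    have "ref_vertex t = (ref_vertex s :: real^'d)"
      using that \<open>nondegenerate K\<close> by (metis cell_inv_vertex)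
    then have "ref_shape t (ref_vertex t :: real^'d) = ref_shape t (ref_vertex s)"
      by simp
    then show "t = s"
      by (simp add: ref_shape_ref_vertex of_bool_def split: if_splits)
  qed
  then have "{t. K t = K s} = {s}"
    by auto
  then show ?thesis
    using assms vertex_in_cell [of K s] by (simp add: shape_def cell_inv_vertex ref_shape_ref_vertex)
qed

lemma continuous_on_shape: "continuous_on (cell_set K) (shape K p)" if "nondegenerate K"
proof -
  have "continuous_on (cell_set K) (\<lambda>x. \<Sum>s | K s = p. ref_shape s (cell_inv K x))"
    using continuous_on_cell_inv [OF that]
    by (intro continuous_intros continuous_on_compose2 [OF continuous_on_ref_shape [of UNIV]]) auto
  then show ?thesis
    by (rule continuous_on_eq) (simp add: shape_def)
qed

section \<open>Constrained shape functions\<close>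

locale constrained_mesh =
  fixes \<Omega> :: "(real^'d::finite) set" and T :: "'d cell set"
  assumes tiling: "tiling \<Omega> T" and conforming: "conforming_constraints T"
begin

lemma finite_cells: "finite T"
  and nondegenerate_cell: "K \<in> T \<Longrightarrow> nondegenerate K"
  and Union_cells: "(\<Union>K\<in>T. cell_set K) = closure \<Omega>"
  using tiling by (auto simp: tiling_def)

lemma cell_subset_closure: "K \<in> T \<Longrightarrow> cell_set K \<subseteq> closure \<Omega>"
  using Union_cells by auto

lemma finite_all_nodes: "finite (all_nodes T)"
  unfolding all_nodes_def using finite_cells by auto

lemma finite_nodes: "finite (nodes T)" and finite_hanging: "finite (hanging T)"
  using finite_all_nodes by (auto simp: nodes_def hanging_def)

lemma coarse_cell: "coarse_cell T k \<in> T" "k \<in> cell_set (coarse_cell T k)" if "k \<in> hanging T"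
proof -
  from that have "\<exists>K. K \<in> T \<and> k \<in> cell_set K - vertices K"
    by (auto simp: hanging_def)
  from someI_ex [OF this] show "coarse_cell T k \<in> T" "k \<in> cell_set (coarse_cell T k)"
    by (auto simp: coarse_cell_def)
qed

lemma constr_nonneg: "0 \<le> constr T k i"
  by (simp add: constr_def shape_nonneg)

lemma constraining_subset_nodes: "k \<in> hanging T \<Longrightarrow> constraining T k \<subseteq> nodes T"
  using conforming by (auto simp: conforming_constraints_def)

text \<open>The constraint of a hanging node reproduces constants. Its weights are the values
  at the node of the shape functions of the coarse cell, which sum to 1, and those that do not vanish
  belong to nodes that do not hang.\<close>

lemma sum_constr:
  assumes k: "k \<in> hanging T"
  shows "(\<Sum>i\<in>nodes T. if k \<in> constrained_by T i then constr T k i else 0) = 1"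
proof -
  have "(\<Sum>i\<in>nodes T. if k \<in> constrained_by T i then constr T k i else 0)
      = (\<Sum>i\<in>constraining T k. constr T k i)"
    using k constraining_subset_nodes [OF k] finite_nodes
    by (intro sum.mono_neutral_cong_right) (auto simp: constrained_by_def)
  also have "\<dots> = (\<Sum>i\<in>vertices (coarse_cell T k). constr T k i)"
    by (intro sum.mono_neutral_left) (auto simp: constraining_def)
  also have "\<dots> = 1"
    unfolding constr_def using coarse_cell [OF k] by (intro sum_shape) auto
  finally show ?thesis .
qed

lemma basis_fun_eq_cell_basis:
  assumes "i \<in> nodes T" "K \<in> T" "x \<in> cell_set K"
  shows "basis_fun T i x = cell_basis T K i x"
proof -
  define K' where "K' = (SOME K. K \<in> T \<and> x \<in> cell_set K)"
  have "\<exists>K. K \<in> T \<and> x \<in> cell_set K"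
    using assms by auto
  from someI_ex [OF this] have "K' \<in> T \<and> x \<in> cell_set K'"
    by (simp add: K'_def)
  then have "cell_basis T K' i x = cell_basis T K i x"
    using assms conforming unfolding conforming_constraints_def by (metis IntI)
  then show ?thesis
    by (simp add: basis_fun_def K'_def)
qed

lemma basis_fun_nonneg: "0 \<le> basis_fun T i x"
  by (auto simp: basis_fun_def cell_basis_def intro!: add_nonneg_nonneg sum_nonneg mult_nonneg_nonneg
      shape_nonneg constr_nonneg)

text \<open>Eliminating the hanging nodes keeps the partition of unity: the shape function of a hanging node
  is distributed over the constraining nodes with weights that sum to 1.\<close>

lemma sum_basis_fun:
  assumes "x \<in> closure \<Omega>"
  shows "(\<Sum>i\<in>nodes T. basis_fun T i x) = 1"
proof -
  from assms obtain K where K: "K \<in> T" "x \<in> cell_set K"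
    using Union_cells by auto
  have "(\<Sum>i\<in>nodes T. basis_fun T i x) = (\<Sum>i\<in>nodes T. cell_basis T K i x)"
    using K by (intro sum.cong refl basis_fun_eq_cell_basis)
  also have "\<dots> = (\<Sum>i\<in>nodes T. shape K i x) +
      (\<Sum>i\<in>nodes T. \<Sum>k\<in>hanging T. (if k \<in> constrained_by T i then constr T k i else 0) * shape K k x)"
    unfolding cell_basis_def sum.distrib using finite_hanging
    by (intro arg_cong2 [where f = "(+)"] sum.cong refl sum.mono_neutral_cong_left)
      (auto simp: constrained_by_def)
  also have "(\<Sum>i\<in>nodes T. \<Sum>k\<in>hanging T.
        (if k \<in> constrained_by T i then constr T k i else 0) * shape K k x)
      = (\<Sum>k\<in>hanging T. shape K k x)"
    by (subst sum.swap) (simp add: sum_distrib_right [symmetric] sum_constr)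
  also have "(\<Sum>i\<in>nodes T. shape K i x) + \<dots> = (\<Sum>p\<in>all_nodes T. shape K p x)"
    unfolding nodes_def using finite_all_nodes
    by (intro sum.subset_diff [symmetric]) (auto simp: hanging_def)
  also have "\<dots> = 1"
    using K finite_all_nodes by (intro sum_shape) (auto simp: all_nodes_def)
  finally show ?thesis .
qed

lemma continuous_on_cell_basis: "K \<in> T \<Longrightarrow> continuous_on (cell_set K) (cell_basis T K i)"
  unfolding cell_basis_def [abs_def]
  by (intro continuous_intros continuous_on_shape nondegenerate_cell)

text \<open>The pieces are continuous on the closed cells, and by the conformity of the constraints they
  agree where cells meet.\<close>

lemma continuous_on_basis_fun:
  assumes "i \<in> nodes T"
  shows "continuous_on (closure \<Omega>) (basis_fun T i)"
  unfolding Union_cells [symmetric]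
proof (rule continuous_on_closed_Union [OF finite_cells])
  fix K assume "K \<in> T"
  then show "continuous_on (cell_set K) (basis_fun T i)"
    using assms by (intro continuous_on_eq [OF continuous_on_cell_basis])
      (auto simp: basis_fun_eq_cell_basis)
qed (auto intro: compact_imp_closed compact_cell_set)

lemma node_in_closure: "i \<in> nodes T \<Longrightarrow> i \<in> closure \<Omega>"
  using cell_subset_closure vertex_in_cell by (auto simp: nodes_def all_nodes_def)

lemma basis_fun_at_node_pos:
  assumes "i \<in> nodes T"
  shows "basis_fun T i i > 0"
proof -
  from assms obtain K s where K: "K \<in> T" "i = K s"
    by (auto simp: nodes_def all_nodes_def)
  have "shape K i i = 1"
    using K nondegenerate_cell by (simp add: shape_at_vertex)
  then have "1 \<le> cell_basis T K i i"
    by (auto simp: cell_basis_def intro!: sum_nonneg mult_nonneg_nonneg shape_nonneg constr_nonneg)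
  then show ?thesis
    using basis_fun_eq_cell_basis [OF assms, of K i] K vertex_in_cell [of K s] by simp
qed

end

section \<open>The shock detector at a discrete extremum\<close>

text \<open>The triangle inequality: a jump is the sum of two slopes, twice the mean is the sum of their
  absolute values.\<close>

lemma detector_le_1:
  assumes "q \<ge> 0"
  shows "detector T q \<Gamma> w i \<le> 1"
proof -
  let ?N = "patch_nodes T i - {i}"
  have "\<bar>\<Sum>j\<in>?N. grad_jump T w i j\<bar> \<le> (\<Sum>j\<in>?N. \<bar>grad_jump T w i j\<bar>)"
    by (rule sum_abs)
  also have "\<dots> \<le> detector_denom T w i"
    unfolding detector_denom_def
  proof (intro sum_mono)
    fix j
    have "\<bar>grad_jump T w i j\<bar> \<le> \<bar>(w j - w i) / norm (j - i)\<bar> + \<bar>sym_slope T w i j\<bar>"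
      unfolding grad_jump_def by (rule abs_triangle_ineq)
    then show "\<bar>grad_jump T w i j\<bar> \<le> 2 * grad_mean T w i j"
      by (simp add: grad_mean_def)
  qed
  finally have "\<bar>\<Sum>j\<in>?N. grad_jump T w i j\<bar> / detector_denom T w i \<le> 1"
    by (auto simp: divide_le_eq_1)
  moreover have "0 \<le> detector_denom T w i"
    unfolding detector_denom_def by (intro sum_nonneg) (simp add: grad_mean_def)
  ultimately show ?thesis
    using assms by (auto simp: detector_def intro: powr_le_one_le powr_le1)
qed

lemma node_detector_le_1: "node_detector T q \<Gamma> J u i \<le> 1" if "J \<noteq> {}" "q \<ge> 0"
  using that by (auto simp: node_detector_def detector_le_1)

context constrained_mesh
begin

lemma compact_patch: "compact (patch T i)"
  unfolding patch_def using finite_cells by (intro compact_UN compact_cell_set) auto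

lemma node_in_patch: "i \<in> nodes T \<Longrightarrow> i \<in> patch T i"
  using vertex_in_cell by (fastforce simp: nodes_def all_nodes_def patch_def)

text \<open>The supremum that defines the symmetric point is attained, because the patch is compact.\<close>

lemma sym_point_in_patch:
  assumes i: "i \<in> nodes T" and "j \<noteq> i"
  shows "sym_point T i j \<in> patch T i"
proof -
  define d where "d = sgn (j - i)"
  have d: "norm d = 1"
    using \<open>j \<noteq> i\<close> by (simp add: d_def norm_sgn)
  define S where "S = {s. 0 \<le> s \<and> (\<forall>t \<in> {0..s}. i - t *\<^sub>R d \<in> patch T i)}"
  define C where "C = {t. i - t *\<^sub>R d \<in> patch T i}"
  have "S \<subseteq> C"
    by (auto simp: S_def C_def)
  have "closed C"
    unfolding C_def
    using compact_imp_closed [OF compact_patch]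
    by (intro closed_vimage [unfolded vimage_def]) (auto intro!: continuous_intros)
  obtain B where B: "\<And>x. x \<in> patch T i \<Longrightarrow> norm x \<le> B"
    using compact_imp_bounded [OF compact_patch [of i]] unfolding bounded_iff by blast
  have "t \<le> norm i + B" if "t \<in> S" for t
  proof -
    have "t = norm (i - (i - t *\<^sub>R d))"
      using that d by (simp add: S_def)
    also have "\<dots> \<le> norm i + norm (i - t *\<^sub>R d)"
      by (rule norm_triangle_ineq4)
    also have "\<dots> \<le> norm i + B"
      using that \<open>S \<subseteq> C\<close> B by (auto simp: C_def)
    finally show ?thesis .
  qed
  then have "bdd_above S"
    by (rule bdd_aboveI)
  moreover have "0 \<in> S"
    using node_in_patch [OF i] by (auto simp: S_def)
  ultimately have "Sup S \<in> closure S"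
    by (intro closure_contains_Sup) auto
  then have "Sup S \<in> C"
    using closure_minimal [OF \<open>S \<subseteq> C\<close> \<open>closed C\<close>] by auto
  then show ?thesis
    by (simp add: sym_point_def C_def S_def d_def)
qed

lemma Vh_cell_expansion:
  assumes "u \<in> Vh \<Omega> T" "K \<in> T" "x \<in> cell_set K"
  shows "u x = (\<Sum>s\<in>UNIV. ref_shape s (cell_inv K x) *\<^sub>R u (K s))"
proof -
  obtain a where a: "u (cell_map K \<xi>) = (\<Sum>s\<in>UNIV. ref_shape s \<xi> *\<^sub>R a s)" if "\<xi> \<in> ref_cube" for \<xi>
    using assms unfolding Vh_def by blast
  have "u (K s) = a s" for s
    using a [OF ref_vertex_in_ref_cube, of s]
    by (simp add: cell_map_ref_vertex ref_shape_ref_vertex of_bool_def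
        if_distrib [where f = "\<lambda>c. c *\<^sub>R _"] cong: if_cong)
  moreover have "u x = (\<Sum>s\<in>UNIV. ref_shape s (cell_inv K x) *\<^sub>R a s)"
    using a [OF cell_inv_in_ref_cube [OF assms(3)]] assms(3) by (simp add: cell_map_cell_inv)
  ultimately show ?thesis
    by simp
qed

text \<open>On each cell the \<open>Q\<^sub>1\<close> shape functions are the weights of a convex combination of the
  values at the vertices.\<close>

lemma Vh_patch_between:
  assumes u: "u \<in> Vh \<Omega> T" and x: "x \<in> patch T i"
    and bounds: "\<And>p. p \<in> all_nodes T \<Longrightarrow> p \<in> patch T i \<Longrightarrow> a \<le> u p $ \<beta> \<and> u p $ \<beta> \<le> b"
  shows "a \<le> u x $ \<beta> \<and> u x $ \<beta> \<le> b"
proof -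
  obtain K where K: "K \<in> T" "i \<in> cell_set K" "x \<in> cell_set K"
    using x by (auto simp: patch_def)
  define c where "c s = ref_shape s (cell_inv K x)" for s
  have c: "c s \<ge> 0" "sum c UNIV = 1" for s
    using K by (auto simp: c_def sum_ref_shape intro: ref_shape_nonneg cell_inv_in_ref_cube)
  have vertex: "a \<le> u (K s) $ \<beta> \<and> u (K s) $ \<beta> \<le> b" for s
    using K vertex_in_cell [of K s] by (intro bounds) (auto simp: all_nodes_def patch_def)
  have "u x $ \<beta> = (\<Sum>s\<in>UNIV. c s * u (K s) $ \<beta>)"
    using Vh_cell_expansion [OF u K(1,3)] by (simp add: c_def)
  moreover have "(\<Sum>s\<in>UNIV. c s * a) \<le> (\<Sum>s\<in>UNIV. c s * u (K s) $ \<beta>)"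
    "(\<Sum>s\<in>UNIV. c s * u (K s) $ \<beta>) \<le> (\<Sum>s\<in>UNIV. c s * b)"
    using c(1) vertex by (auto intro!: sum_mono mult_left_mono)
  ultimately show ?thesis
    by (simp add: sum_distrib_right [symmetric] c(2))
qed

text \<open>At an extremum over the whole patch all slopes have one sign, and there is no cancellation
  between them.\<close>

lemma detector_eq_1:
  assumes i: "i \<in> nodes T" "i \<notin> \<Gamma>" and denom: "detector_denom T w i \<noteq> 0"
    and extremum: "(\<forall>x\<in>patch T i. w i \<le> w x) \<or> (\<forall>x\<in>patch T i. w x \<le> w i)"
  shows "detector T q \<Gamma> w i = 1"
proof -
  let ?N = "patch_nodes T i - {i}"
  have sym: "sym_point T i j \<in> patch T i" and node: "j \<in> patch T i" if "j \<in> ?N" for j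
    using that sym_point_in_patch [OF i(1)] by (auto simp: patch_nodes_def)
  from extremum have "\<bar>\<Sum>j\<in>?N. grad_jump T w i j\<bar> = \<bar>detector_denom T w i\<bar>"
  proof
    assume min: "\<forall>x\<in>patch T i. w i \<le> w x"
    have "grad_jump T w i j = 2 * grad_mean T w i j" if "j \<in> ?N" for j
      using min sym [OF that] node [OF that] by (simp add: grad_jump_def grad_mean_def sym_slope_def)
    then show ?thesis
      by (simp add: detector_denom_def)
  next
    assume max: "\<forall>x\<in>patch T i. w x \<le> w i"
    have "grad_jump T w i j = - (2 * grad_mean T w i j)" if "j \<in> ?N" for j
    proof -
      have "w j - w i \<le> 0" "sym_slope T w i j \<le> 0"
        using max sym [OF that] node [OF that] by (auto simp: sym_slope_def divide_nonpos_nonneg)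
      then have abs_eq: "\<bar>w j - w i\<bar> / norm (j - i) = - ((w j - w i) / norm (j - i))"
          "\<bar>sym_slope T w i j\<bar> = - sym_slope T w i j"
        by (simp_all only: abs_of_nonpos minus_divide_left)
      have "a + b = - (2 * (1 / 2 * (- a + - b)))" for a b :: real
        by (simp add: field_simps)
      then show ?thesis
        unfolding grad_jump_def grad_mean_def abs_eq .
    qed
    then show ?thesis
      by (simp add: detector_denom_def sum_negf)
  qed
  moreover have "0 \<le> detector_denom T w i"
    unfolding detector_denom_def by (intro sum_nonneg) (simp add: grad_mean_def)
  ultimately show ?thesis
    using i denom by (simp add: detector_def)
qed

text \<open>The vertices of the cells of the patch are nodes or hanging nodes, so the bound at these two kinds
  of points extends to the whole patch.\<close>

lemma node_detector_eq_1:
  assumes u: "u \<in> Vh \<Omega> T" and "q \<ge> 0" and "\<beta> \<in> J" and i: "i \<in> nodes T" "i \<notin> \<Gamma> \<beta>"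
    and extremum: "local_discrete_min T (\<lambda>x. u x $ \<beta>) i \<and>
           (\<forall>k \<in> hanging T \<inter> patch T i. u i $ \<beta> \<le> u k $ \<beta>) \<or>
         local_discrete_max T (\<lambda>x. u x $ \<beta>) i \<and>
           (\<forall>k \<in> hanging T \<inter> patch T i. u i $ \<beta> \<ge> u k $ \<beta>)"
    and denom: "detector_denom T (\<lambda>x. u x $ \<beta>) i \<noteq> 0"
  shows "node_detector T q \<Gamma> J u i = 1"
proof -
  define P where "P = all_nodes T \<inter> patch T i"
  have fin: "finite ((\<lambda>p. u p $ \<beta>) ` P)" and P: "P = patch_nodes T i \<union> hanging T \<inter> patch T i"
    using finite_all_nodes by (auto simp: P_def patch_nodes_def nodes_def hanging_def)
  have between: "Min ((\<lambda>p. u p $ \<beta>) ` P) \<le> u x $ \<beta> \<and> u x $ \<beta> \<le> Max ((\<lambda>p. u p $ \<beta>) ` P)"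
    if "x \<in> patch T i" for x
    using fin by (intro Vh_patch_between [OF u that]) (auto simp: P_def)
  have "i \<in> P"
    using i node_in_patch by (auto simp: P patch_nodes_def)
  from extremum have "(\<forall>x\<in>patch T i. u i $ \<beta> \<le> u x $ \<beta>) \<or> (\<forall>x\<in>patch T i. u x $ \<beta> \<le> u i $ \<beta>)"
  proof (elim disjE)
    assume "local_discrete_min T (\<lambda>x. u x $ \<beta>) i \<and>
           (\<forall>k \<in> hanging T \<inter> patch T i. u i $ \<beta> \<le> u k $ \<beta>)"
    then have "u i $ \<beta> \<le> u p $ \<beta>" if "p \<in> P" for p
      using that unfolding P local_discrete_min_def by blast
    then have "u i $ \<beta> \<le> Min ((\<lambda>p. u p $ \<beta>) ` P)"
      using fin \<open>i \<in> P\<close> by (subst Min_ge_iff) auto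
    then show ?thesis
      using between by (meson order_trans)
  next
    assume "local_discrete_max T (\<lambda>x. u x $ \<beta>) i \<and>
           (\<forall>k \<in> hanging T \<inter> patch T i. u i $ \<beta> \<ge> u k $ \<beta>)"
    then have "u p $ \<beta> \<le> u i $ \<beta>" if "p \<in> P" for p
      using that unfolding P local_discrete_max_def by blast
    then have "Max ((\<lambda>p. u p $ \<beta>) ` P) \<le> u i $ \<beta>"
      using fin \<open>i \<in> P\<close> by (subst Max_le_iff) auto
    then show ?thesis
      using between by (meson order_trans)
  qed
  then have "detector T q (\<Gamma> \<beta>) (\<lambda>x. u x $ \<beta>) i = 1"
    by (intro detector_eq_1 i denom)
  then have "1 \<le> node_detector T q \<Gamma> J u i"
    unfolding node_detector_def using \<open>\<beta> \<in> J\<close> by (auto simp: Max_ge_iff intro!: bexI [of _ \<beta>])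
  then show ?thesis
    using node_detector_le_1 [of J q T \<Gamma> u i] assms by force
qed

lemma sys_detector_node: "sys_detector T q \<Gamma> J u i = node_detector T q \<Gamma> J u i" if "i \<in> nodes T"
  using that by (auto simp: sys_detector_def nodes_def)

lemma sys_detector_hanging_ge:
  assumes "k \<in> constrained_by T i"
  shows "node_detector T q \<Gamma> J u i \<le> sys_detector T q \<Gamma> J u k"
proof -
  have k: "k \<in> hanging T" and "i \<in> constraining T k"
    using assms by (auto simp: constrained_by_def)
  moreover have "finite (constraining T k)"
    using finite_subset [OF constraining_subset_nodes [OF k] finite_nodes] .
  ultimately show ?thesis
    by (auto simp: sys_detector_def)
qed

end

section \<open>The stabilized mass matrix\<close>

lemma integrable_of_continuous_on_closure:
  fixes f :: "'a::euclidean_space \<Rightarrow> real"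
  assumes "bounded \<Omega>" "open \<Omega>" "continuous_on (closure \<Omega>) f"
  shows "set_integrable lebesgue \<Omega> f"
proof -
  have "set_integrable lborel (closure \<Omega>) f"
    unfolding set_integrable_def using assms by (intro borel_integrable_compact) auto
  then have "set_integrable lebesgue (closure \<Omega>) f"
    unfolding set_integrable_def by (metis borel_measurable_integrable integrable_completion)
  then show ?thesis
    using assms closure_subset by (rule_tac set_integrable_subset) auto
qed

lemma set_integral_sum:
  fixes f :: "'i \<Rightarrow> 'a \<Rightarrow> real"
  assumes "\<And>i. i \<in> I \<Longrightarrow> set_integrable M A (f i)"
  shows "(LINT x:A|M. (\<Sum>i\<in>I. f i x)) = (\<Sum>i\<in>I. LINT x:A|M. f i x)"
  using assms unfolding set_lebesgue_integral_def set_integrable_def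
  by (simp add: sum_distrib_left Bochner_Integration.integral_sum)

text \<open>Full lumping: all the weights \<open>max (\<alpha>\<^sub>i, \<alpha>\<^sub>k)\<close> in the row are 1.\<close>

lemma stab_mass_eq_diagonal:
  assumes "\<alpha> i = 1" "\<And>j. j \<in> nodes T \<Longrightarrow> \<alpha> j \<le> 1" "j \<in> nodes T"
  shows "stab_mass \<Omega> T \<alpha> i j = ((\<Sum>k\<in>nodes T. mass \<Omega> T i k) * of_bool (i = j)) *\<^sub>R mat 1"
proof -
  have "max (\<alpha> i) (\<alpha> k) = 1" if "k \<in> nodes T" for k
    using assms that by (auto simp: max_def intro: antisym)
  then show ?thesis
    using assms by (simp add: stab_mass_def)
qed

context constrained_mesh
begin

lemma row_sum_mass:
  assumes "open \<Omega>" "bounded \<Omega>" "i \<in> nodes T"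
  shows "(\<Sum>k\<in>nodes T. mass \<Omega> T i k) = (LINT x:\<Omega>|lebesgue. basis_fun T i x)"
proof -
  have "(\<Sum>k\<in>nodes T. mass \<Omega> T i k)
      = (LINT x:\<Omega>|lebesgue. (\<Sum>k\<in>nodes T. basis_fun T k x * basis_fun T i x))"
    unfolding mass_def using assms finite_nodes
    by (intro set_integral_sum [symmetric] integrable_of_continuous_on_closure continuous_intros continuous_on_basis_fun)
  also have "\<dots> = (LINT x:\<Omega>|lebesgue. basis_fun T i x)"
    using assms subsetD [OF closure_subset, of _ \<Omega>]
    by (intro set_lebesgue_integral_cong)
      (auto simp: sum_distrib_right [symmetric] sum_basis_fun)
  finally show ?thesis .
qed

text \<open>The shape function is positive near its node. The node may lie on the boundary of the domain, but
  every neighbourhood of it meets the domain in a nonempty open set.\<close>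

lemma integral_basis_fun_pos:
  assumes "open \<Omega>" "bounded \<Omega>" and i: "i \<in> nodes T"
  shows "0 < (LINT x:\<Omega>|lebesgue. basis_fun T i x)"
proof -
  let ?\<phi> = "basis_fun T i"
  have int: "set_integrable lebesgue \<Omega> ?\<phi>"
    using assms by (intro integrable_of_continuous_on_closure continuous_on_basis_fun)
  have nonneg: "0 \<le> (LINT x:\<Omega>|lebesgue. ?\<phi> x)"
    unfolding set_lebesgue_integral_def
    by (intro integral_nonneg_AE) (auto simp: basis_fun_nonneg)
  have "(LINT x:\<Omega>|lebesgue. ?\<phi> x) \<noteq> 0"
  proof
    assume "(LINT x:\<Omega>|lebesgue. ?\<phi> x) = 0"
    then have "AE x in lebesgue. indicat_real \<Omega> x *\<^sub>R ?\<phi> x = 0"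
      using int unfolding set_lebesgue_integral_def set_integrable_def
      by (subst (asm) integral_nonneg_eq_0_iff_AE) (auto simp: basis_fun_nonneg)
    then obtain N where "N \<in> null_sets lebesgue" and N: "{x. indicat_real \<Omega> x *\<^sub>R ?\<phi> x \<noteq> 0} \<subseteq> N"
      by (auto simp: eventually_ae_filter)
    then have null: "negligible N"
      by (simp add: negligible_iff_null_sets)
    define U where "U = \<Omega> \<inter> ?\<phi> -` {0<..}"
    have "open U"
      unfolding U_def using assms closure_subset
      by (intro continuous_open_preimage continuous_on_subset [OF continuous_on_basis_fun]) auto
    have "U \<noteq> {}"
    proof -
      obtain e where "e > 0" and e: "\<And>x. x \<in> closure \<Omega> \<Longrightarrow> dist x i < e \<Longrightarrow> dist (?\<phi> x) (?\<phi> i) < ?\<phi> i"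
        using continuous_on_basis_fun [OF i] node_in_closure [OF i] basis_fun_at_node_pos [OF i]
        unfolding continuous_on_iff by metis
      obtain x where "x \<in> \<Omega>" "dist x i < e"
        using node_in_closure [OF i] \<open>e > 0\<close> by (auto simp: closure_approachable)
      with e [of x] closure_subset [of \<Omega>] have "x \<in> U"
        by (auto simp: U_def dist_real_def)
      then show ?thesis
        by auto
    qed
    moreover have "negligible U"
      using N by (intro negligible_subset [OF null]) (auto simp: U_def)
    ultimately show False
      using \<open>open U\<close> open_not_negligible by blast
  qed
  with nonneg show ?thesis
    by simp
qed

end

section \<open>Regularity of the shape functions\<close>

text \<open>The partial derivative of \<open>ref_shape s\<close> with respect to the coordinate \<open>k\<close>.\<close>

definition ref_factor :: "'d::finite set \<Rightarrow> 'd \<Rightarrow> real^'d \<Rightarrow> real" where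
  "ref_factor s k \<xi> =
     (if k \<in> s then 1 else - 1) * (\<Prod>l\<in>UNIV - {k}. if l \<in> s then \<xi> $ l else 1 - \<xi> $ l)"

lemma has_derivative_ref_shape:
  "(ref_shape s has_derivative (\<lambda>h. \<Sum>k\<in>UNIV. ref_factor s k \<xi> * h $ k)) (at \<xi> within A)"
proof -
  have "((\<lambda>\<xi>. if k \<in> s then \<xi> $ k else 1 - \<xi> $ k) has_derivative
      (\<lambda>h. (if k \<in> s then 1 else - 1) * h $ k)) (at \<xi> within A)" for k
    by (cases "k \<in> s")
      (auto intro!: derivative_eq_intros bounded_linear_imp_has_derivative bounded_linear_vec_nth)
  then have "((\<lambda>\<xi>. \<Prod>k\<in>UNIV. if k \<in> s then \<xi> $ k else 1 - \<xi> $ k) has_derivative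
      (\<lambda>h. \<Sum>k\<in>UNIV. ((if k \<in> s then 1 else - 1) * h $ k) *
         (\<Prod>l\<in>UNIV - {k}. if l \<in> s then \<xi> $ l else 1 - \<xi> $ l))) (at \<xi> within A)"
    by (intro has_derivative_prod)
  then show ?thesis
    unfolding ref_shape_def [abs_def] ref_factor_def by (simp add: ac_simps)
qed

lemma continuous_on_ref_factor: "continuous_on A (ref_factor s k)"
proof -
  have "continuous_on A (\<lambda>\<xi>. if l \<in> s then \<xi> $ l else 1 - \<xi> $ l)" for l
    by (cases "l \<in> s") (auto intro!: continuous_intros)
  then show ?thesis
    unfolding ref_factor_def [abs_def] by (intro continuous_intros)
qed

text \<open>The derivative at \<open>\<xi>\<close> of the multilinear interpolation of the vertex values \<open>b\<close>. With
  \<open>b = K\<close> it is the derivative of the cell map; with real values it is that of a component of a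
  finite element function on the reference cube.\<close>

definition multilinear_deriv ::
    "('d::finite set \<Rightarrow> 'b::real_normed_vector) \<Rightarrow> real^'d \<Rightarrow> real^'d \<Rightarrow> 'b" where
  "multilinear_deriv b \<xi> h = (\<Sum>s\<in>UNIV. (\<Sum>k\<in>UNIV. ref_factor s k \<xi> * h $ k) *\<^sub>R b s)"

lemma has_derivative_multilinear:
  "((\<lambda>\<xi>. \<Sum>s\<in>UNIV. ref_shape s \<xi> *\<^sub>R b s) has_derivative multilinear_deriv b \<xi>) (at \<xi> within A)"
  unfolding multilinear_deriv_def [abs_def]
  by (intro has_derivative_sum has_derivative_scaleR_left has_derivative_ref_shape)

lemma has_derivative_cell_map: "(cell_map K has_derivative multilinear_deriv K \<xi>) (at \<xi> within A)"
  unfolding cell_map_def [abs_def] by (rule has_derivative_multilinear)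

text \<open>Continuity of the derivative in the operator norm: the bound vanishes at \<open>\<xi> = \<eta>\<close> and is
  continuous in \<open>\<xi>\<close>.\<close>

lemma norm_multilinear_deriv_diff_le:
  "norm (multilinear_deriv b \<xi> h - multilinear_deriv b \<eta> h)
     \<le> (\<Sum>s\<in>UNIV. (\<Sum>k\<in>UNIV. \<bar>ref_factor s k \<xi> - ref_factor s k \<eta>\<bar>) * norm (b s)) * norm h"
proof -
  have "multilinear_deriv b \<xi> h - multilinear_deriv b \<eta> h
      = (\<Sum>s\<in>UNIV. (\<Sum>k\<in>UNIV. (ref_factor s k \<xi> - ref_factor s k \<eta>) * h $ k) *\<^sub>R b s)"
    by (simp add: multilinear_deriv_def sum_subtractf left_diff_distrib scaleR_diff_left)
  also have "norm \<dots> \<le> (\<Sum>s\<in>UNIV. norm ((\<Sum>k\<in>UNIV. (ref_factor s k \<xi> - ref_factor s k \<eta>) * h $ k) *\<^sub>R b s))"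
    by (rule norm_sum)
  also have "\<dots> \<le> (\<Sum>s\<in>UNIV. ((\<Sum>k\<in>UNIV. \<bar>ref_factor s k \<xi> - ref_factor s k \<eta>\<bar>) * norm h) * norm (b s))"
  proof (intro sum_mono)
    fix s
    have "\<bar>\<Sum>k\<in>UNIV. (ref_factor s k \<xi> - ref_factor s k \<eta>) * h $ k\<bar>
        \<le> (\<Sum>k\<in>UNIV. \<bar>ref_factor s k \<xi> - ref_factor s k \<eta>\<bar>) * norm h"
      unfolding sum_distrib_right by (rule order_trans [OF sum_abs])
        (auto simp: abs_mult component_le_norm_cart intro!: sum_mono mult_left_mono)
    then show "norm ((\<Sum>k\<in>UNIV. (ref_factor s k \<xi> - ref_factor s k \<eta>) * h $ k) *\<^sub>R b s)
        \<le> ((\<Sum>k\<in>UNIV. \<bar>ref_factor s k \<xi> - ref_factor s k \<eta>\<bar>) * norm h) * norm (b s)"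
      unfolding norm_scaleR real_norm_def by (rule mult_right_mono) simp
  qed
  also have "\<dots> = (\<Sum>s\<in>UNIV. (\<Sum>k\<in>UNIV. \<bar>ref_factor s k \<xi> - ref_factor s k \<eta>\<bar>) * norm (b s)) * norm h"
    by (simp add: sum_distrib_left sum_distrib_right ac_simps)
  finally show ?thesis .
qed

lemma norm_multilinear_deriv_le:
  assumes "\<xi> \<in> ref_cube"
  shows "norm (multilinear_deriv b \<xi> h) \<le> (\<Sum>s\<in>UNIV. real CARD('d) * norm (b s)) * norm (h :: real^'d::finite)"
proof -
  have "\<bar>ref_factor s k \<xi>\<bar> \<le> 1" for s k
  proof -
    have "\<bar>\<Prod>l\<in>UNIV - {k}. if l \<in> s then \<xi> $ l else 1 - \<xi> $ l\<bar> \<le> 1"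
      unfolding abs_prod using assms by (intro prod_le_1) (auto simp: mem_box_cart abs_le_iff)
    then show ?thesis
      by (simp add: ref_factor_def abs_mult)
  qed
  then have "\<bar>ref_factor s k \<xi> * h $ k\<bar> \<le> 1 * norm h" for s k
    unfolding abs_mult by (intro mult_mono component_le_norm_cart) auto
  then have abs_le: "(\<Sum>k\<in>UNIV. \<bar>ref_factor s k \<xi> * h $ k\<bar>) \<le> real CARD('d) * norm h" for s
    using sum_bounded_above [of UNIV "\<lambda>k. \<bar>ref_factor s k \<xi> * h $ k\<bar>" "norm h"] by simp
  have "\<bar>\<Sum>k\<in>UNIV. ref_factor s k \<xi> * h $ k\<bar> \<le> real CARD('d) * norm h" for s
    by (rule order_trans [OF sum_abs abs_le])
  then have "norm ((\<Sum>k\<in>UNIV. ref_factor s k \<xi> * h $ k) *\<^sub>R b s) \<le> real CARD('d) * norm h * norm (b s)" for s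
    unfolding norm_scaleR real_norm_def by (rule mult_right_mono) simp
  then have "norm (multilinear_deriv b \<xi> h) \<le> (\<Sum>s\<in>UNIV. real CARD('d) * norm h * norm (b s))"
    unfolding multilinear_deriv_def by (intro sum_norm_le) auto
  then show ?thesis
    by (simp add: sum_distrib_left sum_distrib_right ac_simps)
qed

lemma lipschitz_on_multilinear:
  fixes b :: "'d::finite set \<Rightarrow> 'b::real_normed_vector"
  shows "\<exists>L. L-lipschitz_on ref_cube (\<lambda>\<xi>. \<Sum>s\<in>UNIV. ref_shape s \<xi> *\<^sub>R b s)"
proof -
  define L where "L = (\<Sum>s\<in>UNIV. real CARD('d) * norm (b s))"
  have "L-lipschitz_on ref_cube (\<lambda>\<xi>. \<Sum>s\<in>UNIV. ref_shape s \<xi> *\<^sub>R b s)"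
  proof (rule lipschitz_onI)
    fix \<xi> \<eta> :: "real^'d" assume "\<xi> \<in> ref_cube" "\<eta> \<in> ref_cube"
    then show "dist (\<Sum>s\<in>UNIV. ref_shape s \<xi> *\<^sub>R b s) (\<Sum>s\<in>UNIV. ref_shape s \<eta> *\<^sub>R b s) \<le> L * dist \<xi> \<eta>"
      unfolding dist_norm L_def
      by (intro differentiable_bound [OF convex_box(1) has_derivative_multilinear] onorm_le
            norm_multilinear_deriv_le)
  qed (auto simp: L_def intro!: sum_nonneg)
  then show ?thesis ..
qed

text \<open>Near \<open>\<xi>\<^sub>0\<close> the cell map is a small Lipschitz perturbation of its derivative at
  \<open>\<xi>\<^sub>0\<close>, because the derivative is continuous, and that derivative is injective.\<close>

lemma cell_map_locally_expanding:
  fixes K :: "'d::finite cell"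
  assumes "nondegenerate K" "\<xi>\<^sub>0 \<in> ref_cube"
  obtains c \<delta> where "c > 0" "\<delta> > 0"
    "\<And>\<xi> \<eta>. \<xi> \<in> ball \<xi>\<^sub>0 \<delta> \<Longrightarrow> \<eta> \<in> ball \<xi>\<^sub>0 \<delta> \<Longrightarrow> c * dist \<xi> \<eta> \<le> dist (cell_map K \<xi>) (cell_map K \<eta>)"
proof -
  let ?D = "multilinear_deriv K"
  have deriv: "frechet_derivative (cell_map K) (at \<xi>\<^sub>0) = ?D \<xi>\<^sub>0"
    using frechet_derivative_at [OF has_derivative_cell_map [of K]] by (rule sym)
  have "linear (?D \<xi>\<^sub>0)"
    using has_derivative_cell_map [of K \<xi>\<^sub>0 UNIV] has_derivative_linear by blast
  moreover have "det (matrix (?D \<xi>\<^sub>0)) \<noteq> 0"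
    using assms deriv by (auto simp: nondegenerate_def)
  ultimately have "inj (?D \<xi>\<^sub>0)"
    by (simp add: det_nz_iff_inj)
  then obtain B where "B > 0" and B: "\<And>h. B * norm h \<le> norm (?D \<xi>\<^sub>0 h)"
    using linear_inj_bounded_below_pos \<open>linear (?D \<xi>\<^sub>0)\<close> by blast
  define g where
    "g \<xi> = (\<Sum>s\<in>UNIV. (\<Sum>k\<in>UNIV. \<bar>ref_factor s k \<xi> - ref_factor s k \<xi>\<^sub>0\<bar>) * norm (K s))" for \<xi>
  have "continuous_on UNIV g"
    unfolding g_def by (intro continuous_intros continuous_on_ref_factor)
  moreover have "B / 2 > 0"
    using \<open>B > 0\<close> by simp
  ultimately have "\<exists>\<delta>>0. \<forall>\<xi>. dist \<xi> \<xi>\<^sub>0 < \<delta> \<longrightarrow> dist (g \<xi>) (g \<xi>\<^sub>0) < B / 2"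
    unfolding continuous_on_iff by blast
  moreover have "g \<xi>\<^sub>0 = 0"
    by (simp add: g_def)
  ultimately obtain \<delta> where "\<delta> > 0" and \<delta>: "\<And>\<xi>. dist \<xi> \<xi>\<^sub>0 < \<delta> \<Longrightarrow> \<bar>g \<xi>\<bar> < B / 2"
    by (auto simp: dist_real_def)
  show thesis
  proof (rule that [of "B / 2" \<delta>])
    fix \<xi> \<eta> assume near: "\<xi> \<in> ball \<xi>\<^sub>0 \<delta>" "\<eta> \<in> ball \<xi>\<^sub>0 \<delta>"
    have "norm ((cell_map K \<xi> - ?D \<xi>\<^sub>0 \<xi>) - (cell_map K \<eta> - ?D \<xi>\<^sub>0 \<eta>)) \<le> B / 2 * norm (\<xi> - \<eta>)"
    proof (rule differentiable_bound [OF convex_ball _ _ near])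
      fix \<zeta> assume "\<zeta> \<in> ball \<xi>\<^sub>0 \<delta>"
      then have "g \<zeta> \<le> B / 2"
        using \<delta> [of \<zeta>] by (simp add: dist_commute)
      then have "norm (?D \<zeta> h - ?D \<xi>\<^sub>0 h) \<le> B / 2 * norm h" for h
        using norm_multilinear_deriv_diff_le [of K \<zeta> h \<xi>\<^sub>0] mult_right_mono [OF _ norm_ge_zero [of h]]
        unfolding g_def by (meson order_trans)
      then show "onorm (\<lambda>h. ?D \<zeta> h - ?D \<xi>\<^sub>0 h) \<le> B / 2"
        by (rule onorm_le)
      show "((\<lambda>\<xi>. cell_map K \<xi> - ?D \<xi>\<^sub>0 \<xi>) has_derivative (\<lambda>h. ?D \<zeta> h - ?D \<xi>\<^sub>0 h)) (at \<zeta> within ball \<xi>\<^sub>0 \<delta>)"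
        using \<open>linear (?D \<xi>\<^sub>0)\<close>
        by (intro has_derivative_diff has_derivative_cell_map linear_imp_has_derivative)
    qed
    moreover have "?D \<xi>\<^sub>0 (\<xi> - \<eta>) = ?D \<xi>\<^sub>0 \<xi> - ?D \<xi>\<^sub>0 \<eta>"
      using \<open>linear (?D \<xi>\<^sub>0)\<close> by (rule linear_diff)
    moreover have "B * norm (\<xi> - \<eta>) \<le> norm (?D \<xi>\<^sub>0 (\<xi> - \<eta>))"
      by (rule B)
    moreover have "norm (?D \<xi>\<^sub>0 \<xi> - ?D \<xi>\<^sub>0 \<eta>) \<le> norm (cell_map K \<xi> - cell_map K \<eta>) +
        norm ((cell_map K \<xi> - ?D \<xi>\<^sub>0 \<xi>) - (cell_map K \<eta> - ?D \<xi>\<^sub>0 \<eta>))"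
      using norm_triangle_ineq4 [of "cell_map K \<xi> - cell_map K \<eta>"
          "(cell_map K \<xi> - ?D \<xi>\<^sub>0 \<xi>) - (cell_map K \<eta> - ?D \<xi>\<^sub>0 \<eta>)"] by (simp add: algebra_simps)
    ultimately show "B / 2 * dist \<xi> \<eta> \<le> dist (cell_map K \<xi>) (cell_map K \<eta>)"
      by (simp add: dist_norm)
  qed (use \<open>B > 0\<close> \<open>\<delta> > 0\<close> in auto)
qed

text \<open>Locally the cell map is expanding and its inverse is continuous, so the inverse is locally Lipschitz;
  on a compact set this gives a uniform constant.\<close>

lemma lipschitz_on_cell_inv:
  fixes K :: "'d::finite cell"
  assumes "nondegenerate K"
  shows "\<exists>L. L-lipschitz_on (cell_set K) (cell_inv K)"
proof -
  have "local_lipschitz {0::real} (cell_set K) (\<lambda>_. cell_inv K)"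
  proof (rule local_lipschitzI)
    fix x assume x: "x \<in> cell_set K"
    obtain c \<delta> where "c > 0" "\<delta> > 0" and expanding:
      "\<And>\<xi> \<eta>. \<xi> \<in> ball (cell_inv K x) \<delta> \<Longrightarrow> \<eta> \<in> ball (cell_inv K x) \<delta> \<Longrightarrow>
         c * dist \<xi> \<eta> \<le> dist (cell_map K \<xi>) (cell_map K \<eta>)"
      using cell_map_locally_expanding [OF assms cell_inv_in_ref_cube [OF x]] by metis
    obtain \<epsilon> where "\<epsilon> > 0" and
      \<epsilon>: "\<And>y. y \<in> cell_set K \<Longrightarrow> dist y x < \<epsilon> \<Longrightarrow> dist (cell_inv K y) (cell_inv K x) < \<delta>"
      using continuous_on_cell_inv [OF assms] x \<open>\<delta> > 0\<close> unfolding continuous_on_iff by metis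
    have "(1 / c)-lipschitz_on (cball x (\<epsilon> / 2) \<inter> cell_set K) (cell_inv K)"
    proof (rule lipschitz_onI)
      fix y z assume yz: "y \<in> cball x (\<epsilon> / 2) \<inter> cell_set K" "z \<in> cball x (\<epsilon> / 2) \<inter> cell_set K"
      then have "dist y x < \<epsilon>" "dist z x < \<epsilon>"
        using \<open>\<epsilon> > 0\<close> by (auto simp: dist_commute)
      with yz have "c * dist (cell_inv K y) (cell_inv K z) \<le> dist y z"
        using expanding [of "cell_inv K y" "cell_inv K z"] \<epsilon> [of y] \<epsilon> [of z]
        by (simp add: cell_map_cell_inv dist_commute)
      then show "dist (cell_inv K y) (cell_inv K z) \<le> 1 / c * dist y z"
        using \<open>c > 0\<close> by (simp add: field_simps)
    qed (use \<open>c > 0\<close> in auto)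
    then show "\<exists>u>0. \<exists>L. \<forall>t\<in>cball t u \<inter> {0}. L-lipschitz_on (cball x u \<inter> cell_set K) (cell_inv K)" for t :: real
      using \<open>\<epsilon> > 0\<close> by (intro exI [of _ "\<epsilon> / 2"]) auto
  qed
  from local_lipschitz_compact_implies_lipschitz [OF this compact_cell_set compact_sing]
  show ?thesis
    by auto
qed

text \<open>The derivative of the cell map is invertible, so the inverse function theorem applies in the
  interior of the reference cube.\<close>

lemma differentiable_cell_inv:
  assumes K: "nondegenerate K" and \<xi>: "\<xi> \<in> box 0 1"
  shows "cell_inv K differentiable (at (cell_map K \<xi>))"
proof -
  let ?D = "multilinear_deriv K \<xi>"
  have cube: "\<xi> \<in> ref_cube"
    using \<xi> box_subset_cbox by blast
  have "linear ?D"
    using has_derivative_cell_map [of K \<xi> UNIV] has_derivative_linear by blast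
  moreover have "det (matrix ?D) \<noteq> 0"
    using K cube frechet_derivative_at [OF has_derivative_cell_map, of K \<xi>] by (auto simp: nondegenerate_def)
  ultimately have "inj ?D"
    by (simp add: det_nz_iff_inj)
  then have "surj ?D"
    using \<open>linear ?D\<close> linear_injective_imp_surjective by blast
  then obtain D' where "?D \<circ> D' = id"
    using \<open>linear ?D\<close> linear_surjective_right_inverse by blast
  have "(cell_inv K has_derivative D') (at (cell_map K \<xi>))"
  proof (rule has_derivative_inverse_strong [OF open_box \<xi> continuous_on_cell_map])
    show "cell_inv K (cell_map K \<eta>) = \<eta>" if "\<eta> \<in> box 0 1" for \<eta>
      using that box_subset_cbox by (intro cell_inv_cell_map [OF K]) blast
  qed (fact has_derivative_cell_map \<open>?D \<circ> D' = id\<close>)+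
  then show ?thesis
    by (auto simp: differentiable_def)
qed

lemma open_cell_interior: "open (cell_map K ` box 0 1)" if "nondegenerate K"
proof (rule invariance_of_domain [OF continuous_on_cell_map open_box])
  show "inj_on (cell_map K) (box 0 1)"
    using that box_subset_cbox by (auto simp: nondegenerate_def intro: inj_on_subset)
qed

lemma negligible_cell_boundary: "negligible (cell_map K ` (ref_cube - box 0 1))"
proof (rule negligible_differentiable_image_negligible [OF order_refl negligible_frontier_interval])
  show "cell_map K differentiable_on ref_cube - box 0 1"
    using has_derivative_cell_map by (auto simp: differentiable_on_def differentiable_def)
qed

text \<open>On a curved cell the segment between two points may leave the cell, so a Lipschitz bound per
  cell is transported along a segment that stays inside the union of the cells.\<close>

lemma lipschitz_along_segment:
  fixes f :: "'a::real_normed_vector \<Rightarrow> real"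
  assumes "finite \<C>" "\<And>C. C \<in> \<C> \<Longrightarrow> closed C" "\<And>C. C \<in> \<C> \<Longrightarrow> L-lipschitz_on C f" "L \<ge> 0"
    and segment: "closed_segment x y \<subseteq> \<Union>\<C>"
  shows "dist (f x) (f y) \<le> L * dist x y"
proof -
  define \<gamma> where "\<gamma> t = x + t *\<^sub>R (y - x)" for t
  have "(L * norm (y - x))-lipschitz_on {0..1} (f \<circ> \<gamma>)"
  proof (rule lipschitz_on_closed_Union [where U = "\<lambda>C. \<gamma> -` C" and I = \<C>])
    fix C assume C: "C \<in> \<C>"
    have "(norm (y - x))-lipschitz_on (\<gamma> -` C) \<gamma>"
      by (rule lipschitz_onI) (auto simp: \<gamma>_def dist_norm scaleR_diff_left [symmetric])
    moreover have "L-lipschitz_on (\<gamma> ` (\<gamma> -` C)) f"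
      using assms(3) [OF C] by (rule lipschitz_on_subset) auto
    ultimately show "(L * norm (y - x))-lipschitz_on (\<gamma> -` C) (f \<circ> \<gamma>)"
      by (rule lipschitz_on_compose)
    show "closed (\<gamma> -` C)"
      using assms(2) [OF C] unfolding \<gamma>_def by (intro closed_vimage continuous_intros)
  next
    show "{0..1} \<subseteq> (\<Union>C\<in>\<C>. \<gamma> -` C)"
    proof
      fix t :: real assume "t \<in> {0..1}"
      then have "\<gamma> t \<in> closed_segment x y"
        unfolding in_segment by (intro exI [of _ t]) (auto simp: \<gamma>_def algebra_simps)
      with segment show "t \<in> (\<Union>C\<in>\<C>. \<gamma> -` C)"
        by auto
    qed
  qed (use assms in auto)
  from lipschitz_onD [OF this, of 0 1] show ?thesis
    by (simp add: \<gamma>_def dist_norm norm_minus_commute)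
qed

text \<open>The product rule for Lipschitz constants, with bounds for the factors from compactness. It makes
  \<open>v\<^sub>k \<phi>\<^sub>i\<close> an admissible function in the Gauss-Green formula.\<close>

lemma W1_infinity_mult:
  assumes "bounded \<Omega>" and f: "W1_infinity \<Omega> f" and g: "W1_infinity \<Omega> g"
  shows "W1_infinity \<Omega> (\<lambda>x. f x * g x)"
proof -
  obtain A where "A > 0" and A: "\<And>x. x \<in> closure \<Omega> \<Longrightarrow> \<bar>f x\<bar> \<le> A"
    using assms compact_continuous_image [of "closure \<Omega>" f]
    by (auto simp: W1_infinity_def bounded_pos dest!: compact_imp_bounded)
  obtain B where "B > 0" and B: "\<And>x. x \<in> closure \<Omega> \<Longrightarrow> \<bar>g x\<bar> \<le> B"
    using assms compact_continuous_image [of "closure \<Omega>" g]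
    by (auto simp: W1_infinity_def bounded_pos dest!: compact_imp_bounded)
  obtain L where L: "\<And>x. x \<in> \<Omega> \<Longrightarrow> \<exists>\<epsilon>>0. L-lipschitz_on (ball x \<epsilon> \<inter> \<Omega>) f"
    using f by (auto simp: W1_infinity_def)
  obtain M where M: "\<And>x. x \<in> \<Omega> \<Longrightarrow> \<exists>\<epsilon>>0. M-lipschitz_on (ball x \<epsilon> \<inter> \<Omega>) g"
    using g by (auto simp: W1_infinity_def)
  have "\<exists>\<epsilon>>0. (A * M + B * L)-lipschitz_on (ball x \<epsilon> \<inter> \<Omega>) (\<lambda>x. f x * g x)" if x: "x \<in> \<Omega>" for x
  proof -
    obtain \<delta> where "\<delta> > 0" and \<delta>: "L-lipschitz_on (ball x \<delta> \<inter> \<Omega>) f"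
      using L [OF x] by auto
    obtain \<epsilon> where "\<epsilon> > 0" and \<epsilon>: "M-lipschitz_on (ball x \<epsilon> \<inter> \<Omega>) g"
      using M [OF x] by auto
    have "(A * M + B * L)-lipschitz_on (ball x (min \<delta> \<epsilon>) \<inter> \<Omega>) (\<lambda>x. f x * g x)"
    proof (rule lipschitz_onI)
      fix y z assume yz: "y \<in> ball x (min \<delta> \<epsilon>) \<inter> \<Omega>" "z \<in> ball x (min \<delta> \<epsilon>) \<inter> \<Omega>"
      then have "\<bar>f y\<bar> \<le> A" "\<bar>g z\<bar> \<le> B"
        using A B closure_subset by blast+
      moreover have "\<bar>g y - g z\<bar> \<le> M * dist y z" "\<bar>f y - f z\<bar> \<le> L * dist y z"
        using lipschitz_onD [OF \<epsilon>, of y z] lipschitz_onD [OF \<delta>, of y z] yz by (auto simp: dist_real_def)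
      ultimately have "\<bar>f y\<bar> * \<bar>g y - g z\<bar> + \<bar>g z\<bar> * \<bar>f y - f z\<bar> \<le> A * (M * dist y z) + B * (L * dist y z)"
        using \<open>A > 0\<close> \<open>B > 0\<close> by (intro add_mono mult_mono) auto
      moreover have "f y * g y - f z * g z = f y * (g y - g z) + g z * (f y - f z)"
        by (simp add: algebra_simps)
      then have "dist (f y * g y) (f z * g z) \<le> \<bar>f y\<bar> * \<bar>g y - g z\<bar> + \<bar>g z\<bar> * \<bar>f y - f z\<bar>"
        unfolding dist_real_def abs_mult [symmetric] by (simp only: abs_triangle_ineq)
      ultimately show "dist (f y * g y) (f z * g z) \<le> (A * M + B * L) * dist y z"
        by (simp add: algebra_simps)
    qed (use \<open>A > 0\<close> \<open>B > 0\<close> lipschitz_on_nonneg [OF \<delta>] lipschitz_on_nonneg [OF \<epsilon>] in auto)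
    then show ?thesis
      using \<open>\<delta> > 0\<close> \<open>\<epsilon> > 0\<close> by (intro exI [of _ "min \<delta> \<epsilon>"]) auto
  qed
  moreover have "continuous_on (closure \<Omega>) (\<lambda>x. f x * g x)"
    using f g by (auto simp: W1_infinity_def intro: continuous_intros)
  ultimately show ?thesis
    unfolding W1_infinity_def by blast
qed

context constrained_mesh
begin

text \<open>The constraints only recombine the shape functions of the vertices. Pulled back to the reference
  cube, a constrained shape function is therefore a single multilinear interpolation.\<close>

lemma cell_basis_multilinear:
  assumes "K \<in> T"
  obtains b where "\<And>x. x \<in> cell_set K \<Longrightarrow> cell_basis T K i x = (\<Sum>s\<in>UNIV. ref_shape s (cell_inv K x) *\<^sub>R b s)"
proof
  have shape: "shape K p x = (\<Sum>s\<in>UNIV. ref_shape s (cell_inv K x) * of_bool (K s = p))"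
    if "x \<in> cell_set K" for p x
    using that by (simp add: shape_def of_bool_def if_distrib [where f = "\<lambda>c. _ * c"] sum.If_cases cong: if_cong)
  let ?b = "\<lambda>s. of_bool (K s = i) + (\<Sum>k\<in>constrained_by T i. constr T k i * of_bool (K s = k))"
  fix x assume "x \<in> cell_set K"
  then have "cell_basis T K i x = (\<Sum>s\<in>UNIV. ref_shape s (cell_inv K x) * of_bool (K s = i)) +
     (\<Sum>k\<in>constrained_by T i. \<Sum>s\<in>UNIV. constr T k i * (ref_shape s (cell_inv K x) * of_bool (K s = k)))"
    by (simp only: cell_basis_def shape sum_distrib_left)
  also have "\<dots> = (\<Sum>s\<in>UNIV. ref_shape s (cell_inv K x) *\<^sub>R ?b s)"
    by (subst sum.swap) (simp add: sum.distrib distrib_left sum_distrib_left ac_simps)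
  finally show "cell_basis T K i x = (\<Sum>s\<in>UNIV. ref_shape s (cell_inv K x) *\<^sub>R ?b s)" .
qed

lemma basis_fun_lipschitz_on_cells:
  assumes i: "i \<in> nodes T"
  obtains L where "L \<ge> 0" "\<And>K. K \<in> T \<Longrightarrow> L-lipschitz_on (cell_set K) (basis_fun T i)"
proof -
  have "\<exists>L. L-lipschitz_on (cell_set K) (basis_fun T i)" if K: "K \<in> T" for K
  proof -
    obtain b where b: "\<And>x. x \<in> cell_set K \<Longrightarrow>
        cell_basis T K i x = (\<Sum>s\<in>UNIV. ref_shape s (cell_inv K x) *\<^sub>R b s)"
      using cell_basis_multilinear [OF K] by blast
    obtain M where M: "M-lipschitz_on ref_cube (\<lambda>\<xi>. \<Sum>s\<in>UNIV. ref_shape s \<xi> *\<^sub>R b s)"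
      using lipschitz_on_multilinear [of b] by auto
    obtain L where L: "L-lipschitz_on (cell_set K) (cell_inv K)"
      using lipschitz_on_cell_inv [OF nondegenerate_cell [OF K]] by auto
    have "M-lipschitz_on (cell_inv K ` cell_set K) (\<lambda>\<xi>. \<Sum>s\<in>UNIV. ref_shape s \<xi> *\<^sub>R b s)"
      using M by (rule lipschitz_on_subset) (auto intro: cell_inv_in_ref_cube)
    with L have "(M * L)-lipschitz_on (cell_set K) (\<lambda>x. \<Sum>s\<in>UNIV. ref_shape s (cell_inv K x) *\<^sub>R b s)"
      by (rule lipschitz_on_compose2)
    then have "(M * L)-lipschitz_on (cell_set K) (basis_fun T i)"
      by (rule lipschitz_on_transform) (simp add: b basis_fun_eq_cell_basis [OF i K])
    then show ?thesis ..
  qed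
  then obtain L where L: "\<And>K. K \<in> T \<Longrightarrow> (L K)-lipschitz_on (cell_set K) (basis_fun T i)"
    by metis
  show thesis
  proof
    have nonneg: "K \<in> T \<Longrightarrow> 0 \<le> L K" for K
      using L lipschitz_on_nonneg by blast
    then show "0 \<le> sum L T"
      by (rule sum_nonneg)
    fix K assume K: "K \<in> T"
    then have "L K \<le> sum L T"
      using finite_cells nonneg by (intro member_le_sum) auto
    with L [OF K] show "(sum L T)-lipschitz_on (cell_set K) (basis_fun T i)"
      by (rule lipschitz_on_le)
  qed
qed

text \<open>The Lipschitz constants of the finitely many pieces have a common bound, which carries over to every
  ball inside the domain.\<close>

lemma W1_infinity_basis_fun:
  assumes "open \<Omega>" and i: "i \<in> nodes T"
  shows "W1_infinity \<Omega> (basis_fun T i)"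
proof -
  obtain L where "L \<ge> 0" and L: "\<And>K. K \<in> T \<Longrightarrow> L-lipschitz_on (cell_set K) (basis_fun T i)"
    using basis_fun_lipschitz_on_cells [OF i] by blast
  have "\<exists>\<epsilon>>0. L-lipschitz_on (ball x \<epsilon> \<inter> \<Omega>) (basis_fun T i)" if x: "x \<in> \<Omega>" for x
  proof -
    obtain \<epsilon> where "\<epsilon> > 0" and \<epsilon>: "ball x \<epsilon> \<subseteq> \<Omega>"
      using \<open>open \<Omega>\<close> x open_contains_ball by blast
    have "L-lipschitz_on (ball x \<epsilon> \<inter> \<Omega>) (basis_fun T i)"
    proof (rule lipschitz_onI)
      fix y z assume "y \<in> ball x \<epsilon> \<inter> \<Omega>" "z \<in> ball x \<epsilon> \<inter> \<Omega>"
      then have "closed_segment y z \<subseteq> ball x \<epsilon>"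
        by (intro closed_segment_subset) auto
      with \<epsilon> have "closed_segment y z \<subseteq> \<Union> (cell_set ` T)"
        using closure_subset [of \<Omega>] by (auto simp: Union_cells)
      then show "dist (basis_fun T i y) (basis_fun T i z) \<le> L * dist y z"
        using finite_cells L \<open>L \<ge> 0\<close>
        by (intro lipschitz_along_segment [where \<C> = "cell_set ` T"])
          (auto intro: compact_imp_closed compact_cell_set)
    qed (fact \<open>L \<ge> 0\<close>)
    with \<open>\<epsilon> > 0\<close> show ?thesis
      by auto
  qed
  with continuous_on_basis_fun [OF i] show ?thesis
    unfolding W1_infinity_def by blast
qed

definition skeleton :: "(real^'d) set" where
  "skeleton = (\<Union>K\<in>T. cell_map K ` (ref_cube - box 0 1))"

lemma negligible_skeleton: "negligible skeleton"
  unfolding skeleton_def using finite_cells by (intro negligible_Union) (auto intro: negligible_cell_boundary)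

text \<open>Off the skeleton a point lies in the image of an open reference cube, which is open, and there the
  shape function is a smooth function of the inverse of the cell map.\<close>

lemma differentiable_basis_fun:
  assumes i: "i \<in> nodes T" and x: "x \<in> closure \<Omega> - skeleton"
  shows "basis_fun T i differentiable (at x)"
proof -
  obtain K where K: "K \<in> T" "x \<in> cell_set K"
    using x by (auto simp: Union_cells [symmetric])
  with x have interior: "x \<in> cell_map K ` box 0 1"
    by (auto simp: skeleton_def cell_set_def)
  have subset: "cell_map K ` box 0 1 \<subseteq> cell_set K"
    unfolding cell_set_def using box_subset_cbox by blast
  obtain b where b: "\<And>x. x \<in> cell_set K \<Longrightarrow>
      cell_basis T K i x = (\<Sum>s\<in>UNIV. ref_shape s (cell_inv K x) *\<^sub>R b s)"
    using cell_basis_multilinear [OF K(1)] by blast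
  let ?m = "\<lambda>\<xi>. \<Sum>s\<in>UNIV. ref_shape s \<xi> *\<^sub>R b s"
  have "?m differentiable (at (cell_inv K x))"
    using has_derivative_multilinear [of b] unfolding differentiable_def by blast
  moreover have "cell_inv K differentiable (at x)"
    using differentiable_cell_inv [OF nondegenerate_cell [OF K(1)]] interior by auto
  ultimately obtain D where D: "((\<lambda>x. ?m (cell_inv K x)) has_derivative D) (at x)"
    using differentiable_chain_at [of "cell_inv K" x ?m] by (auto simp: differentiable_def comp_def)
  have "(basis_fun T i has_derivative D) (at x)"
    using D open_cell_interior [OF nondegenerate_cell [OF K(1)]] interior
  proof (rule has_derivative_transform_within_open)
    show "?m (cell_inv K y) = basis_fun T i y" if "y \<in> cell_map K ` box 0 1" for y
      using that subset b by (auto simp: basis_fun_eq_cell_basis [OF i K(1)])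
  qed
  then show ?thesis
    by (auto simp: differentiable_def)
qed

end

section \<open>Integration by parts\<close>

text \<open>A partial derivative as a limit of a sequence, which gives its measurability and its bound.\<close>

lemma partial_LIMSEQ:
  assumes "w differentiable (at x)"
  shows "(\<lambda>n. (w (x + inverse (real (Suc n)) *\<^sub>R axis k 1) - w x) * real (Suc n)) \<longlonglongrightarrow> partial k w x"
proof -
  have w: "(w has_derivative frechet_derivative w (at x)) (at x)"
    using assms by (simp add: frechet_derivative_works)
  then have "((\<lambda>t. w (x + t *\<^sub>R axis k 1)) has_derivative
      (\<lambda>t. frechet_derivative w (at x) (t *\<^sub>R axis k 1))) (at 0)"
    by (intro has_derivative_compose [of "\<lambda>t. x + t *\<^sub>R axis k 1" _ 0 UNIV w, simplified])
      (auto intro!: derivative_eq_intros)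
  moreover have "frechet_derivative w (at x) (t *\<^sub>R axis k 1) = t * partial k w x" for t
    using has_derivative_linear [OF w] by (simp add: partial_def linear_scale)
  ultimately have "((\<lambda>t. w (x + t *\<^sub>R axis k 1)) has_real_derivative partial k w x) (at 0)"
    by (simp add: has_field_derivative_def mult_commute_abs)
  then have "((\<lambda>t. (w (x + t *\<^sub>R axis k 1) - w x) / t) \<longlongrightarrow> partial k w x) (at 0)"
    by (simp add: has_field_derivative_iff)
  moreover have "filterlim (\<lambda>n. inverse (real (Suc n))) (at 0) sequentially"
    using LIMSEQ_inverse_real_of_nat by (auto simp: filterlim_at)
  ultimately have "(\<lambda>n. (w (x + inverse (real (Suc n)) *\<^sub>R axis k 1) - w x) / inverse (real (Suc n)))
      \<longlonglongrightarrow> partial k w x"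
    by (rule filterlim_compose)
  then show ?thesis
    by (simp add: divide_inverse)
qed

lemma abs_partial_le:
  fixes w :: "real^'d::finite \<Rightarrow> real"
  assumes "open \<Omega>" "x \<in> \<Omega>" "\<epsilon> > 0" and lip: "L-lipschitz_on (ball x \<epsilon> \<inter> \<Omega>) w"
    and "w differentiable (at x)"
  shows "\<bar>partial k w x\<bar> \<le> L"
proof (rule tendsto_upperbound)
  let ?y = "\<lambda>n. x + inverse (real (Suc n)) *\<^sub>R axis k 1"
  show "(\<lambda>n. \<bar>(w (?y n) - w x) * real (Suc n)\<bar>) \<longlonglongrightarrow> \<bar>partial k w x\<bar>"
    by (intro tendsto_rabs partial_LIMSEQ assms)
  have "?y \<longlonglongrightarrow> x + 0 *\<^sub>R axis k 1"
    by (intro tendsto_intros LIMSEQ_inverse_real_of_nat)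
  moreover have "open (ball x \<epsilon> \<inter> \<Omega>)"
    using assms by auto
  ultimately have "eventually (\<lambda>n. ?y n \<in> ball x \<epsilon> \<inter> \<Omega>) sequentially"
    using assms by (intro topological_tendstoD) auto
  then show "eventually (\<lambda>n. \<bar>(w (?y n) - w x) * real (Suc n)\<bar> \<le> L) sequentially"
  proof (rule eventually_mono)
    fix n assume "?y n \<in> ball x \<epsilon> \<inter> \<Omega>"
    then have "\<bar>w (?y n) - w x\<bar> \<le> L * inverse (real (Suc n))"
      using lipschitz_onD [OF lip, of "?y n" x] assms
      by (simp add: dist_norm norm_axis_1 del: of_nat_Suc)
    then have "\<bar>w (?y n) - w x\<bar> * real (Suc n) \<le> L * inverse (real (Suc n)) * real (Suc n)"
      by (rule mult_right_mono) simp
    also have "\<dots> = L"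
      by (simp only: mult.assoc) simp
    finally show "\<bar>(w (?y n) - w x) * real (Suc n)\<bar> \<le> L"
      by (simp only: abs_mult abs_of_nat)
  qed
qed simp

text \<open>The partial derivative is bounded by the uniform local Lipschitz constant, and almost everywhere it
  is the limit of measurable difference quotients.\<close>

lemma partial_absolutely_integrable:
  fixes w :: "real^'d::finite \<Rightarrow> real"
  assumes \<Omega>: "open \<Omega>" "bounded \<Omega>" and w: "W1_infinity \<Omega> w"
    and N: "negligible N" "\<And>x. x \<in> \<Omega> - N \<Longrightarrow> w differentiable (at x)"
  shows "partial k w absolutely_integrable_on \<Omega>"
proof -
  \<comment> \<open>Outside the closure of the domain \<open>w\<close> is arbitrary and may fail to be measurable, but the
    difference quotients near the boundary evaluate it there.\<close>
  define w' where "w' x = (if x \<in> closure \<Omega> then w x else 0)" for x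
  define h where "h n x = (if x \<in> N then 0
      else (w' (x + inverse (real (Suc n)) *\<^sub>R axis k 1) - w' x) * real (Suc n))" for n x
  define p where "p x = (if x \<in> N then 0 else partial k w x)" for x
  obtain L where L: "\<And>x. x \<in> \<Omega> \<Longrightarrow> \<exists>\<epsilon>>0. L-lipschitz_on (ball x \<epsilon> \<inter> \<Omega>) w"
    using w by (auto simp: W1_infinity_def)
  have \<Omega>_sets: "\<Omega> \<in> sets lebesgue"
    using \<Omega> by auto
  have N_sets: "N \<in> sets lebesgue"
    using N by (simp add: negligible_imp_sets)
  have w'_borel: "w' \<in> borel_measurable borel"
  proof -
    have "(\<lambda>x. indicator (closure \<Omega>) x *\<^sub>R w x) \<in> borel_measurable borel"
      using w by (intro borel_measurable_continuous_on_indicator) (auto simp: W1_infinity_def)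
    also have "(\<lambda>x. indicator (closure \<Omega>) x *\<^sub>R w x) = w'"
      by (auto simp: w'_def indicator_def)
    finally show ?thesis .
  qed
  have h_measurable: "h n \<in> borel_measurable (lebesgue_on \<Omega>)" for n
  proof -
    have "(\<lambda>x. (w' (x + inverse (real (Suc n)) *\<^sub>R axis k 1) - w' x) * real (Suc n)) \<in> borel_measurable lebesgue"
    proof (intro measurable_completion borel_measurable_times borel_measurable_diff)
      show "w' \<in> borel_measurable lborel"
        using w'_borel by simp
      show "(\<lambda>x. w' (x + inverse (real (Suc n)) *\<^sub>R axis k 1)) \<in> borel_measurable lborel"
        by (rule measurable_compose [OF _ w'_borel]) simp
    qed simp
    then have "h n \<in> borel_measurable lebesgue"
      unfolding h_def using N_sets by (intro measurable_If_set) auto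
    then show ?thesis
      by (rule measurable_restrict_space1)
  qed
  have h_tendsto: "(\<lambda>n. h n x) \<longlonglongrightarrow> p x" if x: "x \<in> \<Omega>" for x
  proof (cases "x \<in> N")
    case False
    have "(\<lambda>n. x + inverse (real (Suc n)) *\<^sub>R axis k 1) \<longlonglongrightarrow> x + 0 *\<^sub>R axis k 1"
      by (intro tendsto_intros LIMSEQ_inverse_real_of_nat)
    then have "eventually (\<lambda>n. x + inverse (real (Suc n)) *\<^sub>R axis k 1 \<in> \<Omega>) sequentially"
      using \<Omega> x by (intro topological_tendstoD) auto
    then have "eventually (\<lambda>n. (w (x + inverse (real (Suc n)) *\<^sub>R axis k 1) - w x) * real (Suc n) = h n x) sequentially"
      by (rule eventually_mono) (use x False closure_subset [of \<Omega>] in \<open>auto simp: h_def w'_def\<close>)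
    moreover have "(\<lambda>n. (w (x + inverse (real (Suc n)) *\<^sub>R axis k 1) - w x) * real (Suc n)) \<longlonglongrightarrow> p x"
      using partial_LIMSEQ [OF N(2)] x False by (simp add: p_def)
    ultimately show ?thesis
      by (rule Lim_transform_eventually [rotated])
  qed (simp add: h_def p_def)
  have "p \<in> borel_measurable (lebesgue_on \<Omega>)"
    by (rule borel_measurable_LIMSEQ_metric [where f = h, OF h_measurable]) (auto intro: h_tendsto)
  moreover have "norm (p x) \<le> \<bar>L\<bar>" if x: "x \<in> \<Omega>" for x
  proof (cases "x \<in> N")
    case False
    obtain \<epsilon> where "\<epsilon> > 0" "L-lipschitz_on (ball x \<epsilon> \<inter> \<Omega>) w"
      using L [OF x] by auto
    then have "\<bar>partial k w x\<bar> \<le> L"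
      using x False by (intro abs_partial_le [OF \<Omega>(1) x _ _ N(2)]) auto
    with False show ?thesis
      by (simp add: p_def)
  qed (simp add: p_def)
  moreover have "(\<lambda>x. \<bar>L\<bar>) integrable_on \<Omega>"
    using \<Omega> by (intro integrable_on_const) (simp add: bounded_set_imp_lmeasurable lmeasurable_open)
  ultimately have "p absolutely_integrable_on \<Omega>"
    using \<Omega>_sets by (intro measurable_bounded_by_integrable_imp_absolutely_integrable)
  then show ?thesis
    by (rule absolutely_integrable_spike [OF _ N(1)]) (simp add: p_def)
qed

lemma continuous_times_absolutely_integrable:
  fixes f g :: "real^'d::finite \<Rightarrow> real"
  assumes "open \<Omega>" "bounded \<Omega>" "continuous_on (closure \<Omega>) f" "g absolutely_integrable_on \<Omega>"
  shows "(\<lambda>x. f x * g x) absolutely_integrable_on \<Omega>"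
proof (rule absolutely_integrable_bounded_measurable_product [OF bilinear_times])
  show "f \<in> borel_measurable (lebesgue_on \<Omega>)"
    using assms closure_subset
    by (intro continuous_imp_measurable_on_sets_lebesgue continuous_on_subset [OF assms(3)]) auto
  have "bounded (f ` closure \<Omega>)"
    using assms by (intro compact_imp_bounded compact_continuous_image) auto
  then show "bounded (f ` \<Omega>)"
    by (rule bounded_subset) (use closure_subset in blast)
qed (use assms in auto)

lemma partial_mult:
  assumes f: "f differentiable (at x)" and g: "g differentiable (at x)"
  shows "partial k (\<lambda>y. f y * g y) x = f x * partial k g x + partial k f x * g x"
proof -
  have "((\<lambda>y. f y * g y) has_derivative
      (\<lambda>h. f x * frechet_derivative g (at x) h + frechet_derivative f (at x) h * g x)) (at x)"
    using f g by (intro has_derivative_mult) (simp_all add: frechet_derivative_works)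
  from frechet_derivative_at [OF this, symmetric] show ?thesis
    by (simp add: partial_def)
qed

lemma integral_partial_mult:
  fixes f g :: "real^'d::finite \<Rightarrow> real"
  assumes \<Omega>: "open \<Omega>" "bounded \<Omega>"
    and f: "W1_infinity \<Omega> f" "\<And>x. x \<in> \<Omega> \<Longrightarrow> f differentiable (at x)"
    and g: "W1_infinity \<Omega> g" and N: "negligible N" "\<And>x. x \<in> \<Omega> - N \<Longrightarrow> g differentiable (at x)"
  shows "(LINT x:\<Omega>|lebesgue. partial k (\<lambda>y. f y * g y) x) =
    (LINT x:\<Omega>|lebesgue. f x * partial k g x) + (LINT x:\<Omega>|lebesgue. g x * partial k f x)"
proof -
  have cont: "continuous_on (closure \<Omega>) f" "continuous_on (closure \<Omega>) g"
    using f g by (auto simp: W1_infinity_def)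
  have fg: "(\<lambda>x. f x * partial k g x) absolutely_integrable_on \<Omega>"
    "(\<lambda>x. g x * partial k f x) absolutely_integrable_on \<Omega>"
    using f N
    by (auto intro!: continuous_times_absolutely_integrable \<Omega> cont
        partial_absolutely_integrable [OF \<Omega> g N(1)] partial_absolutely_integrable [OF \<Omega> f(1) negligible_empty])
  have "(\<lambda>y. f y * g y) differentiable (at x)" if "x \<in> \<Omega> - N" for x
    using that f N by (intro differentiable_mult) auto
  then have prod: "partial k (\<lambda>y. f y * g y) absolutely_integrable_on \<Omega>"
    by (intro partial_absolutely_integrable [OF \<Omega> W1_infinity_mult [OF \<Omega>(2) f(1) g] N(1)])
  have "integral \<Omega> (partial k (\<lambda>y. f y * g y)) = integral \<Omega> (\<lambda>x. f x * partial k g x + g x * partial k f x)"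
    using f N by (intro integral_spike [OF N(1)]) (simp add: partial_mult mult.commute)
  also have "\<dots> = integral \<Omega> (\<lambda>x. f x * partial k g x) + integral \<Omega> (\<lambda>x. g x * partial k f x)"
    using fg by (intro integral_add set_lebesgue_integral_eq_integral(1))
  finally show ?thesis
    using fg prod by (simp add: set_lebesgue_integral_eq_integral(2))
qed

text \<open>The surface measure is finite, the normal has length 1 almost everywhere, and \<open>f\<close> is bounded.\<close>

lemma boundary_integrable:
  fixes f :: "real^'d::finite \<Rightarrow> real"
  assumes "bounded \<Omega>" and \<sigma>: "surface_measure_normal \<Omega> \<sigma> n"
    and f: "continuous_on (closure \<Omega>) f" and A: "A \<in> sets borel" "A \<subseteq> frontier \<Omega>"
  shows "set_integrable \<sigma> A (\<lambda>x. f x * n x $ k)"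
proof -
  interpret finite_measure \<sigma>
    using \<sigma> by (simp add: surface_measure_normal_def)
  have [measurable_cong]: "sets \<sigma> = sets borel"
    using \<sigma> by (simp add: surface_measure_normal_def)
  have "frontier \<Omega> \<subseteq> closure \<Omega>"
    by (simp add: frontier_def)
  have "bounded (f ` closure \<Omega>)"
    using assms by (intro compact_imp_bounded compact_continuous_image) auto
  then obtain B where B: "\<And>x. x \<in> closure \<Omega> \<Longrightarrow> \<bar>f x\<bar> \<le> B"
    unfolding bounded_iff by auto
  have "AE x in \<sigma>. norm (indicator A x *\<^sub>R (f x * n x $ k)) \<le> \<bar>B\<bar>"
  proof (rule eventually_mono)
    show "AE x in \<sigma>. norm (n x) = 1"
      using \<sigma> by (simp add: surface_measure_normal_def)
    fix x assume "norm (n x) = 1"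
    then have "\<bar>n x $ k\<bar> \<le> 1"
      using component_le_norm_cart [of "n x" k] by simp
    moreover have "\<bar>f x\<bar> \<le> \<bar>B\<bar>" if "x \<in> A"
      using that A \<open>frontier \<Omega> \<subseteq> closure \<Omega>\<close> B [of x] by auto
    ultimately show "norm (indicator A x *\<^sub>R (f x * n x $ k)) \<le> \<bar>B\<bar>"
      using mult_mono [of "\<bar>f x\<bar>" "\<bar>B\<bar>" "\<bar>n x $ k\<bar>" 1] by (auto simp: indicator_def abs_mult)
  qed
  moreover have "(\<lambda>x. indicator A x *\<^sub>R (f x * n x $ k)) \<in> borel_measurable \<sigma>"
  proof -
    have "(\<lambda>x. indicator A x *\<^sub>R f x) \<in> borel_measurable borel"
      using A \<open>frontier \<Omega> \<subseteq> closure \<Omega>\<close>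
      by (intro borel_measurable_continuous_on_indicator continuous_on_subset [OF f]) auto
    moreover have "(\<lambda>x. n x $ k) \<in> borel_measurable borel"
      using \<sigma> by (auto simp: surface_measure_normal_def intro: borel_measurable_continuous_onI measurable_compose [of n]
          intro!: continuous_intros)
    ultimately have "(\<lambda>x. (indicator A x *\<^sub>R f x) * n x $ k) \<in> borel_measurable borel"
      by (rule borel_measurable_times)
    then show ?thesis
      by (simp add: mult.assoc cong: measurable_cong_sets [OF \<open>sets \<sigma> = sets borel\<close> refl])
  qed
  ultimately show ?thesis
    unfolding set_integrable_def by (intro integrable_const_bound)
qed

context constrained_mesh
begin

text \<open>Summation over \<open>j\<close> replaces \<open>\<phi>\<^sub>j\<close> by 1. The boundary term may be extended from the
  outflow boundary to the whole boundary, since \<open>\<phi>\<^sub>i\<close> vanishes on the inflow boundary, and the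
  Gauss-Green formula turns it into the volume term plus an integral with the factor
  \<open>div v = 0\<close>.\<close>

lemma adv_K_row_sum:
  assumes \<Omega>: "open \<Omega>" "bounded \<Omega>" and \<sigma>: "surface_measure_normal \<Omega> \<sigma> n" and v: "divergence_free \<Omega> v"
    and \<Gamma>: "\<Gamma> \<subseteq> frontier \<Omega>" "\<Gamma> \<in> sets borel" "resolves_inflow T \<Gamma>"
    and i: "i \<in> nodes T" "i \<notin> \<Gamma>"
  shows "(\<Sum>j\<in>nodes T. adv_K \<Omega> T \<sigma> n v \<Gamma> i j) = 0"
proof -
  let ?\<phi> = "basis_fun T"
  have W1: "W1_infinity \<Omega> (\<lambda>x. v x $ k)" "W1_infinity \<Omega> (?\<phi> i)" for k
    using v W1_infinity_basis_fun [OF \<Omega>(1) i(1)] by (auto simp: divergence_free_def)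
  have cont: "continuous_on (closure \<Omega>) (\<lambda>x. v x $ k)" for k
    using W1 by (auto simp: W1_infinity_def)
  have diff_v: "(\<lambda>x. v x $ k) differentiable (at x)" if "x \<in> \<Omega>" for x k
  proof -
    from that v obtain D where "(v has_derivative D) (at x)"
      by (auto simp: divergence_free_def differentiable_def)
    then have "((\<lambda>x. v x $ k) has_derivative (\<lambda>h. D h $ k)) (at x)"
      by (rule bounded_linear.has_derivative [OF bounded_linear_vec_nth])
    then show ?thesis
      by (auto simp: differentiable_def)
  qed
  have diff_\<phi>: "?\<phi> i differentiable (at x)" if "x \<in> \<Omega> - skeleton" for x
    using that closure_subset by (intro differentiable_basis_fun [OF i(1)]) auto
  have boundary: "frontier \<Omega> \<subseteq> closure \<Omega>" "frontier \<Omega> \<in> sets borel"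
    by (auto simp: frontier_def)
  have volume: "(\<Sum>j\<in>nodes T. LINT x:\<Omega>|lebesgue. v x $ k * ?\<phi> j x * partial k (?\<phi> i) x)
      = (LINT x:\<Omega>|lebesgue. v x $ k * partial k (?\<phi> i) x)" for k
  proof -
    have "(\<Sum>j\<in>nodes T. LINT x:\<Omega>|lebesgue. v x $ k * ?\<phi> j x * partial k (?\<phi> i) x)
        = (LINT x:\<Omega>|lebesgue. \<Sum>j\<in>nodes T. v x $ k * ?\<phi> j x * partial k (?\<phi> i) x)"
      using diff_\<phi>
      by (intro set_integral_sum [symmetric] continuous_times_absolutely_integrable \<Omega> continuous_intros cont
          continuous_on_basis_fun partial_absolutely_integrable [OF \<Omega> W1(2) negligible_skeleton])
    also have "\<dots> = (LINT x:\<Omega>|lebesgue. v x $ k * partial k (?\<phi> i) x)"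
      using \<Omega> subsetD [OF closure_subset, of _ \<Omega>]
      by (intro set_lebesgue_integral_cong)
        (auto simp: sum_distrib_left [symmetric] sum_distrib_right [symmetric] sum_basis_fun)
    finally show ?thesis .
  qed
  have surface: "(\<Sum>j\<in>nodes T. LINT x:frontier \<Omega> - \<Gamma>|\<sigma>. v x $ k * ?\<phi> j x * (n x $ k * ?\<phi> i x))
      = (LINT x:frontier \<Omega>|\<sigma>. v x $ k * ?\<phi> i x * n x $ k)" for k
  proof -
    have "(\<Sum>j\<in>nodes T. LINT x:frontier \<Omega> - \<Gamma>|\<sigma>. v x $ k * ?\<phi> j x * (n x $ k * ?\<phi> i x))
        = (\<Sum>j\<in>nodes T. LINT x:frontier \<Omega> - \<Gamma>|\<sigma>. v x $ k * ?\<phi> j x * ?\<phi> i x * n x $ k)"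
      by (simp add: ac_simps)
    also have "\<dots> = (LINT x:frontier \<Omega> - \<Gamma>|\<sigma>. \<Sum>j\<in>nodes T. v x $ k * ?\<phi> j x * ?\<phi> i x * n x $ k)"
      using boundary \<Gamma> i
      by (intro set_integral_sum [symmetric] boundary_integrable [OF \<Omega>(2) \<sigma>] continuous_intros cont
          continuous_on_basis_fun) auto
    also have "\<dots> = (LINT x:frontier \<Omega>|\<sigma>. v x $ k * ?\<phi> i x * n x $ k)"
    proof -
      have "indicat_real (frontier \<Omega> - \<Gamma>) x *\<^sub>R (\<Sum>j\<in>nodes T. v x $ k * ?\<phi> j x * ?\<phi> i x * n x $ k)
          = indicat_real (frontier \<Omega>) x *\<^sub>R (v x $ k * ?\<phi> i x * n x $ k)" for x
      proof (cases "x \<in> frontier \<Omega>")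
        case True
        then have "(\<Sum>j\<in>nodes T. v x $ k * ?\<phi> j x * ?\<phi> i x * n x $ k) = v x $ k * ?\<phi> i x * n x $ k"
          using boundary by (auto simp: sum_distrib_left [symmetric] sum_distrib_right [symmetric] sum_basis_fun)
        moreover have "?\<phi> i x = 0" if "x \<in> \<Gamma>"
          using that \<Gamma> i by (auto simp: resolves_inflow_def)
        ultimately show ?thesis
          by (auto simp: indicator_def)
      qed auto
      then show ?thesis
        by (simp add: set_lebesgue_integral_def)
    qed
    finally show ?thesis .
  qed
  have gauss: "(LINT x:frontier \<Omega>|\<sigma>. v x $ k * ?\<phi> i x * n x $ k) =
      (LINT x:\<Omega>|lebesgue. v x $ k * partial k (?\<phi> i) x) +
      (LINT x:\<Omega>|lebesgue. ?\<phi> i x * partial k (\<lambda>y. v y $ k) x)" for k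
  proof -
    have "(LINT x:frontier \<Omega>|\<sigma>. v x $ k * ?\<phi> i x * n x $ k) =
        (LINT x:\<Omega>|lebesgue. partial k (\<lambda>x. v x $ k * ?\<phi> i x) x)"
      using \<sigma> W1_infinity_mult [OF \<Omega>(2) W1] by (simp add: surface_measure_normal_def)
    also have "\<dots> = (LINT x:\<Omega>|lebesgue. v x $ k * partial k (?\<phi> i) x) +
        (LINT x:\<Omega>|lebesgue. ?\<phi> i x * partial k (\<lambda>y. v y $ k) x)"
      by (rule integral_partial_mult [OF \<Omega> W1(1) diff_v W1(2) negligible_skeleton diff_\<phi>])
    finally show ?thesis .
  qed
  have "(\<Sum>k\<in>UNIV. LINT x:\<Omega>|lebesgue. ?\<phi> i x * partial k (\<lambda>y. v y $ k) x)
      = (LINT x:\<Omega>|lebesgue. \<Sum>k\<in>UNIV. ?\<phi> i x * partial k (\<lambda>y. v y $ k) x)"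
    using diff_v
    by (intro set_integral_sum [symmetric] continuous_times_absolutely_integrable \<Omega>
        continuous_on_basis_fun i partial_absolutely_integrable [OF \<Omega> W1(1) negligible_empty]) auto
  also have "\<dots> = (LINT x:\<Omega>|lebesgue. 0)"
    using \<Omega> v by (intro set_lebesgue_integral_cong) (auto simp: sum_distrib_left [symmetric] divergence_free_def)
  finally have div: "(\<Sum>k\<in>UNIV. LINT x:\<Omega>|lebesgue. ?\<phi> i x * partial k (\<lambda>y. v y $ k) x) = 0"
    by simp
  have "(\<Sum>j\<in>nodes T. adv_K \<Omega> T \<sigma> n v \<Gamma> i j) =
      - (\<Sum>k\<in>UNIV. \<Sum>j\<in>nodes T. LINT x:\<Omega>|lebesgue. v x $ k * ?\<phi> j x * partial k (?\<phi> i) x) +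
      (\<Sum>k\<in>UNIV. \<Sum>j\<in>nodes T. LINT x:frontier \<Omega> - \<Gamma>|\<sigma>. v x $ k * ?\<phi> j x * (n x $ k * ?\<phi> i x))"
    unfolding adv_K_def sum.distrib sum_negf by (subst (1 2) sum.swap) (rule refl)
  also have "\<dots> = 0"
    unfolding volume surface gauss sum.distrib using div by simp
  finally show ?thesis .
qed

end

section \<open>Eigenvalues of real matrices\<close>

lemma complex_eigenvalue_of_real:
  fixes A :: "real^'m^'m::finite"
  assumes "h \<noteq> 0" "A *v h = l *\<^sub>R h"
  shows "complex_eigenvalue A (complex_of_real l)"
  unfolding complex_eigenvalue_def
proof (intro exI conjI)
  let ?x = "(\<chi> b. complex_of_real (h $ b)) :: complex^'m"
  show "?x \<noteq> 0"
    using assms(1) by (auto simp: vec_eq_iff)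
  have "(\<Sum>b\<in>UNIV. A $ a $ b * h $ b) = l * h $ a" for a
    using arg_cong [OF assms(2), of "\<lambda>w. w $ a"] by (simp add: matrix_vector_mult_def)
  then have "(\<Sum>b\<in>UNIV. complex_of_real (A $ a $ b) * complex_of_real (h $ b))
      = complex_of_real l * complex_of_real (h $ a)" for a
    by (metis (no_types, lifting) of_real_mult of_real_sum sum.cong)
  then show "(\<chi> a b. complex_of_real (A $ a $ b)) *v ?x = complex_of_real l *s ?x"
    by (simp add: vec_eq_iff matrix_vector_mult_def)
qed

text \<open>A real matrix acts separately on the real and the imaginary part. This transfers the formula for the
  real flux derivative to complex eigenvectors.\<close>

lemma complexified_mult_component:
  fixes A :: "real^'m^'m::finite" and x :: "complex^'m"
  shows "((\<chi> a b. complex_of_real (A $ a $ b)) *v x) $ a =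
    Complex ((A *v (\<chi> b. Re (x $ b))) $ a) ((A *v (\<chi> b. Im (x $ b))) $ a)"
  by (rule complex_eqI) (simp_all add: matrix_vector_mult_def)

lemma complex_eigenvalue_shift:
  fixes A :: "real^'m^'m::finite"
  assumes "complex_eigenvalue (A + s *\<^sub>R mat 1) z"
  shows "complex_eigenvalue A (z - complex_of_real s)"
proof -
  have eq: "(\<chi> a b. complex_of_real ((A + s *\<^sub>R mat 1) $ a $ b)) *v x =
      (\<chi> a b. complex_of_real (A $ a $ b)) *v x + complex_of_real s *s x" for x :: "complex^'m"
    by (simp add: vec_eq_iff matrix_vector_mult_def mat_def distrib_right sum.distrib
        if_distrib [where f = "\<lambda>c. complex_of_real c"] if_distrib [where f = "\<lambda>c. _ * c"]
        if_distrib [where f = "\<lambda>c. c * _"] cong: if_cong)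
  from assms obtain x where "x \<noteq> 0"
    and x: "(\<chi> a b. complex_of_real (A $ a $ b)) *v x + complex_of_real s *s x = z *s x"
    unfolding complex_eigenvalue_def eq by auto
  have "(\<chi> a b. complex_of_real (A $ a $ b)) *v x = z *s x - complex_of_real s *s x"
    using x by (metis add_diff_cancel_right')
  also have "\<dots> = (z - complex_of_real s) *s x"
    by (simp add: vec_eq_iff left_diff_distrib)
  finally show ?thesis
    using \<open>x \<noteq> 0\<close> unfolding complex_eigenvalue_def by blast
qed

lemma complex_eigenvalue_scalar:
  assumes "complex_eigenvalue (s *\<^sub>R mat 1 :: real^'m^'m::finite) z"
  shows "z = complex_of_real s"
proof -
  from assms have "complex_eigenvalue (0 + s *\<^sub>R mat 1 :: real^'m^'m) z"
    by simp
  then have "complex_eigenvalue (0 :: real^'m^'m) (z - complex_of_real s)"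
    by (rule complex_eigenvalue_shift)
  then obtain x :: "complex^'m" where "x \<noteq> 0" "0 = (z - complex_of_real s) *s x"
    by (auto simp: complex_eigenvalue_def matrix_vector_mult_def zero_vec_def)
  then show ?thesis
    by (auto simp: vec_eq_iff)
qed

section \<open>The Euler flux Jacobian\<close>

lemma density_euler_vec [simp]: "density (euler_vec r m e) = r"
  and momentum_euler_vec [simp]: "momentum (euler_vec r m e) = m"
  and total_energy_euler_vec [simp]: "total_energy (euler_vec r m e) = e"
  by (simp_all add: density_def momentum_def total_energy_def euler_vec_def vec_eq_iff)

lemma bounded_linear_density: "bounded_linear density"
  and bounded_linear_momentum: "bounded_linear momentum"
  and bounded_linear_total_energy: "bounded_linear total_energy"
  by (auto intro!: linear_conv_bounded_linear [THEN iffD1] linearI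
      simp: density_def momentum_def total_energy_def vec_eq_iff)

lemma euler_vec_add: "euler_vec r m e + euler_vec r' m' e' = euler_vec (r + r') (m + m') (e + e')"
  and euler_vec_scaleR: "c *\<^sub>R euler_vec r m e = euler_vec (c * r) (c *\<^sub>R m) (c * e)"
  by (auto simp: euler_vec_def vec_eq_iff split: sum.split)

lemma bounded_linear_euler_vec: "bounded_linear (\<lambda>(r, m, e). euler_vec r m e)"
  by (intro linear_conv_bounded_linear [THEN iffD1] linearI)
    (auto simp: euler_vec_add euler_vec_scaleR)

text \<open>The derivative of the pressure at \<open>u\<close> in the direction \<open>h\<close>, see
  \<open>has_derivative_pressure\<close>.\<close>

definition pressure_deriv :: "real \<Rightarrow> 'd::finite euler_state \<Rightarrow> 'd euler_state \<Rightarrow> real" where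
  "pressure_deriv \<gamma> u h =
     (\<gamma> - 1) * (total_energy h - velocity u \<bullet> momentum h + (norm (velocity u))\<^sup>2 / 2 * density h)"

lemma has_derivative_velocity:
  assumes "density u \<noteq> 0"
  shows "(velocity has_derivative
    (\<lambda>h. (1 / density u) *\<^sub>R (momentum h - density h *\<^sub>R velocity u))) (at u)"
proof -
  have "((\<lambda>u. (1 / density u) *\<^sub>R momentum u) has_derivative
      (\<lambda>h. (1 / density u) *\<^sub>R momentum h + (- density h / (density u)\<^sup>2) *\<^sub>R momentum u)) (at u)"
    using assms
    by (auto intro!: derivative_eq_intros bounded_linear_imp_has_derivative
        bounded_linear_density bounded_linear_momentum simp: power2_eq_square field_simps)
  then show ?thesis
    unfolding velocity_def [abs_def]
    by (rule has_derivative_eq_rhs) (auto simp: fun_eq_iff power2_eq_square algebra_simps)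
qed

lemma has_derivative_pressure:
  assumes "density u \<noteq> 0"
  shows "(pressure \<gamma> has_derivative pressure_deriv \<gamma> u) (at u)"
proof -
  let ?dv = "\<lambda>h. (1 / density u) *\<^sub>R (momentum h - density h *\<^sub>R velocity u)"
  have "((\<lambda>u. total_energy u / density u) has_derivative
      (\<lambda>h. (total_energy h * density u - total_energy u * density h) / (density u * density u))) (at u)"
    using assms
    by (intro has_derivative_divide' bounded_linear_imp_has_derivative bounded_linear_density
        bounded_linear_total_energy)
  moreover have "((\<lambda>u. velocity u \<bullet> velocity u) has_derivative (\<lambda>h. velocity u \<bullet> ?dv h + ?dv h \<bullet> velocity u)) (at u)"
    by (intro has_derivative_inner has_derivative_velocity assms)
  ultimately have "((\<lambda>u. (\<gamma> - 1) * density u * (total_energy u / density u - 1/2 * (velocity u \<bullet> velocity u)))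
    has_derivative (\<lambda>h. (\<gamma> - 1) * density u *
        ((total_energy h * density u - total_energy u * density h) / (density u * density u)
          - 1/2 * (velocity u \<bullet> ?dv h + ?dv h \<bullet> velocity u))
      + (\<gamma> - 1) * density h * (total_energy u / density u - 1/2 * (velocity u \<bullet> velocity u)))) (at u)"
    by (intro has_derivative_mult has_derivative_diff has_derivative_mult_right
        bounded_linear_imp_has_derivative [OF bounded_linear_density])
  then show ?thesis
    unfolding pressure_def [abs_def] power2_norm_eq_inner
  proof (rule has_derivative_eq_rhs)
    show "(\<lambda>h. (\<gamma> - 1) * density u *
        ((total_energy h * density u - total_energy u * density h) / (density u * density u)
          - 1/2 * (velocity u \<bullet> ?dv h + ?dv h \<bullet> velocity u))
      + (\<gamma> - 1) * density h * (total_energy u / density u - 1/2 * (velocity u \<bullet> velocity u)))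
      = pressure_deriv \<gamma> u"
      using assms
      by (simp add: fun_eq_iff pressure_deriv_def power2_norm_eq_inner inner_commute inner_diff_right field_simps)
  qed
qed

text \<open>The derivative at \<open>u\<close>, in the direction \<open>h\<close>, of the flux through \<open>c\<close>; the
  auxiliary \<open>s\<close> is the density times the variation of \<open>\<theta>\<close>, the velocity
  along \<open>c\<close>.\<close>

definition flux_deriv :: "real \<Rightarrow> 'd::finite euler_state \<Rightarrow> real^'d \<Rightarrow> 'd euler_state \<Rightarrow> 'd euler_state" where
  "flux_deriv \<gamma> u c h =
     (let \<theta> = velocity u \<bullet> c; s = momentum h \<bullet> c - \<theta> * density h
      in euler_vec (momentum h \<bullet> c)
        (s *\<^sub>R velocity u + \<theta> *\<^sub>R momentum h + pressure_deriv \<gamma> u h *\<^sub>R c)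
        (enthalpy \<gamma> u * s + \<theta> * (total_energy h + pressure_deriv \<gamma> u h)))"

lemma has_derivative_euler_flux:
  assumes "density u \<noteq> 0"
  shows "(euler_flux \<gamma> k has_derivative flux_deriv \<gamma> u (axis k 1)) (at u)"
proof -
  let ?dv = "\<lambda>h. (1 / density u) *\<^sub>R (momentum h - density h *\<^sub>R velocity u)"
  let ?dp = "pressure_deriv \<gamma> u"
  note linear = bounded_linear_imp_has_derivative
  have v: "((\<lambda>u. velocity u $ k) has_derivative (\<lambda>h. ?dv h $ k)) (at u)"
    by (rule bounded_linear.has_derivative [OF bounded_linear_vec_nth has_derivative_velocity [OF assms]])
  have mass: "((\<lambda>u. momentum u $ k) has_derivative (\<lambda>h. momentum h $ k)) (at u)"
    by (rule bounded_linear.has_derivative [OF bounded_linear_vec_nth linear [OF bounded_linear_momentum]])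
  have momentum: "((\<lambda>u. velocity u $ k *\<^sub>R momentum u + pressure \<gamma> u *\<^sub>R axis k 1) has_derivative
      (\<lambda>h. (velocity u $ k *\<^sub>R momentum h + ?dv h $ k *\<^sub>R momentum u) + ?dp h *\<^sub>R axis k 1)) (at u)"
    by (intro has_derivative_add has_derivative_scaleR has_derivative_scaleR_left v
        linear [OF bounded_linear_momentum] has_derivative_pressure assms)
  have energy: "((\<lambda>u. velocity u $ k * (total_energy u + pressure \<gamma> u)) has_derivative
      (\<lambda>h. velocity u $ k * (total_energy h + ?dp h) + ?dv h $ k * (total_energy u + pressure \<gamma> u))) (at u)"
    by (intro has_derivative_mult has_derivative_add v linear [OF bounded_linear_total_energy]
        has_derivative_pressure assms)
  have "((\<lambda>u. case (momentum u $ k, velocity u $ k *\<^sub>R momentum u + pressure \<gamma> u *\<^sub>R axis k 1,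
        velocity u $ k * (total_energy u + pressure \<gamma> u)) of (r, m, e) \<Rightarrow> euler_vec r m e) has_derivative
      (\<lambda>h. case (momentum h $ k,
         (velocity u $ k *\<^sub>R momentum h + ?dv h $ k *\<^sub>R momentum u) + ?dp h *\<^sub>R axis k 1,
         velocity u $ k * (total_energy h + ?dp h) + ?dv h $ k * (total_energy u + pressure \<gamma> u))
        of (r, m, e) \<Rightarrow> euler_vec r m e)) (at u)"
    by (intro bounded_linear.has_derivative [OF bounded_linear_euler_vec] has_derivative_Pair mass momentum energy)
  then have "(euler_flux \<gamma> k has_derivative (\<lambda>h. euler_vec (momentum h $ k)
         ((velocity u $ k *\<^sub>R momentum h + ?dv h $ k *\<^sub>R momentum u) + ?dp h *\<^sub>R axis k 1)
         (velocity u $ k * (total_energy h + ?dp h) + ?dv h $ k * (total_energy u + pressure \<gamma> u)))) (at u)"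
    unfolding euler_flux_def [abs_def] by simp
  moreover have "momentum u = density u *\<^sub>R velocity u"
    using assms by (simp add: velocity_def)
  moreover have "total_energy u + pressure \<gamma> u = density u * enthalpy \<gamma> u"
    using assms by (simp add: enthalpy_def field_simps)
  ultimately show ?thesis
    using assms
    by (elim has_derivative_eq_rhs)
      (simp add: fun_eq_iff flux_deriv_def Let_def inner_axis algebra_simps)
qed

lemma linear_flux_deriv: "linear (\<lambda>c. flux_deriv \<gamma> u c h)"
  by (rule linearI)
    (simp_all add: flux_deriv_def Let_def euler_vec_add euler_vec_scaleR inner_add_right algebra_simps)

lemma flux_jacobian_mult:
  assumes "density u \<noteq> 0"
  shows "flux_jacobian \<gamma> u c *v h = flux_deriv \<gamma> u c h"
proof -
  let ?D = "\<lambda>k. matrix (flux_deriv \<gamma> u (axis k 1))"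
  have "(\<Sum>k\<in>S. c $ k *\<^sub>R ?D k) *v h = (\<Sum>k\<in>S. c $ k *\<^sub>R (?D k *v h))" if "finite S" for S
    using that
    by (induction S rule: finite_induct)
      (simp_all add: matrix_vector_mult_add_rdistrib scaleR_matrix_vector_assoc)
  then have "flux_jacobian \<gamma> u c *v h = (\<Sum>k\<in>UNIV. c $ k *\<^sub>R (?D k *v h))"
    unfolding flux_jacobian_def frechet_derivative_at [OF has_derivative_euler_flux [OF assms], symmetric]
    by simp
  also have "\<dots> = (\<Sum>k\<in>UNIV. c $ k *\<^sub>R flux_deriv \<gamma> u (axis k 1) h)"
    using has_derivative_linear [OF has_derivative_euler_flux [OF assms]] by (simp add: matrix_works)
  also have "\<dots> = flux_deriv \<gamma> u (\<Sum>k\<in>UNIV. c $ k *\<^sub>R axis k 1) h"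
    by (simp add: linear_sum [OF linear_flux_deriv] linear_scale [OF linear_flux_deriv])
  also have "(\<Sum>k\<in>UNIV. c $ k *\<^sub>R axis k 1) = c"
    using basis_expansion [of c] by (simp add: scalar_mult_eq_scaleR)
  finally show ?thesis .
qed

text \<open>For an ideal gas this is the speed of sound \<open>sqrt (\<gamma> p / \<rho>)\<close>.\<close>

definition sound_speed :: "real \<Rightarrow> 'd::finite euler_state \<Rightarrow> real" where
  "sound_speed \<gamma> u = sqrt ((\<gamma> - 1) * (enthalpy \<gamma> u - (norm (velocity u))\<^sup>2 / 2))"

text \<open>The largest modulus of the three eigenvalues of the flux Jacobian in the direction \<open>c\<close>.\<close>

definition wave_speed :: "real \<Rightarrow> 'd::finite euler_state \<Rightarrow> real^'d \<Rightarrow> real" where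
  "wave_speed \<gamma> u c = \<bar>velocity u \<bullet> c\<bar> + sound_speed \<gamma> u * norm c"

text \<open>The enthalpy exceeds the kinetic energy by \<open>\<gamma> p / ((\<gamma> - 1) \<rho>)\<close>.\<close>

lemma sound_speed_squared:
  assumes "\<gamma> > 1" "admissible \<gamma> u"
  shows "(sound_speed \<gamma> u)\<^sup>2 = (\<gamma> - 1) * (enthalpy \<gamma> u - (norm (velocity u))\<^sup>2 / 2)"
    and "sound_speed \<gamma> u > 0"
proof -
  have u: "density u > 0" "pressure \<gamma> u > 0"
    using assms by (auto simp: admissible_def)
  have "(\<gamma> - 1) * (enthalpy \<gamma> u - (norm (velocity u))\<^sup>2 / 2)
      = (\<gamma> - 1) * (total_energy u / density u - 1/2 * (norm (velocity u))\<^sup>2) + (\<gamma> - 1) * (pressure \<gamma> u / density u)"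
    by (simp add: enthalpy_def algebra_simps)
  also have "(\<gamma> - 1) * (total_energy u / density u - 1/2 * (norm (velocity u))\<^sup>2) = pressure \<gamma> u / density u"
    using u by (simp add: pressure_def)
  also have "q + (\<gamma> - 1) * q = \<gamma> * q" for q
    by (simp add: algebra_simps)
  finally have eq: "(\<gamma> - 1) * (enthalpy \<gamma> u - (norm (velocity u))\<^sup>2 / 2) = \<gamma> * (pressure \<gamma> u / density u)" .
  have "\<gamma> * (pressure \<gamma> u / density u) > 0"
    using u assms by simp
  then show "(sound_speed \<gamma> u)\<^sup>2 = (\<gamma> - 1) * (enthalpy \<gamma> u - (norm (velocity u))\<^sup>2 / 2)"
    and "sound_speed \<gamma> u > 0"
    unfolding sound_speed_def eq by simp_all
qed

text \<open>Let \<open>R\<close>, \<open>m\<close>, \<open>e\<close> be the components of an eigenvector, \<open>P\<close> the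
  corresponding variation of the pressure, and \<open>s = z - v \<bullet> c\<close>. If \<open>s \<noteq> 0\<close>, the mass equation
  and the product of the momentum equations with \<open>c\<close> give \<open>s\<^sup>2 R = P |c|\<^sup>2\<close>, and the definition of \<open>P\<close>
  together with the momentum and energy equations gives \<open>P = a\<^sup>2 R\<close>. Moreover
  \<open>R \<noteq> 0\<close>, since otherwise the whole eigenvector would vanish. Hence
  \<open>s\<^sup>2 = a\<^sup>2 |c|\<^sup>2\<close>.\<close>

lemma complex_eigenvalue_flux_jacobian:
  fixes u :: "'d::finite euler_state"
  assumes \<gamma>: "\<gamma> > 1" and u: "admissible \<gamma> u"
    and z: "complex_eigenvalue (flux_jacobian \<gamma> u c) z"
  shows "z \<in> complex_of_real ` {velocity u \<bullet> c, velocity u \<bullet> c + sound_speed \<gamma> u * norm c,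
    velocity u \<bullet> c - sound_speed \<gamma> u * norm c}"
proof -
  obtain x :: "complex^(unit + 'd + unit)" where "x \<noteq> 0"
    and x: "(\<chi> a b. complex_of_real (flux_jacobian \<gamma> u c $ a $ b)) *v x = z *s x"
    using z by (auto simp: complex_eigenvalue_def)
  define xr xi where "xr = (\<chi> a. Re (x $ a))" and "xi = (\<chi> a. Im (x $ a))"
  define R where "R = x $ Inl ()"
  define m where "m l = x $ Inr (Inl l)" for l
  define e where "e = x $ Inr (Inr ())"
  define v where "v = velocity u"
  define \<theta> where "\<theta> = v \<bullet> c"
  define H where "H = enthalpy \<gamma> u"
  define a where "a = sound_speed \<gamma> u"
  define mc where "mc = (\<Sum>l\<in>UNIV. m l * complex_of_real (c $ l))"
  define mv where "mv = (\<Sum>l\<in>UNIV. m l * complex_of_real (v $ l))"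
  define P where "P = complex_of_real (\<gamma> - 1) * (e - mv + complex_of_real ((norm v)\<^sup>2 / 2) * R)"
  define S where "S = mc - complex_of_real \<theta> * R"
  have density: "density u \<noteq> 0"
    using u by (auto simp: admissible_def)
  have parts: "density xr = Re R" "density xi = Im R" "momentum xr $ l = Re (m l)" "momentum xi $ l = Im (m l)"
    "total_energy xr = Re e" "total_energy xi = Im e" "momentum xr \<bullet> c = Re mc" "momentum xi \<bullet> c = Im mc"
    "v \<bullet> momentum xr = Re mv" "v \<bullet> momentum xi = Im mv" for l
    by (simp_all add: xr_def xi_def density_def momentum_def total_energy_def R_def m_def e_def mc_def mv_def
        inner_vec_def mult.commute)
  have P: "pressure_deriv \<gamma> u xr = Re P" "pressure_deriv \<gamma> u xi = Im P"
    by (simp_all add: pressure_deriv_def parts P_def v_def [symmetric])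
  have row: "z * x $ b = Complex (flux_deriv \<gamma> u c xr $ b) (flux_deriv \<gamma> u c xi $ b)" for b
    using arg_cong [OF x, of "\<lambda>y. y $ b"]
    by (simp add: complexified_mult_component flux_jacobian_mult [OF density] xr_def xi_def)
  have mass: "z * R = mc"
    using row [of "Inl ()"] by (simp add: R_def flux_deriv_def euler_vec_def Let_def parts complex_eq_iff)
  have momentum: "z * m l = S * v $ l + \<theta> * m l + P * c $ l" for l
    using row [of "Inr (Inl l)"]
    by (simp add: m_def [symmetric] flux_deriv_def euler_vec_def Let_def parts P S_def v_def [symmetric]
        \<theta>_def [symmetric] complex_eq_iff)
  have energy: "z * e = H * S + \<theta> * (e + P)"
    using row [of "Inr (Inr ())"]
    by (simp add: e_def [symmetric] flux_deriv_def euler_vec_def Let_def parts P S_def v_def [symmetric]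
        \<theta>_def [symmetric] H_def [symmetric] complex_eq_iff)
  define s where "s = z - \<theta>"
  show ?thesis
  proof (cases "s = 0")
    case True
    then show ?thesis
      by (simp add: s_def \<theta>_def v_def)
  next
    case False
    have S: "S = s * R"
      by (simp add: S_def s_def mass [symmetric] algebra_simps)
    have m: "s * m l = s * R * v $ l + P * c $ l" for l
      using momentum [of l] by (simp add: S s_def algebra_simps)
    have e: "s * e = H * s * R + \<theta> * P"
      using energy by (simp add: S s_def algebra_simps)
    have "s * mc = (\<Sum>l\<in>UNIV. (s * m l) * complex_of_real (c $ l))"
      by (simp add: mc_def sum_distrib_left mult.assoc)
    also have "\<dots> = s * R * \<theta> + P * complex_of_real ((norm c)\<^sup>2)"
      by (simp add: m \<theta>_def inner_vec_def power2_norm_eq_inner sum_distrib_left sum.distrib algebra_simps)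
    finally have mc: "s * (s * R) = P * complex_of_real ((norm c)\<^sup>2)"
      by (simp add: mass [symmetric] s_def algebra_simps)
    have "s * mv = (\<Sum>l\<in>UNIV. (s * m l) * complex_of_real (v $ l))"
      by (simp add: mv_def sum_distrib_left mult.assoc)
    also have "\<dots> = s * R * complex_of_real ((norm v)\<^sup>2) + P * \<theta>"
      by (simp add: m \<theta>_def inner_vec_def power2_norm_eq_inner sum_distrib_left sum.distrib algebra_simps)
    finally have mv: "s * mv = s * R * complex_of_real ((norm v)\<^sup>2) + P * \<theta>" .
    have "s * P = complex_of_real (\<gamma> - 1) * (s * e - s * mv + complex_of_real ((norm v)\<^sup>2 / 2) * (s * R))"
      by (simp add: P_def algebra_simps)
    also have "\<dots> = s * (complex_of_real ((\<gamma> - 1) * (H - (norm v)\<^sup>2 / 2)) * R)"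
      by (simp only: e mv) (simp add: algebra_simps)
    also have "(\<gamma> - 1) * (H - (norm v)\<^sup>2 / 2) = a\<^sup>2"
      by (simp add: a_def H_def v_def sound_speed_squared [OF \<gamma> u])
    finally have P_eq: "P = complex_of_real (a\<^sup>2) * R"
      using False by simp
    have "R \<noteq> 0"
    proof
      assume "R = 0"
      then have "P = 0"
        by (simp add: P_eq)
      with \<open>R = 0\<close> have me: "m l = 0" "e = 0" for l
        using m e False by auto
      have "x $ b = 0" for b
      proof (cases b)
        case (Inl a)
        then show ?thesis
          using \<open>R = 0\<close> by (simp add: R_def)
      next
        case (Inr a)
        then show ?thesis
          using me by (cases a) (simp_all add: m_def e_def)
      qed
      then show False
        using \<open>x \<noteq> 0\<close> by (simp add: vec_eq_iff)
    qed
    have "s * s * R = complex_of_real (a * norm c) * complex_of_real (a * norm c) * R"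
      using mc by (simp add: P_eq power2_eq_square algebra_simps)
    then have "s * s = complex_of_real (a * norm c) * complex_of_real (a * norm c)"
      using \<open>R \<noteq> 0\<close> by simp
    then have "s = complex_of_real (a * norm c) \<or> s = - complex_of_real (a * norm c)"
      by (simp add: square_eq_iff)
    then have "z = complex_of_real (\<theta> + a * norm c) \<or> z = complex_of_real (\<theta> - a * norm c)"
      by (auto simp: s_def algebra_simps)
    then show ?thesis
      by (auto simp: \<theta>_def v_def a_def)
  qed
qed

text \<open>The eigenvector is \<open>(1, v \<plusminus> a c / |c|, H \<plusminus> a (v \<bullet> c) / |c|)\<close>, along which the
  pressure varies by \<open>a\<^sup>2\<close>. Division by zero being zero, it is also right for
  \<open>c = 0\<close>, where the Jacobian vanishes.\<close>

lemma acoustic_eigenvalue: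
  assumes \<gamma>: "\<gamma> > 1" and u: "admissible \<gamma> u" and \<tau>: "\<tau>\<^sup>2 = 1"
  shows "complex_eigenvalue (flux_jacobian \<gamma> u c)
    (complex_of_real (velocity u \<bullet> c + \<tau> * (sound_speed \<gamma> u * norm c)))"
proof -
  define v where "v = velocity u"
  define a where "a = sound_speed \<gamma> u"
  define H where "H = enthalpy \<gamma> u"
  define \<theta> where "\<theta> = v \<bullet> c"
  define t where "t = \<tau> * a / norm c"
  define h where "h = euler_vec 1 (v + t *\<^sub>R c) (H + t * \<theta>)"
  have density: "density u \<noteq> 0"
    using u by (auto simp: admissible_def)
  have cc: "c \<bullet> c = norm c * norm c"
    by (simp add: power2_norm_eq_inner [symmetric] power2_eq_square)
  have tc: "t * (c \<bullet> c) = \<tau> * (a * norm c)"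
    by (simp add: t_def cc)
  have ttc: "(\<tau> * (a * norm c)) * t = (if c = 0 then 0 else a\<^sup>2)"
    using \<tau> by (simp add: t_def power2_eq_square)
  have "pressure_deriv \<gamma> u h = (\<gamma> - 1) * (H - (norm v)\<^sup>2 / 2)"
    by (simp add: pressure_deriv_def h_def v_def [symmetric] inner_add_right power2_norm_eq_inner \<theta>_def algebra_simps)
  then have dp: "pressure_deriv \<gamma> u h = a\<^sup>2"
    by (simp add: a_def H_def v_def sound_speed_squared [OF \<gamma> u])
  have hc: "momentum h \<bullet> c = \<theta> + \<tau> * (a * norm c)"
    by (simp add: h_def inner_add_left \<theta>_def tc)
  have "flux_deriv \<gamma> u c h = euler_vec (\<theta> + \<tau> * (a * norm c))
      ((\<tau> * (a * norm c)) *\<^sub>R v + \<theta> *\<^sub>R (v + t *\<^sub>R c) + a\<^sup>2 *\<^sub>R c)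
      (H * (\<tau> * (a * norm c)) + \<theta> * (H + t * \<theta> + a\<^sup>2))"
    by (simp add: flux_deriv_def Let_def hc dp v_def [symmetric] \<theta>_def [symmetric] H_def [symmetric])
      (simp add: h_def)
  also have "\<dots> = (\<theta> + \<tau> * (a * norm c)) *\<^sub>R h"
  proof -
    have "a\<^sup>2 *\<^sub>R c = ((\<tau> * (a * norm c)) * t) *\<^sub>R c"
      unfolding ttc by simp
    then have "(\<tau> * (a * norm c)) *\<^sub>R v + \<theta> *\<^sub>R (v + t *\<^sub>R c) + a\<^sup>2 *\<^sub>R c
        = (\<theta> + \<tau> * (a * norm c)) *\<^sub>R (v + t *\<^sub>R c)"
      by (simp only: scaleR_add_left scaleR_add_right scaleR_scaleR distrib_right) simp
    moreover have "\<theta> * a\<^sup>2 = \<theta> * ((\<tau> * (a * norm c)) * t)"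
      unfolding ttc by (simp add: \<theta>_def)
    then have "H * (\<tau> * (a * norm c)) + \<theta> * (H + t * \<theta> + a\<^sup>2) = (\<theta> + \<tau> * (a * norm c)) * (H + t * \<theta>)"
      unfolding distrib_left [of \<theta> _ "a\<^sup>2"] by (simp only: distrib_left distrib_right) (simp add: ac_simps)
    ultimately show ?thesis
      by (simp only: h_def euler_vec_scaleR) simp
  qed
  finally have "flux_jacobian \<gamma> u c *v h = (\<theta> + \<tau> * (a * norm c)) *\<^sub>R h"
    by (simp add: flux_jacobian_mult [OF density])
  moreover have "h \<noteq> 0"
    using density_euler_vec [of 1 "v + t *\<^sub>R c" "H + t * \<theta>"] by (auto simp: h_def density_def)
  ultimately show ?thesis
    unfolding \<theta>_def v_def a_def by (intro complex_eigenvalue_of_real)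
qed

text \<open>Of the two acoustic eigenvalues, the one whose sign \<open>\<tau>\<close> agrees with that of
  \<open>v \<bullet> c\<close> has the wave speed as its modulus.\<close>

lemma wave_speed_le_spectral_radius:
  assumes "\<gamma> > 1" "admissible \<gamma> u"
  shows "wave_speed \<gamma> u c \<le> spectral_radius (flux_jacobian \<gamma> u c)"
proof -
  define \<tau> :: real where "\<tau> = (if velocity u \<bullet> c \<ge> 0 then 1 else - 1)"
  let ?z = "complex_of_real (velocity u \<bullet> c + \<tau> * (sound_speed \<gamma> u * norm c))"
  have "0 \<le> sound_speed \<gamma> u * norm c"
    using sound_speed_squared(2) [OF assms] by simp
  then have "wave_speed \<gamma> u c = cmod ?z"
    unfolding wave_speed_def norm_of_real \<tau>_def by auto
  also have "\<dots> \<le> spectral_radius (flux_jacobian \<gamma> u c)"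
    unfolding spectral_radius_def
  proof (rule Max_ge)
    have "{z. complex_eigenvalue (flux_jacobian \<gamma> u c) z} \<subseteq>
        complex_of_real ` {velocity u \<bullet> c, velocity u \<bullet> c + sound_speed \<gamma> u * norm c,
          velocity u \<bullet> c - sound_speed \<gamma> u * norm c}"
      using complex_eigenvalue_flux_jacobian [OF assms] by blast
    then show "finite (cmod ` {z. complex_eigenvalue (flux_jacobian \<gamma> u c) z})"
      by (meson finite.emptyI finite_imageI finite_insert finite_subset)
    show "cmod ?z \<in> cmod ` {z. complex_eigenvalue (flux_jacobian \<gamma> u c) z}"
      using acoustic_eigenvalue [OF assms, of \<tau> c] by (intro imageI CollectI) (auto simp: \<tau>_def)
  qed
  finally show ?thesis .
qed

lemma complex_eigenvalue_le_wave_speed: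
  assumes "\<gamma> > 1" "admissible \<gamma> u" "complex_eigenvalue (flux_jacobian \<gamma> u c) z"
  shows "z \<in> \<real> \<and> Re z \<le> wave_speed \<gamma> u c"
proof -
  have "0 \<le> sound_speed \<gamma> u * norm c"
    using sound_speed_squared(2) [OF assms(1,2)] by simp
  moreover have "velocity u \<bullet> c \<le> \<bar>velocity u \<bullet> c\<bar>"
    by simp
  ultimately have le: "r \<le> wave_speed \<gamma> u c" if "r \<in> {velocity u \<bullet> c, velocity u \<bullet> c + sound_speed \<gamma> u * norm c,
      velocity u \<bullet> c - sound_speed \<gamma> u * norm c}" for r
    using that unfolding wave_speed_def by (elim insertE emptyE) linarith+
  from complex_eigenvalue_flux_jacobian [OF assms] show ?thesis
  proof
    fix r assume "z = complex_of_real r" and "r \<in> {velocity u \<bullet> c, velocity u \<bullet> c + sound_speed \<gamma> u * norm c,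
      velocity u \<bullet> c - sound_speed \<gamma> u * norm c}"
    with le [of r] show ?thesis
      by (simp del: insert_iff)
  qed
qed

lemma wave_speed_add:
  assumes "\<gamma> > 1" "admissible \<gamma> u"
  shows "wave_speed \<gamma> u (c + d) \<le> wave_speed \<gamma> u c + wave_speed \<gamma> u d"
proof -
  have "sound_speed \<gamma> u * norm (c + d) \<le> sound_speed \<gamma> u * (norm c + norm d)"
    using sound_speed_squared(2) [OF assms] by (intro mult_left_mono norm_triangle_ineq) simp
  then show ?thesis
    unfolding wave_speed_def inner_add_right by (simp add: algebra_simps)
qed

lemma wave_speed_sum:
  assumes "\<gamma> > 1" "admissible \<gamma> u"
  shows "wave_speed \<gamma> u (\<Sum>k\<in>A. c k) \<le> (\<Sum>k\<in>A. wave_speed \<gamma> u (c k))"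
proof (induction A rule: infinite_finite_induct)
  case (insert k A)
  then show ?case
    using wave_speed_add [OF assms, of "c k" "sum c A"] by simp
qed (simp_all add: wave_speed_def)

lemma wave_speed_scaleR: "0 \<le> t \<Longrightarrow> wave_speed \<gamma> u (t *\<^sub>R c) = t * wave_speed \<gamma> u c"
  by (simp add: wave_speed_def abs_mult algebra_simps)

text \<open>Convexity of the squared norm; the defect is a multiple of \<open>|v - w|\<^sup>2\<close>.\<close>

lemma norm_weighted_mean_squared_le:
  fixes v w :: "'a::real_inner"
  assumes "a > 0" "b > 0"
  shows "(norm ((1 / (a + b)) *\<^sub>R (a *\<^sub>R v + b *\<^sub>R w)))\<^sup>2 \<le> (a * (norm v)\<^sup>2 + b * (norm w)\<^sup>2) / (a + b)"
proof -
  have "(norm (a *\<^sub>R v + b *\<^sub>R w))\<^sup>2 + a * b * (norm (v - w))\<^sup>2 = (a + b) * (a * (norm v)\<^sup>2 + b * (norm w)\<^sup>2)"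
    by (simp add: power2_norm_eq_inner inner_add_left inner_add_right inner_diff_left inner_diff_right
        inner_commute algebra_simps)
  moreover have "0 \<le> a * b * (norm (v - w))\<^sup>2"
    using assms by simp
  ultimately have "(norm (a *\<^sub>R v + b *\<^sub>R w))\<^sup>2 \<le> (a + b) * (a * (norm v)\<^sup>2 + b * (norm w)\<^sup>2)"
    by linarith
  then have "(norm (a *\<^sub>R v + b *\<^sub>R w))\<^sup>2 / (a + b)\<^sup>2 \<le> (a + b) * (a * (norm v)\<^sup>2 + b * (norm w)\<^sup>2) / (a + b)\<^sup>2"
    by (rule divide_right_mono) simp
  also have "\<dots> = (a * (norm v)\<^sup>2 + b * (norm w)\<^sup>2) / (a + b)"
    using assms by (simp add: power2_eq_square)
  finally show ?thesis
    using assms by (simp only: norm_scaleR power_mult_distrib) (simp add: power_divide)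
qed

text \<open>The enthalpy is averaged with the same weights as the velocity, so by convexity it still exceeds the
  kinetic energy of the averaged velocity, which makes the pressure positive.\<close>

lemma admissible_roe:
  assumes \<gamma>: "\<gamma> > 1" and u: "admissible \<gamma> u" and w: "admissible \<gamma> w"
  shows "admissible \<gamma> (roe \<gamma> u w)"
proof -
  define a b r where "a = sqrt (density u)" and "b = sqrt (density w)" and "r = sqrt (density u * density w)"
  define v where "v = (1 / (a + b)) *\<^sub>R (a *\<^sub>R velocity u + b *\<^sub>R velocity w)"
  define H where "H = (enthalpy \<gamma> u * a + enthalpy \<gamma> w * b) / (a + b)"
  have pos: "a > 0" "b > 0" "r > 0"
    using u w by (auto simp: a_def b_def r_def admissible_def)
  have roe: "roe \<gamma> u w = euler_vec r (r *\<^sub>R v) (r * ((H + (\<gamma> - 1) * (norm v)\<^sup>2 / 2) / \<gamma>))"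
    by (simp add: roe_def Let_def a_def b_def r_def v_def H_def)
  have kinetic: "(norm (velocity y))\<^sup>2 / 2 < enthalpy \<gamma> y" if "admissible \<gamma> y" for y :: "'a euler_state"
  proof -
    have "0 < (sound_speed \<gamma> y)\<^sup>2"
      using sound_speed_squared(2) [OF \<gamma> that] by simp
    then show ?thesis
      using \<gamma> by (simp add: sound_speed_squared(1) [OF \<gamma> that] zero_less_mult_iff)
  qed
  have "(norm v)\<^sup>2 \<le> (a * (norm (velocity u))\<^sup>2 + b * (norm (velocity w))\<^sup>2) / (a + b)"
    unfolding v_def using pos by (intro norm_weighted_mean_squared_le) auto
  also have "\<dots> < (a * (2 * enthalpy \<gamma> u) + b * (2 * enthalpy \<gamma> w)) / (a + b)"
    using kinetic [OF u] kinetic [OF w] pos by (intro divide_strict_right_mono add_strict_mono mult_strict_left_mono) auto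
  also have "\<dots> = 2 * H"
    by (simp add: H_def algebra_simps)
  finally have "(norm v)\<^sup>2 / 2 < H"
    by simp
  have "velocity (roe \<gamma> u w) = v"
    using pos by (simp add: roe velocity_def)
  then have "pressure \<gamma> (roe \<gamma> u w) = (\<gamma> - 1) * r * ((H + (\<gamma> - 1) * (norm v)\<^sup>2 / 2) / \<gamma> - 1/2 * (norm v)\<^sup>2)"
    using pos by (simp add: pressure_def roe)
  also have "(H + (\<gamma> - 1) * (norm v)\<^sup>2 / 2) / \<gamma> - 1/2 * (norm v)\<^sup>2 = (H - (norm v)\<^sup>2 / 2) / \<gamma>"
    using \<gamma> by (simp add: field_simps)
  finally have "pressure \<gamma> (roe \<gamma> u w) > 0"
    using \<gamma> pos \<open>(norm v)\<^sup>2 / 2 < H\<close> by simp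
  then show ?thesis
    using pos by (simp add: admissible_def roe)
qed

section \<open>Local bounds preservation\<close>

text \<open>A diagonal mass row acts only on the time derivative at \<open>i\<close>, and zero row sums allow the
  subtraction of \<open>A\<^sub>i\<^sub>j u\<^sub>i\<close> in each term; the form of the equation in terms of differences is
  then the same equation.\<close>

lemma bounds_preserving_rowI:
  assumes "finite N" "i \<in> N"
    and M: "m > 0" "\<And>j. j \<in> N \<Longrightarrow> M i j = (m * of_bool (i = j)) *\<^sub>R mat 1"
    and eigenvalues: "\<And>j z. j \<in> N - {i} \<Longrightarrow> complex_eigenvalue (A i j) z \<Longrightarrow> z \<in> \<real> \<and> Re z \<le> 0"
    and row_sum: "(\<Sum>j\<in>N. A i j) = 0"
  shows "bounds_preserving_row N M A dtu u i"
proof -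
  have mass: "(\<Sum>j\<in>N. M i j *v dtu j) = (\<Sum>j\<in>N. M i j *v dtu i)"
    using M by (intro sum.cong) auto
  have "(\<Sum>j\<in>N. A i j *v w) = 0" for w
  proof -
    have "(\<Sum>j\<in>S. A i j *v w) = (\<Sum>j\<in>S. A i j) *v w" if "finite S" for S
      using that by (induction S rule: finite_induct) (simp_all add: matrix_vector_mult_add_rdistrib)
    then show ?thesis
      using \<open>finite N\<close> row_sum by simp
  qed
  then have "(\<Sum>j\<in>N. A i j *v u j) = (\<Sum>j\<in>N. A i j *v (u j - u i))"
    by (simp add: matrix_vector_mult_diff_distrib sum_subtractf)
  also have "\<dots> = (\<Sum>j\<in>N - {i}. A i j *v (u j - u i))"
    using \<open>finite N\<close> \<open>i \<in> N\<close> by (simp add: sum.remove)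
  finally show ?thesis
    unfolding bounds_preserving_row_def using mass M eigenvalues row_sum by auto
qed

context constrained_mesh
begin

lemma adv_bounds_preserving:
  assumes \<Omega>: "open \<Omega>" "bounded \<Omega>" and \<sigma>: "surface_measure_normal \<Omega> \<sigma> n" and v: "divergence_free \<Omega> v"
    and \<Gamma>: "\<Gamma> \<subseteq> frontier \<Omega>" "\<Gamma> \<in> sets borel" "resolves_inflow T \<Gamma>"
    and i: "i \<in> nodes T" "i \<notin> \<Gamma>"
    and \<alpha>: "\<alpha> i = 1" "\<And>j. j \<in> nodes T \<Longrightarrow> \<alpha> j \<le> 1"
  shows "bounds_preserving_row (nodes T) (stab_mass \<Omega> T \<alpha>) (adv_A \<Omega> T \<sigma> n v \<Gamma> \<alpha>) dtu u i"
proof (rule bounds_preserving_rowI [OF finite_nodes i(1)])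
  show "0 < (\<Sum>k\<in>nodes T. mass \<Omega> T i k)"
    using integral_basis_fun_pos [OF \<Omega> i(1)] by (simp add: row_sum_mass [OF \<Omega> i(1)])
  show "stab_mass \<Omega> T \<alpha> i j = ((\<Sum>k\<in>nodes T. mass \<Omega> T i k) * of_bool (i = j)) *\<^sub>R mat 1" if "j \<in> nodes T" for j
    using \<alpha> that by (intro stab_mass_eq_diagonal)
next
  let ?K = "adv_K \<Omega> T \<sigma> n v \<Gamma>" and ?\<nu> = "adv_nu T (adv_K \<Omega> T \<sigma> n v \<Gamma>) \<alpha>"
  fix j z assume j: "j \<in> nodes T - {i}" and "complex_eigenvalue (adv_A \<Omega> T \<sigma> n v \<Gamma> \<alpha> i j) z"
  then have "z = complex_of_real (?K i j + ?\<nu> i j * ell i j)"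
    unfolding adv_A_def by (intro complex_eigenvalue_scalar)
  moreover have "?K i j \<le> ?\<nu> i j"
    using j \<alpha>(1) by (auto simp: adv_nu_def)
  ultimately show "z \<in> \<real> \<and> Re z \<le> 0"
    using j by (auto simp: ell_def)
next
  let ?K = "adv_K \<Omega> T \<sigma> n v \<Gamma>" and ?\<nu> = "adv_nu T (adv_K \<Omega> T \<sigma> n v \<Gamma>) \<alpha>"
  have "(\<Sum>j\<in>nodes T. ?\<nu> i j * ell i j) = ?\<nu> i i + (\<Sum>j\<in>nodes T - {i}. - ?\<nu> i j)"
  proof -
    have "ell i i = 1" "j \<noteq> i \<Longrightarrow> ell i j = - 1" for j
      by (auto simp: ell_def)
    then show ?thesis
      using i finite_nodes by (subst sum.remove [of _ i]) (auto intro!: sum.cong)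
  qed
  also have "\<dots> = 0"
    by (auto simp: adv_nu_def Let_def sum_negf intro!: sum.cong split: if_splits)
  finally have "(\<Sum>j\<in>nodes T. ?K i j + ?\<nu> i j * ell i j) = 0"
    using adv_K_row_sum [OF \<Omega> \<sigma> v \<Gamma> i] by (simp add: sum.distrib)
  then show "(\<Sum>j\<in>nodes T. adv_A \<Omega> T \<sigma> n v \<Gamma> \<alpha> i j) = 0"
    by (simp add: adv_A_def scaleR_sum_left [symmetric])
qed

text \<open>Subadditivity and homogeneity of the wave speed split the assembled vector into the cell
  contributions. Each of them has its own spectral radius in \<open>\<nu>\<^sub>i\<^sub>j\<close>, with a detector value that
  belongs to \<open>i\<close> or to a hanging node constrained by \<open>i\<close>, and these are at least 1. The other
  argument of each maximum can only increase \<open>\<nu>\<^sub>i\<^sub>j\<close>.\<close>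

lemma wave_speed_conv_le:
  assumes "\<gamma> > 1" and adm: "admissible \<gamma> (u i)" "admissible \<gamma> (u j)"
    and \<alpha>: "\<alpha> i = 1" "\<And>k. k \<in> constrained_by T i \<Longrightarrow> 1 \<le> \<alpha> k"
  shows "wave_speed \<gamma> (roe \<gamma> (u i) (u j)) (conv T i j) \<le> (\<Sum>K\<in>T. euler_nu \<gamma> T u \<alpha> K i j)"
proof -
  let ?w = "roe \<gamma> (u i) (u j)"
  have w: "admissible \<gamma> ?w"
    using assms by (intro admissible_roe)
  define rad where "rad K a b = spectral_radius (flux_jacobian \<gamma> ?w (cell_conv K a b))" for K a b
  define S where "S K a b = wave_speed \<gamma> ?w (cell_conv K a b)" for K a b
  have le: "S K a b \<le> rad K a b" for K a b
    unfolding S_def rad_def using assms(1) w by (rule wave_speed_le_spectral_radius)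
  have nonneg: "0 \<le> S K a b" for K a b
    using sound_speed_squared(2) [OF assms(1) w] by (simp add: S_def wave_speed_def)
  have weighted: "wave_speed \<gamma> ?w (\<Sum>k\<in>A. t k *\<^sub>R cell_conv K (f k) (g k)) \<le> (\<Sum>k\<in>A. t k * S K (f k) (g k))"
    if "\<And>k. 0 \<le> t k" for A t K and f g :: "real^'d \<Rightarrow> real^'d"
    using wave_speed_sum [OF assms(1) w, of "\<lambda>k. t k *\<^sub>R cell_conv K (f k) (g k)" A] that
    by (simp add: wave_speed_scaleR S_def)
  have amplify: "S K a b \<le> t * rad K a b" if "1 \<le> t" for t K a b
    using that le [of K a b] nonneg [of K a b] mult_mono [of 1 t "S K a b" "rad K a b"] by simp
  have amplify_max: "S K a b \<le> max (t * rad K a b) r" "S K a b \<le> max r (t * rad K a b)"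
    if "1 \<le> t" for t r K a b
    using amplify [OF that, of K a b] by auto
  have "wave_speed \<gamma> ?w (conv T i j) \<le> (\<Sum>K\<in>T. wave_speed \<gamma> ?w (cell_conv K i j
     + (\<Sum>k\<in>constrained_by T j. constr T k j *\<^sub>R cell_conv K i k)
     + (\<Sum>k\<in>constrained_by T i. constr T k i *\<^sub>R cell_conv K k j)
     + (\<Sum>k\<in>constrained_by T i \<inter> constrained_by T j. (constr T k i * constr T k j) *\<^sub>R cell_conv K k k)))"
    unfolding conv_def by (rule wave_speed_sum [OF assms(1) w])
  also have "\<dots> \<le> (\<Sum>K\<in>T. S K i j + (\<Sum>k\<in>constrained_by T j. constr T k j * S K i k)
     + (\<Sum>k\<in>constrained_by T i. constr T k i * S K k j)
     + (\<Sum>k\<in>constrained_by T i \<inter> constrained_by T j. (constr T k i * constr T k j) * S K k k))"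
    by (intro sum_mono order_trans [OF wave_speed_add [OF assms(1) w]] add_mono weighted
        mult_nonneg_nonneg constr_nonneg) (simp add: S_def)
  also have "\<dots> \<le> (\<Sum>K\<in>T. euler_nu \<gamma> T u \<alpha> K i j)"
  proof (rule sum_mono)
    fix K
    have "S K i j \<le> max (\<alpha> i * rad K i j) (\<alpha> j * rad K j i)"
      using \<alpha>(1) by (intro amplify_max) simp
    moreover have "(\<Sum>k\<in>constrained_by T j. constr T k j * S K i k)
        \<le> (\<Sum>k\<in>constrained_by T j. constr T k j * max (\<alpha> i * rad K i k) (\<alpha> k * rad K k i))"
      using \<alpha>(1) by (intro sum_mono mult_left_mono amplify_max constr_nonneg) simp
    moreover have "(\<Sum>k\<in>constrained_by T i. constr T k i * S K k j)
        \<le> (\<Sum>k\<in>constrained_by T i. constr T k i * max (\<alpha> k * rad K k j) (\<alpha> j * rad K j k))"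
      using \<alpha>(2) by (intro sum_mono mult_left_mono amplify_max constr_nonneg) auto
    moreover have "(\<Sum>k\<in>constrained_by T i \<inter> constrained_by T j. (constr T k i * constr T k j) * S K k k)
        \<le> (\<Sum>k\<in>constrained_by T i \<inter> constrained_by T j. (constr T k i * constr T k j) * (\<alpha> k * rad K k k))"
      using \<alpha>(2) by (intro sum_mono mult_left_mono amplify mult_nonneg_nonneg constr_nonneg) auto
    ultimately show "S K i j + (\<Sum>k\<in>constrained_by T j. constr T k j * S K i k)
     + (\<Sum>k\<in>constrained_by T i. constr T k i * S K k j)
     + (\<Sum>k\<in>constrained_by T i \<inter> constrained_by T j. (constr T k i * constr T k j) * S K k k)
      \<le> euler_nu \<gamma> T u \<alpha> K i j"
      unfolding euler_nu_def Let_def rad_def by (simp add: mult.assoc)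
  qed
  finally show ?thesis .
qed

lemma euler_bounds_preserving:
  assumes \<Omega>: "open \<Omega>" "bounded \<Omega>" and "\<gamma> > 1"
    and adm: "\<And>j. j \<in> nodes T \<Longrightarrow> admissible \<gamma> (u j)" and i: "i \<in> nodes T"
    and \<alpha>: "\<alpha> i = 1" "\<And>j. j \<in> nodes T \<Longrightarrow> \<alpha> j \<le> 1" "\<And>k. k \<in> constrained_by T i \<Longrightarrow> 1 \<le> \<alpha> k"
  shows "bounds_preserving_row (nodes T) (stab_mass \<Omega> T \<alpha>) (euler_A \<gamma> T u \<alpha>) dtu w i"
proof (rule bounds_preserving_rowI [OF finite_nodes i])
  show "0 < (\<Sum>k\<in>nodes T. mass \<Omega> T i k)"
    using integral_basis_fun_pos [OF \<Omega> i] by (simp add: row_sum_mass [OF \<Omega> i])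
  show "stab_mass \<Omega> T \<alpha> i j = ((\<Sum>k\<in>nodes T. mass \<Omega> T i k) * of_bool (i = j)) *\<^sub>R mat 1" if "j \<in> nodes T" for j
    using \<alpha> that by (intro stab_mass_eq_diagonal)
next
  fix j z assume j: "j \<in> nodes T - {i}" and z: "complex_eigenvalue (euler_A \<gamma> T u \<alpha> i j) z"
  let ?w = "roe \<gamma> (u i) (u j)" and ?\<nu> = "\<Sum>K\<in>T. euler_nu \<gamma> T u \<alpha> K i j"
  have ij: "admissible \<gamma> (u i)" "admissible \<gamma> (u j)"
    using adm i j by auto
  have "euler_A \<gamma> T u \<alpha> i j = flux_jacobian \<gamma> ?w (conv T i j) + (- ?\<nu>) *\<^sub>R mat 1"
    using j by (auto simp: euler_A_def euler_offdiag_def euler_B_def ell_def sum_negf)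
  then have "complex_eigenvalue (flux_jacobian \<gamma> ?w (conv T i j)) (z - complex_of_real (- ?\<nu>))"
    using z by (intro complex_eigenvalue_shift) simp
  from complex_eigenvalue_le_wave_speed [OF \<open>\<gamma> > 1\<close> admissible_roe [OF \<open>\<gamma> > 1\<close> ij] this]
  have real: "z - complex_of_real (- ?\<nu>) \<in> \<real>" and "Re z + ?\<nu> \<le> wave_speed \<gamma> ?w (conv T i j)"
    by auto
  moreover have "wave_speed \<gamma> ?w (conv T i j) \<le> ?\<nu>"
    using \<open>\<gamma> > 1\<close> ij \<alpha>(1,3) by (rule wave_speed_conv_le)
  ultimately have "Re z \<le> 0"
    by linarith
  moreover have "z \<in> \<real>"
    using Reals_add [OF real Reals_of_real, of "- ?\<nu>"] by simp
  ultimately show "z \<in> \<real> \<and> Re z \<le> 0"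
    by simp
next
  show "(\<Sum>j\<in>nodes T. euler_A \<gamma> T u \<alpha> i j) = 0"
    using i finite_nodes by (subst sum.remove [of _ i]) (auto simp: euler_A_def intro!: sum.cong split: if_splits)
qed

text \<open>A hanging node inherits the largest value of its constraining nodes, hence a value of at least 1
  when the extremum is among them.\<close>

lemma sys_detector_extremum:
  assumes "u \<in> Vh \<Omega> T" "q > 1" "\<beta> \<in> J" "i \<in> nodes T" "i \<notin> \<Gamma> \<beta>"
    and "local_discrete_min T (\<lambda>x. u x $ \<beta>) i \<and>
           (\<forall>k \<in> hanging T \<inter> patch T i. u i $ \<beta> \<le> u k $ \<beta>) \<or>
         local_discrete_max T (\<lambda>x. u x $ \<beta>) i \<and>
           (\<forall>k \<in> hanging T \<inter> patch T i. u i $ \<beta> \<ge> u k $ \<beta>)"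
    and "detector_denom T (\<lambda>x. u x $ \<beta>) i \<noteq> 0"
  shows "sys_detector T q \<Gamma> J u i = 1"
    and "j \<in> nodes T \<Longrightarrow> sys_detector T q \<Gamma> J u j \<le> 1"
    and "k \<in> constrained_by T i \<Longrightarrow> 1 \<le> sys_detector T q \<Gamma> J u k"
proof -
  have one: "node_detector T q \<Gamma> J u i = 1"
    using assms by (intro node_detector_eq_1 [where \<beta> = \<beta>]) auto
  then show "sys_detector T q \<Gamma> J u i = 1"
    using assms by (simp add: sys_detector_node)
  show "sys_detector T q \<Gamma> J u j \<le> 1" if "j \<in> nodes T"
    using assms that by (auto simp: sys_detector_node intro!: node_detector_le_1)
  show "1 \<le> sys_detector T q \<Gamma> J u k" if "k \<in> constrained_by T i"
    using sys_detector_hanging_ge [OF that, of q \<Gamma> J u] one by simp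
qed

end

theorem lemma3p1:
  fixes \<Omega> :: "(real^'d) set" and T :: "'d cell set" and q \<Delta>t :: real
  assumes "lipschitz_domain \<Omega>" and "octree_mesh \<Omega> T" and "conforming_constraints T"
    and "q > 1" and "\<Delta>t > 0"
  shows
    "(\<forall>\<sigma> n v (\<Gamma> :: 1 \<Rightarrow> (real^'d) set) (J :: 1 set) (u :: real^'d \<Rightarrow> real^1) un \<beta> i \<alpha>.
        surface_measure_normal \<Omega> \<sigma> n \<and> divergence_free \<Omega> v \<and>
        \<Gamma> 1 \<subseteq> frontier \<Omega> \<and> \<Gamma> 1 \<in> sets borel \<and> resolves_inflow T (\<Gamma> 1) \<and>
        u \<in> Vh \<Omega> T \<and> un \<in> Vh \<Omega> T \<and> J = {1} \<and> \<beta> \<in> J \<and>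
        \<alpha> = sys_detector T q \<Gamma> J u \<and>
        i \<in> nodes T \<and> i \<notin> \<Gamma> \<beta> \<and>
        (local_discrete_min T (\<lambda>x. u x $ \<beta>) i \<and>
           (\<forall>k \<in> hanging T \<inter> patch T i. u i $ \<beta> \<le> u k $ \<beta>) \<or>
         local_discrete_max T (\<lambda>x. u x $ \<beta>) i \<and>
           (\<forall>k \<in> hanging T \<inter> patch T i. u i $ \<beta> \<ge> u k $ \<beta>)) \<and>
        detector_denom T (\<lambda>x. u x $ \<beta>) i \<noteq> 0 \<longrightarrow>
        bounds_preserving_row (nodes T) (stab_mass \<Omega> T \<alpha>) (adv_A \<Omega> T \<sigma> n v (\<Gamma> 1) \<alpha>)
          (\<lambda>j. (u j - un j) /\<^sub>R \<Delta>t) u i) \<and>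
     (\<forall>\<gamma> (\<Gamma> :: unit + 'd + unit \<Rightarrow> (real^'d) set) J (u :: real^'d \<Rightarrow> 'd euler_state) un \<beta> i \<alpha>.
        \<gamma> > 1 \<and> (\<forall>\<beta>. \<Gamma> \<beta> \<subseteq> frontier \<Omega>) \<and>
        u \<in> Vh \<Omega> T \<and> un \<in> Vh \<Omega> T \<and> (\<forall>j \<in> nodes T. admissible \<gamma> (u j)) \<and> \<beta> \<in> J \<and>
        \<alpha> = sys_detector T q \<Gamma> J u \<and>
        i \<in> nodes T \<and> i \<notin> \<Gamma> \<beta> \<and>
        (local_discrete_min T (\<lambda>x. u x $ \<beta>) i \<and>
           (\<forall>k \<in> hanging T \<inter> patch T i. u i $ \<beta> \<le> u k $ \<beta>) \<or>
         local_discrete_max T (\<lambda>x. u x $ \<beta>) i \<and>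
           (\<forall>k \<in> hanging T \<inter> patch T i. u i $ \<beta> \<ge> u k $ \<beta>)) \<and>
        detector_denom T (\<lambda>x. u x $ \<beta>) i \<noteq> 0 \<longrightarrow>
        bounds_preserving_row (nodes T) (stab_mass \<Omega> T \<alpha>) (euler_A \<gamma> T u \<alpha>)
          (\<lambda>j. (u j - un j) /\<^sub>R \<Delta>t) u i)"
proof -
  interpret constrained_mesh \<Omega> T
    using assms by unfold_locales (auto simp: octree_mesh_def)
  have \<Omega>: "open \<Omega>" "bounded \<Omega>"
    using assms by (auto simp: lipschitz_domain_def)
  show ?thesis
  proof (intro conjI allI impI; elim conjE)
    fix \<sigma> n v and \<Gamma> :: "1 \<Rightarrow> (real^'d) set" and J :: "1 set" and u un :: "real^'d \<Rightarrow> real^1" and \<beta> i \<alpha>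
    assume \<sigma>: "surface_measure_normal \<Omega> \<sigma> n" "divergence_free \<Omega> v"
      and \<Gamma>: "\<Gamma> 1 \<subseteq> frontier \<Omega>" "\<Gamma> 1 \<in> sets borel" "resolves_inflow T (\<Gamma> 1)"
      and J: "J = {1}" "\<beta> \<in> J" and \<alpha>: "\<alpha> = sys_detector T q \<Gamma> J u"
      and i: "i \<in> nodes T" "i \<notin> \<Gamma> \<beta>"
      and extremum: "u \<in> Vh \<Omega> T" "local_discrete_min T (\<lambda>x. u x $ \<beta>) i \<and>
           (\<forall>k \<in> hanging T \<inter> patch T i. u i $ \<beta> \<le> u k $ \<beta>) \<or>
         local_discrete_max T (\<lambda>x. u x $ \<beta>) i \<and>
           (\<forall>k \<in> hanging T \<inter> patch T i. u i $ \<beta> \<ge> u k $ \<beta>)"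
        "detector_denom T (\<lambda>x. u x $ \<beta>) i \<noteq> 0"
    have "i \<notin> \<Gamma> 1"
      using i(2) J by (metis singletonD)
    then show "bounds_preserving_row (nodes T) (stab_mass \<Omega> T \<alpha>) (adv_A \<Omega> T \<sigma> n v (\<Gamma> 1) \<alpha>)
          (\<lambda>j. (u j - un j) /\<^sub>R \<Delta>t) u i"
      unfolding \<alpha>
      by (intro adv_bounds_preserving \<Omega> \<sigma> \<Gamma> i(1)
          sys_detector_extremum [where u = u and \<beta> = \<beta> and \<Gamma> = \<Gamma> and J = J, OF extremum(1) \<open>q > 1\<close> J(2) i extremum(2,3)])
  next
    fix \<gamma> and \<Gamma> :: "unit + 'd + unit \<Rightarrow> (real^'d) set" and J and u un :: "real^'d \<Rightarrow> 'd euler_state" and \<beta> i \<alpha>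
    assume \<gamma>: "\<gamma> > 1" and adm: "\<forall>j \<in> nodes T. admissible \<gamma> (u j)"
      and J: "\<beta> \<in> J" and \<alpha>: "\<alpha> = sys_detector T q \<Gamma> J u"
      and i: "i \<in> nodes T" "i \<notin> \<Gamma> \<beta>"
      and extremum: "u \<in> Vh \<Omega> T" "local_discrete_min T (\<lambda>x. u x $ \<beta>) i \<and>
           (\<forall>k \<in> hanging T \<inter> patch T i. u i $ \<beta> \<le> u k $ \<beta>) \<or>
         local_discrete_max T (\<lambda>x. u x $ \<beta>) i \<and>
           (\<forall>k \<in> hanging T \<inter> patch T i. u i $ \<beta> \<ge> u k $ \<beta>)"
        "detector_denom T (\<lambda>x. u x $ \<beta>) i \<noteq> 0"
    show "bounds_preserving_row (nodes T) (stab_mass \<Omega> T \<alpha>) (euler_A \<gamma> T u \<alpha>)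
          (\<lambda>j. (u j - un j) /\<^sub>R \<Delta>t) u i"
      unfolding \<alpha> using adm
      by (intro euler_bounds_preserving \<Omega> \<gamma> i(1)
          sys_detector_extremum [where u = u and \<beta> = \<beta> and \<Gamma> = \<Gamma> and J = J, OF extremum(1) \<open>q > 1\<close> J i extremum(2,3)]) auto
  qed
qed

end
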